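(* Let $\Lambda$ be a cofinal row-finite $k$-graph with no sources. Let $\mathcal{I}_\Lambda$ denote the interior of the isotropy in $\mathcal{G}_\Lambda$. Then $\mathcal{I}_\Lambda$ is closed and $$\mathcal{I}_\Lambda=\{(x,m,x):x\in\Lambda^\infty,\ m\in\operatorname{Per}(\Lambda)\}\cong\Lambda^\infty\times\operatorname{Per}(\Lambda).$$ Moreover, $\mathcal{H}_\Lambda:=\mathcal{G}_\Lambda/\mathcal{I}_\Lambda$ is an amenable, topologically principal, locally compact, Hausdorff, étale groupoid.
   Context: **$k$-graphs.** $0\in\mathbb{N}$. A $k$-graph is a countable small category $\Lambda$ with a functor $d:\Lambda\to\mathbb{N}^k$ such that, writing $\Lambda^n=d^{-1}(n)$, for all $m,n$ the map $(\mu,\nu)\mapsto\mu\nu$ is a bijection of $\{(\mu,\nu)\in\Lambda^m\times\Lambda^n: s(\mu)=r(\nu)\}$ onto $\Lambda^{m+n}$. $\Lambda^0$ is identified with the objects; $r,s$ are the codomain and domain maps. $v\Lambda^n=\{\lambda\in\Lambda^n:r(\lambda)=v\}$; $\Lambda$ is row-finite with no sources if $0<|v\Lambda^n|<\infty$ for all $v\in\Lambda^0$, $n\in\mathbb{N}^k$. $\Omega_k=\{(m,n)\in\mathbb{N}^k\times\mathbb{N}^k:m\le n\}$ is the $k$-graph with $r(m,n)=(m,m)$, $s(m,n)=(n,n)$, $(m,n)(n,p)=(m,p)$, $d(m,n)=n-m$. $\Lambda^\infty$ is the set of degree-preserving functors $x:\Omega_k\to\Lambda$; $x(n):=x(n,n)$,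 $r(x):=x(0)$; $(T^px)(m,n)=x(m+p,n+p)$; for $s(\lambda)=r(x)$, $\lambda x$ is the unique element of $\Lambda^\infty$ with $(\lambda x)(0,d(\lambda))=\lambda$ and $T^{d(\lambda)}(\lambda x)=x$. $\Lambda$ is cofinal if for all $x\in\Lambda^\infty$, $v\in\Lambda^0$ there are $n\in\mathbb{N}^k$ and $\lambda\in\Lambda$ with $r(\lambda)=v$, $s(\lambda)=x(n)$. **Groupoid.** $\mathcal{G}_\Lambda=\{(x,l-m,y)\in\Lambda^\infty\times\mathbb{Z}^k\times\Lambda^\infty: l,m\in\mathbb{N}^k,\ T^lx=T^my\}$ with $r(x,n,y)=x$, $s(x,n,y)=y$ (identifying $(x,0,x)$ with $x$), $(x,n,y)(y,p,z)=(x,n+p,z)$, $(x,n,y)^{-1}=(y,-n,x)$. The sets $Z(\mu,\nu)=\{(\mu x,d(\mu)-d(\nu),\nu x):r(x)=s(\mu)\}$ for $s(\mu)=s(\nu)$ form a basis for its locally compact Hausdorff étale topology; its unit space is $\Lambda^\infty$. The isotropy is $\{g\in\mathcal{G}_\Lambda:r(g)=s(g)\}$. **Periodicity group.** For $\Lambda$ cofinal, write $\mu\sim\nu$ if $s(\mu)=s(\nu)$ and $\mu x=\nu x$ for all $x\in\Lambda^\infty$ with $r(x)=s(\mu)$; $\operatorname{Per}(\Lambda)=\{d(\mu)-d(\nu):\mu\sim\nu\}$, which is a subgroup of $\mathbb{Z}^k$. $\mathcal{G}_\Lambda/\mathcal{I}_\Lambda$ is the quotient by the relation $g\sim h$ iff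 $g\in h\mathcal{I}_\Lambda$, with the quotient topology. A groupoid is topologically principal if the units with trivial isotropy group are dense in the unit space. *)

theory Defs
  imports "HOL-Analysis.Analysis" "HOL-Library.Function_Algebras"
begin

section \<open>Categories and groupoids\<close>

text \<open>Small categories are given by their morphisms only, an object being identified with its
  identity morphism. So src and rng (domain and codomain) are identity-valued, and cmp is
  relevant only on pairs with src f = rng g.\<close>

record 'a cat =
  mor :: "'a set"
  src :: "'a \<Rightarrow> 'a"
  rng :: "'a \<Rightarrow> 'a"
  cmp :: "'a \<Rightarrow> 'a \<Rightarrow> 'a"

definition category :: "('a, 'b) cat_scheme \<Rightarrow> bool" where
  "category C \<longleftrightarrow>
     (\<forall>f\<in>mor C. src C f \<in> mor C \<and> rng C f \<in> mor C \<and>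
        src C (src C f) = src C f \<and> rng C (src C f) = src C f \<and>
        src C (rng C f) = rng C f \<and> rng C (rng C f) = rng C f \<and>
        cmp C (rng C f) f = f \<and> cmp C f (src C f) = f) \<and>
     (\<forall>f\<in>mor C. \<forall>g\<in>mor C. src C f = rng C g \<longrightarrow>
        cmp C f g \<in> mor C \<and> src C (cmp C f g) = src C g \<and> rng C (cmp C f g) = rng C f) \<and>
     (\<forall>f\<in>mor C. \<forall>g\<in>mor C. \<forall>h\<in>mor C. src C f = rng C g \<longrightarrow> src C g = rng C h \<longrightarrow>
        cmp C (cmp C f g) h = cmp C f (cmp C g h))"

definition cat_functor :: "('a, 'c) cat_scheme \<Rightarrow> ('b, 'd) cat_scheme \<Rightarrow> ('a \<Rightarrow> 'b) \<Rightarrow> bool" where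
  "cat_functor C D F \<longleftrightarrow>
     (\<forall>f\<in>mor C. F f \<in> mor D \<and> F (src C f) = src D (F f) \<and> F (rng C f) = rng D (F f)) \<and>
     (\<forall>f\<in>mor C. \<forall>g\<in>mor C. src C f = rng C g \<longrightarrow> F (cmp C f g) = cmp D (F f) (F g))"

record 'a gpd = "'a cat" +
  ginv :: "'a \<Rightarrow> 'a"

definition groupoid :: "('a, 'b) gpd_scheme \<Rightarrow> bool" where
  "groupoid G \<longleftrightarrow> category G \<and>
     (\<forall>g\<in>mor G. ginv G g \<in> mor G \<and> src G (ginv G g) = rng G g \<and> rng G (ginv G g) = src G g \<and>
        cmp G g (ginv G g) = rng G g \<and> cmp G (ginv G g) g = src G g)"

definition units :: "('a, 'b) gpd_scheme \<Rightarrow> 'a set" where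
  "units G = {u \<in> mor G. src G u = u}"

definition isotropy :: "('a, 'b) gpd_scheme \<Rightarrow> 'a set" where
  "isotropy G = {g \<in> mor G. rng G g = src G g}"

definition rfibre :: "('a, 'b) gpd_scheme \<Rightarrow> 'a \<Rightarrow> 'a set" where
  "rfibre G u = {g \<in> mor G. rng G g = u}"


section \<open>Topological groupoids\<close>

definition topological_groupoid :: "('a, 'b) gpd_scheme \<Rightarrow> 'a topology \<Rightarrow> bool" where
  "topological_groupoid G T \<longleftrightarrow> groupoid G \<and> topspace T = mor G \<and>
     continuous_map (subtopology (prod_topology T T) {(g, h). src G g = rng G h}) T
       (\<lambda>(g, h). cmp G g h) \<and>
     continuous_map T T (ginv G)"

definition topological_groupoid_iso ::
    "('a, 'c) gpd_scheme \<Rightarrow> 'a topology \<Rightarrow> ('b, 'd) gpd_scheme \<Rightarrow> 'b topology \<Rightarrow> ('a \<Rightarrow> 'b) \<Rightarrow> bool" where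
  "topological_groupoid_iso G T H U f \<longleftrightarrow>
     topological_groupoid G T \<and> topological_groupoid H U \<and>
     cat_functor G H f \<and> homeomorphic_map T U f"

definition local_homeomorphism :: "'a topology \<Rightarrow> 'b topology \<Rightarrow> ('a \<Rightarrow> 'b) \<Rightarrow> bool" where
  "local_homeomorphism X Y f \<longleftrightarrow>
     (\<forall>x\<in>topspace X. \<exists>U. openin X U \<and> x \<in> U \<and> openin Y (f ` U) \<and>
        homeomorphic_map (subtopology X U) (subtopology Y (f ` U)) f)"

definition etale_groupoid :: "('a, 'b) gpd_scheme \<Rightarrow> 'a topology \<Rightarrow> bool" where
  "etale_groupoid G T \<longleftrightarrow> topological_groupoid G T \<and>
     local_homeomorphism T (subtopology T (units G)) (rng G) \<and>
     local_homeomorphism T (subtopology T (units G)) (src G)"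

definition topologically_principal :: "('a, 'b) gpd_scheme \<Rightarrow> 'a topology \<Rightarrow> bool" where
  "topologically_principal G T \<longleftrightarrow>
     subtopology T (units G) closure_of
       {u \<in> units G. {g \<in> mor G. rng G g = u \<and> src G g = u} = {u}} = units G"

text \<open>Amenability of a locally compact Hausdorff etale groupoid (Anantharaman-Delaroche and
  Renault): there is a net of continuous systems of probability measures on the fibres of the
  range map with \<open>\<parallel>g m\<^sup>s\<^sup>(\<^sup>g\<^sup>) - m\<^sup>r\<^sup>(\<^sup>g\<^sup>)\<parallel>\<^sub>1 \<rightarrow> 0\<close> uniformly on compact sets of \<open>g\<close>.
  In the etale case the fibres are discrete, so a system of probability measures is a function
  \<open>m\<close> on the groupoid whose restriction to each fibre is nonnegative with sum 1, and the
  norm of the difference is an \<open>l\<^sup>1\<close> norm. The net is rendered by a proper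
  filter on the set of such functions.\<close>

definition compactly_supported :: "'a topology \<Rightarrow> ('a \<Rightarrow> real) \<Rightarrow> bool" where
  "compactly_supported T f \<longleftrightarrow> continuous_map T euclideanreal f \<and>
     (\<exists>K. compactin T K \<and> (\<forall>g\<in>topspace T - K. f g = 0))"

definition continuous_prob_system ::
    "('a, 'b) gpd_scheme \<Rightarrow> 'a topology \<Rightarrow> ('a \<Rightarrow> real) \<Rightarrow> bool" where
  "continuous_prob_system G T m \<longleftrightarrow>
     (\<forall>g\<in>mor G. 0 \<le> m g) \<and>
     (\<forall>u\<in>units G. (m has_sum 1) (rfibre G u)) \<and>
     (\<forall>f. compactly_supported T f \<longrightarrow>
        continuous_map (subtopology T (units G)) euclideanreal
          (\<lambda>u. \<Sum>\<^sub>\<infinity>g\<in>rfibre G u. f g * m g))"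

definition amenable :: "('a, 'b) gpd_scheme \<Rightarrow> 'a topology \<Rightarrow> bool" where
  "amenable G T \<longleftrightarrow>
     (\<exists>F :: ('a \<Rightarrow> real) filter. F \<noteq> bot \<and>
        (\<forall>\<^sub>F m in F. continuous_prob_system G T m) \<and>
        (\<forall>K. compactin T K \<longrightarrow>
           uniform_limit K
             (\<lambda>m g. \<Sum>\<^sub>\<infinity>h\<in>rfibre G (rng G g). \<bar>m (cmp G (ginv G g) h) - m h\<bar>)
             (\<lambda>g. 0) F))"


section \<open>Quotients\<close>

definition quotient_topology :: "'a topology \<Rightarrow> ('a \<Rightarrow> 'b) \<Rightarrow> 'b topology" where
  "quotient_topology X q =
     topology (\<lambda>U. U \<subseteq> q ` topspace X \<and> openin X {x \<in> topspace X. q x \<in> U})"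

lemma openin_quotient_topology:
  "openin (quotient_topology X q) U \<longleftrightarrow>
     U \<subseteq> q ` topspace X \<and> openin X {x \<in> topspace X. q x \<in> U}"
proof -
  have "istopology (\<lambda>U. U \<subseteq> q ` topspace X \<and> openin X {x \<in> topspace X. q x \<in> U})"
    unfolding istopology_def
  proof (intro conjI allI impI)
    fix S T
    assume S: "S \<subseteq> q ` topspace X \<and> openin X {x \<in> topspace X. q x \<in> S}"
      and T: "T \<subseteq> q ` topspace X \<and> openin X {x \<in> topspace X. q x \<in> T}"
    then show "S \<inter> T \<subseteq> q ` topspace X" by blast
    have "{x \<in> topspace X. q x \<in> S \<inter> T} =
        {x \<in> topspace X. q x \<in> S} \<inter> {x \<in> topspace X. q x \<in> T}" by blast
    then show "openin X {x \<in> topspace X. q x \<in> S \<inter> T}" using S T by auto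
  next
    fix \<K>
    assume K: "\<forall>U\<in>\<K>. U \<subseteq> q ` topspace X \<and> openin X {x \<in> topspace X. q x \<in> U}"
    then show "\<Union>\<K> \<subseteq> q ` topspace X" by blast
    have "{x \<in> topspace X. q x \<in> \<Union>\<K>} = (\<Union>U\<in>\<K>. {x \<in> topspace X. q x \<in> U})" by blast
    then show "openin X {x \<in> topspace X. q x \<in> \<Union>\<K>}" using K by auto
  qed
  then show ?thesis by (simp add: quotient_topology_def)
qed

lemma topspace_quotient_topology: "topspace (quotient_topology X q) = q ` topspace X"
proof -
  have "{x \<in> topspace X. q x \<in> q ` topspace X} = topspace X" by blast
  then have "openin (quotient_topology X q) (q ` topspace X)"
    by (simp add: openin_quotient_topology)
  then show ?thesis
    by (meson openin_quotient_topology openin_subset openin_topspace subset_antisym)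
qed

lemma quotient_map_quotient_topology: "quotient_map X (quotient_topology X q) q"
  by (auto simp: quotient_map_def topspace_quotient_topology openin_quotient_topology)

definition gcoset :: "('a, 'b) gpd_scheme \<Rightarrow> 'a set \<Rightarrow> 'a \<Rightarrow> 'a set" where
  "gcoset G I g = {cmp G g i |i. i \<in> I \<and> src G g = rng G i}"

text \<open>The elements of G/I are the classes gI with operations induced from representatives. The
  unions range over all representatives, so if an operation depended on the choice, its value
  would not be a single class.\<close>

definition quotient_groupoid :: "('a, 'b) gpd_scheme \<Rightarrow> 'a set \<Rightarrow> 'a set gpd" where
  "quotient_groupoid G I =
     \<lparr> mor = gcoset G I ` mor G,
       src = (\<lambda>A. \<Union>a\<in>A. gcoset G I (src G a)),
       rng = (\<lambda>A. \<Union>a\<in>A. gcoset G I (rng G a)),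
       cmp = (\<lambda>A B. \<Union>a\<in>A. \<Union>b\<in>{b \<in> B. src G a = rng G b}. gcoset G I (cmp G a b)),
       ginv = (\<lambda>A. \<Union>a\<in>A. gcoset G I (ginv G a)) \<rparr>"


section \<open>Higher-rank graphs\<close>

text \<open>\<open>\<nat>\<^sup>k\<close> (and similarly \<open>\<int>\<^sup>k\<close>) is the set of functions on nat that vanish from
  \<open>k\<close> on; the order and the algebraic operations are those of functions, hence pointwise.\<close>

definition natk :: "nat \<Rightarrow> (nat \<Rightarrow> nat) set" where
  "natk k = {n. \<forall>i\<ge>k. n i = 0}"

definition intvec :: "(nat \<Rightarrow> nat) \<Rightarrow> (nat \<Rightarrow> int)" where
  "intvec n = (\<lambda>i. int (n i))"

definition natk_cat :: "nat \<Rightarrow> (nat \<Rightarrow> nat) cat" where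
  "natk_cat k = \<lparr> mor = natk k, src = (\<lambda>_. 0), rng = (\<lambda>_. 0), cmp = (+) \<rparr>"

record 'a kgraph = "'a cat" +
  deg :: "'a \<Rightarrow> (nat \<Rightarrow> nat)"

definition of_degree :: "'a kgraph \<Rightarrow> (nat \<Rightarrow> nat) \<Rightarrow> 'a set" where
  "of_degree \<Lambda> n = {\<mu> \<in> mor \<Lambda>. deg \<Lambda> \<mu> = n}"

definition k_graph :: "nat \<Rightarrow> 'a kgraph \<Rightarrow> bool" where
  "k_graph k \<Lambda> \<longleftrightarrow> category \<Lambda> \<and> countable (mor \<Lambda>) \<and> cat_functor \<Lambda> (natk_cat k) (deg \<Lambda>) \<and>
     (\<forall>m\<in>natk k. \<forall>n\<in>natk k.
        bij_betw (\<lambda>(\<mu>, \<nu>). cmp \<Lambda> \<mu> \<nu>)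
          {(\<mu>, \<nu>). \<mu> \<in> of_degree \<Lambda> m \<and> \<nu> \<in> of_degree \<Lambda> n \<and> src \<Lambda> \<mu> = rng \<Lambda> \<nu>}
          (of_degree \<Lambda> (m + n)))"

definition row_finite_no_sources :: "nat \<Rightarrow> 'a kgraph \<Rightarrow> bool" where
  "row_finite_no_sources k \<Lambda> \<longleftrightarrow>
     (\<forall>v\<in>of_degree \<Lambda> 0. \<forall>n\<in>natk k.
        {\<mu> \<in> of_degree \<Lambda> n. rng \<Lambda> \<mu> = v} \<noteq> {} \<and> finite {\<mu> \<in> of_degree \<Lambda> n. rng \<Lambda> \<mu> = v})"

definition Omega :: "nat \<Rightarrow> ((nat \<Rightarrow> nat) \<times> (nat \<Rightarrow> nat)) kgraph" where
  "Omega k =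
     \<lparr> mor = {(m, n). m \<in> natk k \<and> n \<in> natk k \<and> m \<le> n},
       src = (\<lambda>(m, n). (n, n)),
       rng = (\<lambda>(m, n). (m, m)),
       cmp = (\<lambda>(m, n) (n', p). (m, p)),
       deg = (\<lambda>(m, n). n - m) \<rparr>"

type_synonym 'a path = "(nat \<Rightarrow> nat) \<times> (nat \<Rightarrow> nat) \<Rightarrow> 'a"

text \<open>Paths are extensional functions, so that equality of paths is equality on the morphisms of
  \<open>\<Omega>\<^sub>k\<close>.\<close>

definition inf_paths :: "nat \<Rightarrow> 'a kgraph \<Rightarrow> 'a path set" where
  "inf_paths k \<Lambda> = {x \<in> extensional (mor (Omega k)).
     cat_functor (Omega k) \<Lambda> x \<and> (\<forall>e\<in>mor (Omega k). deg \<Lambda> (x e) = deg (Omega k) e)}"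

definition path_shift :: "nat \<Rightarrow> (nat \<Rightarrow> nat) \<Rightarrow> 'a path \<Rightarrow> 'a path" where
  "path_shift k p x = restrict (\<lambda>(m, n). x (m + p, n + p)) (mor (Omega k))"

definition path_prepend :: "nat \<Rightarrow> 'a kgraph \<Rightarrow> 'a \<Rightarrow> 'a path \<Rightarrow> 'a path" where
  "path_prepend k \<Lambda> \<mu> x =
     (THE y. y \<in> inf_paths k \<Lambda> \<and> y (0, deg \<Lambda> \<mu>) = \<mu> \<and> path_shift k (deg \<Lambda> \<mu>) y = x)"

definition kgraph_cofinal :: "nat \<Rightarrow> 'a kgraph \<Rightarrow> bool" where
  "kgraph_cofinal k \<Lambda> \<longleftrightarrow>
     (\<forall>x\<in>inf_paths k \<Lambda>. \<forall>v\<in>of_degree \<Lambda> 0.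
        \<exists>n\<in>natk k. \<exists>\<mu>\<in>mor \<Lambda>. rng \<Lambda> \<mu> = v \<and> src \<Lambda> \<mu> = x (n, n))"

definition path_equiv :: "nat \<Rightarrow> 'a kgraph \<Rightarrow> 'a \<Rightarrow> 'a \<Rightarrow> bool" where
  "path_equiv k \<Lambda> \<mu> \<nu> \<longleftrightarrow> \<mu> \<in> mor \<Lambda> \<and> \<nu> \<in> mor \<Lambda> \<and> src \<Lambda> \<mu> = src \<Lambda> \<nu> \<and>
     (\<forall>x\<in>inf_paths k \<Lambda>. x (0, 0) = src \<Lambda> \<mu> \<longrightarrow> path_prepend k \<Lambda> \<mu> x = path_prepend k \<Lambda> \<nu> x)"

definition Per :: "nat \<Rightarrow> 'a kgraph \<Rightarrow> (nat \<Rightarrow> int) set" where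
  "Per k \<Lambda> = {intvec (deg \<Lambda> \<mu>) - intvec (deg \<Lambda> \<nu>) |\<mu> \<nu>. path_equiv k \<Lambda> \<mu> \<nu>}"


section \<open>The path groupoid\<close>

definition path_groupoid :: "nat \<Rightarrow> 'a kgraph \<Rightarrow> ('a path \<times> (nat \<Rightarrow> int) \<times> 'a path) gpd" where
  "path_groupoid k \<Lambda> =
     \<lparr> mor = {(x, intvec l - intvec m, y) |x l m y.
                x \<in> inf_paths k \<Lambda> \<and> y \<in> inf_paths k \<Lambda> \<and> l \<in> natk k \<and> m \<in> natk k \<and>
                path_shift k l x = path_shift k m y},
       src = (\<lambda>(x, n, y). (y, 0, y)),
       rng = (\<lambda>(x, n, y). (x, 0, x)),
       cmp = (\<lambda>(x, n, y) (y', p, z). (x, n + p, z)),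
       ginv = (\<lambda>(x, n, y). (y, - n, x)) \<rparr>"

definition cyl :: "nat \<Rightarrow> 'a kgraph \<Rightarrow> 'a \<Rightarrow> 'a \<Rightarrow> ('a path \<times> (nat \<Rightarrow> int) \<times> 'a path) set" where
  "cyl k \<Lambda> \<mu> \<nu> = {(path_prepend k \<Lambda> \<mu> x, intvec (deg \<Lambda> \<mu>) - intvec (deg \<Lambda> \<nu>), path_prepend k \<Lambda> \<nu> x) |x.
     x \<in> inf_paths k \<Lambda> \<and> x (0, 0) = src \<Lambda> \<mu>}"

definition path_groupoid_topology ::
    "nat \<Rightarrow> 'a kgraph \<Rightarrow> ('a path \<times> (nat \<Rightarrow> int) \<times> 'a path) topology" where
  "path_groupoid_topology k \<Lambda> = topology_generated_by
     {cyl k \<Lambda> \<mu> \<nu> |\<mu> \<nu>. \<mu> \<in> mor \<Lambda> \<and> \<nu> \<in> mor \<Lambda> \<and> src \<Lambda> \<mu> = src \<Lambda> \<nu>}"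

text \<open>The infinite-path space is identified with the unit space via \<open>x \<mapsto> (x, 0, x)\<close>.\<close>

definition inf_path_topology :: "nat \<Rightarrow> 'a kgraph \<Rightarrow> 'a path topology" where
  "inf_path_topology k \<Lambda> =
     pullback_topology (inf_paths k \<Lambda>) (\<lambda>x. (x, 0, x)) (path_groupoid_topology k \<Lambda>)"

definition interior_isotropy :: "nat \<Rightarrow> 'a kgraph \<Rightarrow> ('a path \<times> (nat \<Rightarrow> int) \<times> 'a path) set" where
  "interior_isotropy k \<Lambda> = path_groupoid_topology k \<Lambda> interior_of isotropy (path_groupoid k \<Lambda>)"

definition interior_isotropy_groupoid ::
    "nat \<Rightarrow> 'a kgraph \<Rightarrow> ('a path \<times> (nat \<Rightarrow> int) \<times> 'a path) gpd" where
  "interior_isotropy_groupoid k \<Lambda> = (path_groupoid k \<Lambda>)\<lparr>mor := interior_isotropy k \<Lambda>\<rparr>"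

definition interior_isotropy_topology ::
    "nat \<Rightarrow> 'a kgraph \<Rightarrow> ('a path \<times> (nat \<Rightarrow> int) \<times> 'a path) topology" where
  "interior_isotropy_topology k \<Lambda> =
     subtopology (path_groupoid_topology k \<Lambda>) (interior_isotropy k \<Lambda>)"

text \<open>The trivial group bundle \<open>\<Lambda>\<^sup>\<infinity> \<times> Per(\<Lambda>)\<close>, with the discrete topology
  on the second factor.\<close>

definition Per_bundle :: "nat \<Rightarrow> 'a kgraph \<Rightarrow> ('a path \<times> (nat \<Rightarrow> int)) gpd" where
  "Per_bundle k \<Lambda> =
     \<lparr> mor = inf_paths k \<Lambda> \<times> Per k \<Lambda>,
       src = (\<lambda>(x, m). (x, 0)),
       rng = (\<lambda>(x, m). (x, 0)),
       cmp = (\<lambda>(x, m) (x', n). (x, m + n)),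
       ginv = (\<lambda>(x, m). (x, - m)) \<rparr>"

definition Per_bundle_topology :: "nat \<Rightarrow> 'a kgraph \<Rightarrow> ('a path \<times> (nat \<Rightarrow> int)) topology" where
  "Per_bundle_topology k \<Lambda> =
     prod_topology (inf_path_topology k \<Lambda>) (discrete_topology (Per k \<Lambda>))"

definition H_groupoid :: "nat \<Rightarrow> 'a kgraph \<Rightarrow> ('a path \<times> (nat \<Rightarrow> int) \<times> 'a path) set gpd" where
  "H_groupoid k \<Lambda> = quotient_groupoid (path_groupoid k \<Lambda>) (interior_isotropy k \<Lambda>)"

definition H_topology :: "nat \<Rightarrow> 'a kgraph \<Rightarrow> ('a path \<times> (nat \<Rightarrow> int) \<times> 'a path) set topology" where
  "H_topology k \<Lambda> = quotient_topology (path_groupoid_topology k \<Lambda>)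
     (gcoset (path_groupoid k \<Lambda>) (interior_isotropy k \<Lambda>))"

end

theory Submission
  imports Defs
begin

text \<open>An infinite path is determined by its initial segments, and the cylinders
  \<open>Z(x(0,l), y(0,m))\<close> with \<open>T\<^sup>l x = T\<^sup>m y\<close> form a neighbourhood basis of
  \<open>(x, l - m, y)\<close>. If \<open>\<mu> \<sim> \<nu>\<close>, then every path \<open>w\<close> with range \<open>s(\<mu>)\<close> satisfies
  \<open>T\<^sup>d\<^sup>(\<^sup>\<mu>\<^sup>) w = T\<^sup>d\<^sup>(\<^sup>\<nu>\<^sup>) w\<close>, and cofinality transports this property along every infinite path.
  Conversely, if \<open>T\<^sup>l w = T\<^sup>m w\<close> for all \<open>w\<close> with range \<open>y(0)\<close>, then
  \<open>y(0, l + m) \<sim> y(0, m + m)\<close>. This identifies the interior of the isotropy. A set of paths with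
  \<open>T\<^sup>l x = T\<^sup>m x\<close> for some \<open>l - m\<close> outside \<open>Per(\<Lambda>)\<close> therefore has empty interior, and Baire's
  theorem gives topological principality of the quotient. Its amenability is explicit: average the
  point masses at the classes of \<open>(x, a, T\<^sup>a x)\<close> over \<open>a\<close> in a large box; the arrow
  \<open>(x, l - m, y)\<close> only translates the box by \<open>l - m\<close>.\<close>

text \<open>A degree \<open>p = l - m\<close> has many representations, and each basic open set
  belongs to a particular one. Arrows are therefore handled with an explicit pair
  \<open>(l, m)\<close>, and two pairs of the same degree, \<open>l - m = c - d\<close>, are
  reconciled by adding: \<open>(l + c, m + c) = (c + l, d + l)\<close>. Periods get the same
  treatment. The relation ~ ties two morphisms together, which makes it awkward to add periods found
  at different places. It is traded for \<open>per_at v l m\<close>, which mentions only a vertex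
  and two degrees. Such periods add at a fixed vertex and survive to every later vertex of a path,
  and any two vertices of one path have a common later one. Hence Per is a group, as the quotient
  requires. A class in the quotient is a triple \<open>(x, p + Per, y)\<close>. Classes with the
  same ends are separated because the degree is locally constant. In the amenability argument
  different \<open>a\<close> may give the same class. Counting with multiplicity keeps the
  translation exact, so the error is the part of the box without a translated partner. It is uniform
  on compact sets since these admit pairs \<open>(l, m)\<close> of bounded size.\<close>

lemma natk_simps [simp, intro]:
  "0 \<in> natk k"
  "m \<in> natk k \<Longrightarrow> n \<in> natk k \<Longrightarrow> m + n \<in> natk k"
  "m \<in> natk k \<Longrightarrow> m - n \<in> natk k"
  by (auto simp: natk_def)

lemma natk_leE:
  assumes "m \<le> n" "n \<in> natk k" "m \<in> natk k"
  obtains a where "a \<in> natk k" "n = m + a"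
proof
  show "n = m + (n - m)" using assms by (auto simp: le_fun_def)
qed (use assms in auto)

lemma le_add_nat_fun [simp]: "(m::nat \<Rightarrow> nat) \<le> m + a" "m \<le> a + m" "0 \<le> m"
  by (auto simp: le_fun_def)

lemma add_diff_nat_fun [simp]: "(m::nat \<Rightarrow> nat) + a - m = a" "a + m - m = a"
  by (auto simp: fun_eq_iff)

lemma intvec_simps [simp]: "intvec 0 = 0" "intvec (m + n) = intvec m + intvec n"
  by (auto simp: intvec_def fun_eq_iff)

lemma intvec_eq_iff [simp]: "intvec m = intvec n \<longleftrightarrow> m = n"
  by (auto simp: intvec_def fun_eq_iff)

text \<open>Equality of degrees in Z^k becomes an identity in N^k, where representations can be
  compared by adding to them.\<close>

lemma intvec_diff_eq_iff:
  "intvec a - intvec b = intvec c - intvec d \<longleftrightarrow> a + d = c + b"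
proof -
  have "intvec a - intvec b = intvec c - intvec d \<longleftrightarrow> intvec (a + d) = intvec (c + b)"
    unfolding intvec_simps by (auto simp: fun_eq_iff algebra_simps)
  then show ?thesis by (simp only: intvec_eq_iff)
qed

section \<open>Infinite paths\<close>

locale higher_rank_graph =
  fixes k :: nat and \<Lambda> :: "'a kgraph"
  assumes k_graph: "k_graph k \<Lambda>"
begin

abbreviation X where "X \<equiv> inf_paths k \<Lambda>"
abbreviation T where "T \<equiv> path_shift k"
abbreviation N where "N \<equiv> natk k"

section \<open>Unique factorization\<close>

lemma category: "category \<Lambda>"
  and deg_functor: "cat_functor \<Lambda> (natk_cat k) (deg \<Lambda>)"
  using k_graph by (auto simp: k_graph_def)

lemma mor_simps [simp]:
  assumes "f \<in> mor \<Lambda>"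
  shows "src \<Lambda> f \<in> mor \<Lambda>" "rng \<Lambda> f \<in> mor \<Lambda>"
    "src \<Lambda> (src \<Lambda> f) = src \<Lambda> f" "rng \<Lambda> (src \<Lambda> f) = src \<Lambda> f"
    "src \<Lambda> (rng \<Lambda> f) = rng \<Lambda> f" "rng \<Lambda> (rng \<Lambda> f) = rng \<Lambda> f"
    "cmp \<Lambda> (rng \<Lambda> f) f = f" "cmp \<Lambda> f (src \<Lambda> f) = f"
    "deg \<Lambda> f \<in> N" "deg \<Lambda> (src \<Lambda> f) = 0" "deg \<Lambda> (rng \<Lambda> f) = 0"
  using assms category deg_functor
  by (auto simp: category_def cat_functor_def natk_cat_def)

lemma cmp_simps [simp]:
  assumes "f \<in> mor \<Lambda>" "g \<in> mor \<Lambda>" "src \<Lambda> f = rng \<Lambda> g"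
  shows "cmp \<Lambda> f g \<in> mor \<Lambda>" "src \<Lambda> (cmp \<Lambda> f g) = src \<Lambda> g"
    "rng \<Lambda> (cmp \<Lambda> f g) = rng \<Lambda> f" "deg \<Lambda> (cmp \<Lambda> f g) = deg \<Lambda> f + deg \<Lambda> g"
  using assms category deg_functor
  by (auto simp: category_def cat_functor_def natk_cat_def)

lemma cmp_assoc:
  assumes "f \<in> mor \<Lambda>" "g \<in> mor \<Lambda>" "h \<in> mor \<Lambda>" "src \<Lambda> f = rng \<Lambda> g" "src \<Lambda> g = rng \<Lambda> h"
  shows "cmp \<Lambda> (cmp \<Lambda> f g) h = cmp \<Lambda> f (cmp \<Lambda> g h)"
  using assms category by (auto simp: category_def)

lemma factorization_bij:
  assumes "m \<in> N" "n \<in> N"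
  shows "bij_betw (\<lambda>(\<mu>, \<nu>). cmp \<Lambda> \<mu> \<nu>)
          {(\<mu>, \<nu>). \<mu> \<in> of_degree \<Lambda> m \<and> \<nu> \<in> of_degree \<Lambda> n \<and> src \<Lambda> \<mu> = rng \<Lambda> \<nu>}
          (of_degree \<Lambda> (m + n))"
  using k_graph assms by (auto simp: k_graph_def)

text \<open>The bijection fixes the degrees of both factors; cancellation in N^k lets the degree of
  the first factor decide that of the second.\<close>

lemma factorization_unique:
  assumes "\<mu> \<in> mor \<Lambda>" "\<nu> \<in> mor \<Lambda>" "src \<Lambda> \<mu> = rng \<Lambda> \<nu>"
    and "\<mu>' \<in> mor \<Lambda>" "\<nu>' \<in> mor \<Lambda>" "src \<Lambda> \<mu>' = rng \<Lambda> \<nu>'"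
    and eq: "cmp \<Lambda> \<mu> \<nu> = cmp \<Lambda> \<mu>' \<nu>'" and deg: "deg \<Lambda> \<mu> = deg \<Lambda> \<mu>'"
  shows "\<mu> = \<mu>'" "\<nu> = \<nu>'"
proof -
  have "deg \<Lambda> \<mu> + deg \<Lambda> \<nu> = deg \<Lambda> \<mu>' + deg \<Lambda> \<nu>'"
    using assms cmp_simps(4) by metis
  then have "deg \<Lambda> \<nu> = deg \<Lambda> \<nu>'" using deg by simp
  then have "(\<mu>, \<nu>) = (\<mu>', \<nu>')"
    using assms by (intro inj_onD[OF bij_betw_imp_inj_on[OF factorization_bij[of "deg \<Lambda> \<mu>" "deg \<Lambda> \<nu>"]]])
      (auto simp: of_degree_def)
  then show "\<mu> = \<mu>'" "\<nu> = \<nu>'" by auto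
qed

lemma factorization_exists:
  assumes "\<xi> \<in> mor \<Lambda>" "deg \<Lambda> \<xi> = m + n" "m \<in> N" "n \<in> N"
  obtains \<mu> \<nu> where "\<mu> \<in> mor \<Lambda>" "\<nu> \<in> mor \<Lambda>" "src \<Lambda> \<mu> = rng \<Lambda> \<nu>" "deg \<Lambda> \<mu> = m" "deg \<Lambda> \<nu> = n"
    "\<xi> = cmp \<Lambda> \<mu> \<nu>"
proof -
  have "\<xi> \<in> of_degree \<Lambda> (m + n)" using assms by (auto simp: of_degree_def)
  then have "\<xi> \<in> (\<lambda>(\<mu>, \<nu>). cmp \<Lambda> \<mu> \<nu>) ` 
      {(\<mu>, \<nu>). \<mu> \<in> of_degree \<Lambda> m \<and> \<nu> \<in> of_degree \<Lambda> n \<and> src \<Lambda> \<mu> = rng \<Lambda> \<nu>}"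
    using factorization_bij[OF assms(3,4)] unfolding bij_betw_def by blast
  then obtain z where z: "\<xi> = (\<lambda>(\<mu>, \<nu>). cmp \<Lambda> \<mu> \<nu>) z" 
      "z \<in> {(\<mu>, \<nu>). \<mu> \<in> of_degree \<Lambda> m \<and> \<nu> \<in> of_degree \<Lambda> n \<and> src \<Lambda> \<mu> = rng \<Lambda> \<nu>}"
    by (rule imageE)
  then show ?thesis using that[of "fst z" "snd z"] by (auto simp: of_degree_def case_prod_unfold)
qed

text \<open>Composing with the identity on either side gives two factorizations of \<mu> with a
  first factor of degree 0, so the first factors coincide.\<close>

lemma degree_0:
  assumes "\<mu> \<in> mor \<Lambda>" "deg \<Lambda> \<mu> = 0"
  shows "rng \<Lambda> \<mu> = \<mu>" "src \<Lambda> \<mu> = \<mu>"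
proof -
  have "rng \<Lambda> \<mu> = \<mu>"
    by (rule factorization_unique[of _ \<mu> _ "src \<Lambda> \<mu>"]) (use assms in auto)
  then show "rng \<Lambda> \<mu> = \<mu>" "src \<Lambda> \<mu> = \<mu>" using assms mor_simps(5) by metis+
qed

lemma path_simps [simp]:
  assumes "x \<in> X" "m \<in> N" "a \<in> N"
  shows "x (m, m + a) \<in> mor \<Lambda>" "deg \<Lambda> (x (m, m + a)) = a"
    "src \<Lambda> (x (m, m + a)) = x (m + a, m + a)" "rng \<Lambda> (x (m, m + a)) = x (m, m)"
proof -
  have e: "(m, m + a) \<in> mor (Omega k)" using assms by (auto simp: Omega_def)
  have "x (m, m + a) \<in> mor \<Lambda> \<and> x (src (Omega k) (m, m + a)) = src \<Lambda> (x (m, m + a)) \<and>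
      x (rng (Omega k) (m, m + a)) = rng \<Lambda> (x (m, m + a)) \<and>
      deg \<Lambda> (x (m, m + a)) = deg (Omega k) (m, m + a)"
    using assms(1) e unfolding inf_paths_def cat_functor_def by blast
  then show "x (m, m + a) \<in> mor \<Lambda>" "deg \<Lambda> (x (m, m + a)) = a"
    "src \<Lambda> (x (m, m + a)) = x (m + a, m + a)" "rng \<Lambda> (x (m, m + a)) = x (m, m)"
    by (simp_all add: Omega_def)
qed

lemma path_0_simps [simp]:
  assumes "x \<in> X" "m \<in> N"
  shows "x (0, m) \<in> mor \<Lambda>" "deg \<Lambda> (x (0, m)) = m"
    "src \<Lambda> (x (0, m)) = x (m, m)" "rng \<Lambda> (x (0, m)) = x (0, 0)"
    "x (m, m) \<in> mor \<Lambda>" "deg \<Lambda> (x (m, m)) = 0" 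
    "src \<Lambda> (x (m, m)) = x (m, m)" "rng \<Lambda> (x (m, m)) = x (m, m)"
  using path_simps[of x 0 m] path_simps[of x m 0] assms by auto

lemma path_cmp:
  assumes "x \<in> X" "m \<in> N" "a \<in> N" "b \<in> N"
  shows "cmp \<Lambda> (x (m, m + a)) (x (m + a, m + a + b)) = x (m, m + a + b)"
proof -
  have e: "(m, m + a) \<in> mor (Omega k)" "(m + a, m + a + b) \<in> mor (Omega k)"
    using assms by (auto simp: Omega_def add.assoc)
  moreover have "src (Omega k) (m, m + a) = rng (Omega k) (m + a, m + a + b)"
    by (simp add: Omega_def)
  ultimately have "x (cmp (Omega k) (m, m + a) (m + a, m + a + b)) =
      cmp \<Lambda> (x (m, m + a)) (x (m + a, m + a + b))"
    using assms(1) unfolding inf_paths_def cat_functor_def by blast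
  then show ?thesis by (simp add: Omega_def)
qed

lemma path_0_cmp:
  assumes "x \<in> X" "a \<in> N" "b \<in> N"
  shows "cmp \<Lambda> (x (0, a)) (x (a, a + b)) = x (0, a + b)"
  using path_cmp[of x 0 a b] assms by simp

text \<open>Unique factorization of the common segment at degree \<open>m\<close>.\<close>

lemma path_initial:
  assumes "x \<in> X" "y \<in> X" "m \<in> N" "a \<in> N" "x (0, m + a) = y (0, m + a)"
  shows "x (0, m) = y (0, m)" "x (m, m + a) = y (m, m + a)"
proof -
  have eq: "cmp \<Lambda> (x (0, m)) (x (m, m + a)) = cmp \<Lambda> (y (0, m)) (y (m, m + a))"
    using assms by (simp add: path_0_cmp)
  show "x (0, m) = y (0, m)" by (rule factorization_unique(1)[OF _ _ _ _ _ _ eq]) (use assms in auto)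
  show "x (m, m + a) = y (m, m + a)" 
    by (rule factorization_unique(2)[OF _ _ _ _ _ _ eq]) (use assms in auto)
qed

lemma path_initial_le:
  assumes "x \<in> X" "y \<in> X" "m \<in> N" "n \<in> N" "m \<le> n" "x (0, n) = y (0, n)"
  shows "x (0, m) = y (0, m)"
  using assms path_initial(1) by (metis natk_leE)

lemma path_eqI:
  assumes "x \<in> X" "y \<in> X" "\<And>n. n \<in> N \<Longrightarrow> x (0, n) = y (0, n)"
  shows "x = y"
proof (rule extensionalityI[of _ "mor (Omega k)"])
  show "x \<in> extensional (mor (Omega k))" "y \<in> extensional (mor (Omega k))"
    using assms by (auto simp: inf_paths_def)
  fix e assume "e \<in> mor (Omega k)"
  then obtain m n where "e = (m, n)" "m \<in> N" "n \<in> N" "m \<le> n" by (auto simp: Omega_def)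
  then show "x e = y e" using path_initial(2)[OF assms(1,2)] assms(3)
    by (metis natk_leE)
qed

lemma shift_apply [simp]:
  assumes "p \<in> N" "m \<in> N" "a \<in> N"
  shows "T p x (m, m + a) = x (p + m, p + m + a)"
  using assms by (simp add: path_shift_def Omega_def restrict_def add_ac)

lemma shift_apply_0 [simp]:
  assumes "p \<in> N" "a \<in> N"
  shows "T p x (0, a) = x (p, p + a)" "T p x (a, a) = x (p + a, p + a)"
  using shift_apply[of p 0 a x] shift_apply[of p a 0 x] assms by auto

lemma shift_in [simp, intro]:
  assumes "x \<in> X" "p \<in> N"
  shows "T p x \<in> X"
  unfolding inf_paths_def mem_Collect_eq cat_functor_def
proof (intro conjI ballI impI)
  show "T p x \<in> extensional (mor (Omega k))" by (auto simp: path_shift_def)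
next
  fix e assume "e \<in> mor (Omega k)"
  then obtain m a where e: "e = (m, m + a)" "m \<in> N" "a \<in> N"
    by (auto simp: Omega_def elim: natk_leE)
  note [simp] = e(2,3) assms
  show "T p x e \<in> mor \<Lambda>"  using assms e by simp
  show "T p x (src (Omega k) e) = src \<Lambda> (T p x e)"
    using path_simps(3)[of x "p + m" a] by (simp add: e(1) Omega_def) (simp add: add_ac)
  show "T p x (rng (Omega k) e) = rng \<Lambda> (T p x e)" by (simp add: e(1) Omega_def)
  show "deg \<Lambda> (T p x e) = deg (Omega k) e" by (simp add: e(1) Omega_def)
  fix f assume "f \<in> mor (Omega k)" "src (Omega k) e = rng (Omega k) f"
  then obtain b where f: "f = (m + a, m + a + b)" "b \<in> N"
    by (auto simp: Omega_def e elim: natk_leE)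
  show "T p x (cmp (Omega k) e f) = cmp \<Lambda> (T p x e) (T p x f)"
    using path_cmp[of x "p + m" a b] shift_apply[of p m "a + b" x] shift_apply[of p "m + a" b x]
    by (simp add: e(1) f Omega_def add.assoc)
qed

lemma shift_0 [simp]: "x \<in> X \<Longrightarrow> T 0 x = x"
  by (rule path_eqI) auto

lemma shift_shift [simp]:
  assumes "x \<in> X" "p \<in> N" "q \<in> N"
  shows "T p (T q x) = T (q + p) x"
  by (rule path_eqI) (use assms in auto)

text \<open>The uniqueness half of prepending a morphism to a path: a segment reaching past
  \<open>p\<close> is composed of the one up to \<open>p\<close> and a segment of the tail.\<close>

lemma path_eq_shiftI:
  assumes "x \<in> X" "y \<in> X" "p \<in> N" "x (0, p) = y (0, p)" "T p x = T p y"
  shows "x = y"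
proof (rule path_eqI)
  fix n assume n: "n \<in> N"
  have "x (p, p + n) = y (p, p + n)"
    using assms n shift_apply_0(1) by metis
  then have "x (0, p + n) = y (0, p + n)"
    using assms n path_0_cmp by metis
  then show "x (0, n) = y (0, n)"
    using path_initial_le[of x y n "p + n"] assms n by simp
qed (use assms in auto)

text \<open>The morphisms connecting the prescribed initial segments are unique and hence compose,
  so they form a functor on \<open>Omega k\<close>.\<close>

lemma path_of_coherent:
  assumes mor: "\<And>n. n \<in> N \<Longrightarrow> f n \<in> mor \<Lambda> \<and> deg \<Lambda> (f n) = n"
    and coh: "\<And>m a. m \<in> N \<Longrightarrow> a \<in> N \<Longrightarrow> \<exists>\<nu>\<in>mor \<Lambda>. src \<Lambda> (f m) = rng \<Lambda> \<nu> \<and> f (m + a) = cmp \<Lambda> (f m) \<nu>"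
  obtains x where "x \<in> X" "\<And>n. n \<in> N \<Longrightarrow> x (0, n) = f n"
proof -
  \<comment> \<open>The connecting morphism from degree \<open>m\<close> to degree
    \<open>m + a\<close>. Cancelling \<open>f m\<close> on the left determines it, which yields its
    identity and composition laws.\<close>
  define g where "g m a = (SOME \<nu>. \<nu> \<in> mor \<Lambda> \<and> src \<Lambda> (f m) = rng \<Lambda> \<nu> \<and> f (m + a) = cmp \<Lambda> (f m) \<nu>)" for m a
  have "g m a \<in> mor \<Lambda> \<and> src \<Lambda> (f m) = rng \<Lambda> (g m a) \<and> f (m + a) = cmp \<Lambda> (f m) (g m a)"
    if "m \<in> N" "a \<in> N" for m a
    unfolding g_def by (rule someI_ex) (use coh[OF that] in blast)
  then have g: "g m a \<in> mor \<Lambda>" "src \<Lambda> (f m) = rng \<Lambda> (g m a)" "f (m + a) = cmp \<Lambda> (f m) (g m a)"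
    if "m \<in> N" "a \<in> N" for m a using that by blast+
  have deg_g: "deg \<Lambda> (g m a) = a" if "m \<in> N" "a \<in> N" for m a
  proof -
    have "m + a = m + deg \<Lambda> (g m a)"
      using mor[of "m + a"] mor[of m] cmp_simps(4)[of "f m" "g m a"] g[OF that] that by auto
    then show ?thesis by simp
  qed
  have g0: "g m 0 = src \<Lambda> (f m)" if "m \<in> N" for m
  proof (rule factorization_unique(2)[of "f m" _ "f m"])
    show "cmp \<Lambda> (f m) (g m 0) = cmp \<Lambda> (f m) (src \<Lambda> (f m))"
      using mor[OF that] g(3)[of m 0] that by (simp del: cmp_simps)
  qed (use mor[of m] g[of m 0] that in simp_all)
  have src_g: "src \<Lambda> (g m a) = src \<Lambda> (f (m + a))" if "m \<in> N" "a \<in> N" for m a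
    using g[OF that] mor that by auto
  have g_add: "g m (a + b) = cmp \<Lambda> (g m a) (g (m + a) b)" if that: "m \<in> N" "a \<in> N" "b \<in> N" for m a b
  proof (rule factorization_unique(2)[of "f m" _ "f m"])
    have [simp]: "src \<Lambda> (g m a) = rng \<Lambda> (g (m + a) b)"
      using src_g[OF that(1,2)] g(2)[of "m + a" b] that by auto
    show "cmp \<Lambda> (g m a) (g (m + a) b) \<in> mor \<Lambda>" 
      using g(1) that by simp
    show "src \<Lambda> (f m) = rng \<Lambda> (cmp \<Lambda> (g m a) (g (m + a) b))"
      using g(1) g(2)[OF that(1,2)] that by simp
    have "cmp \<Lambda> (f m) (g m (a + b)) = cmp \<Lambda> (f (m + a)) (g (m + a) b)"
      using g(3)[of m "a + b"] g(3)[of "m + a" b] that by (simp add: add.assoc)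
    also have "\<dots> = cmp \<Lambda> (f m) (cmp \<Lambda> (g m a) (g (m + a) b))"
      using g(1,3) g(2)[OF that(1,2)] src_g[OF that(1,2)] g(2)[of "m + a" b] that mor 
      by (simp add: cmp_assoc del: cmp_simps)
    finally show "cmp \<Lambda> (f m) (g m (a + b)) = cmp \<Lambda> (f m) (cmp \<Lambda> (g m a) (g (m + a) b))" .
  qed (use mor g(1) g(2)[of m "a + b"] that in simp_all)
  define x where "x = restrict (\<lambda>(m, n). g m (n - m)) (mor (Omega k))"
  have x: "x (m, m + a) = g m a" if "m \<in> N" "a \<in> N" for m a
    using that by (auto simp: x_def Omega_def restrict_def)
  have xid: "x (m, m) = g m 0" if "m \<in> N" for m
    using x[of m 0] that by simp
  have "x \<in> X"
    unfolding inf_paths_def mem_Collect_eq cat_functor_def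
  proof (intro conjI ballI impI)
    show "x \<in> extensional (mor (Omega k))" by (auto simp: x_def)
  next
    fix e assume "e \<in> mor (Omega k)"
    then obtain m a where e: "e = (m, m + a)" "m \<in> N" "a \<in> N"
      by (auto simp: Omega_def elim: natk_leE)
    note [simp] = e(2,3) x
    show "x e \<in> mor \<Lambda>"  using g e by simp
    show "x (src (Omega k) e) = src \<Lambda> (x e)"
      by (simp add: e(1) Omega_def xid g0 src_g)
    show "x (rng (Omega k) e) = rng \<Lambda> (x e)" 
      using g by (simp add: e(1) Omega_def xid g0)
    show "deg \<Lambda> (x e) = deg (Omega k) e" by (simp add: e(1) Omega_def deg_g)
    fix f assume "f \<in> mor (Omega k)" "src (Omega k) e = rng (Omega k) f"
    then obtain b where f: "f = (m + a, m + a + b)" "b \<in> N"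
      by (auto simp: Omega_def e elim: natk_leE)
    show "x (cmp (Omega k) e f) = cmp \<Lambda> (x e) (x f)"
      using x[of m "a + b"] x[of "m + a" b] f(2) by (simp add: e(1) f(1) Omega_def g_add add.assoc)
  qed
  moreover have "x (0, n) = f n" if n: "n \<in> N" for n
  proof -
    \<comment> \<open>A morphism of degree 0 is a vertex, so \<open>f 0\<close> acts as an identity
      and \<open>g 0 n\<close> is \<open>f n\<close> itself.\<close>
    have "f 0 = src \<Lambda> (f 0)" using mor[of 0] degree_0[of "f 0"] by auto
    then have "f n = g 0 n" using g[of 0 n] n mor[of 0]
      by (metis add_0 mor_simps(7) natk_simps(1) degree_0(1))
    then show ?thesis using x[of 0 n] n by auto
  qed
  ultimately show ?thesis using that by blast
qed

section \<open>Paths from chains of prefixes\<close>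

definition prefix :: "'a \<Rightarrow> 'a \<Rightarrow> bool" where
  "prefix \<mu> \<xi> \<longleftrightarrow> \<mu> \<in> mor \<Lambda> \<and> (\<exists>\<nu>\<in>mor \<Lambda>. src \<Lambda> \<mu> = rng \<Lambda> \<nu> \<and> \<xi> = cmp \<Lambda> \<mu> \<nu>)"

lemma prefix_refl: "\<mu> \<in> mor \<Lambda> \<Longrightarrow> prefix \<mu> \<mu>"
  unfolding prefix_def by (metis mor_simps(1,4,8))

lemma prefix_mor: "prefix \<mu> \<xi> \<Longrightarrow> \<mu> \<in> mor \<Lambda>" "prefix \<mu> \<xi> \<Longrightarrow> \<xi> \<in> mor \<Lambda>"
  unfolding prefix_def by auto

lemma prefix_trans: "prefix \<mu> \<nu> \<Longrightarrow> prefix \<nu> \<xi> \<Longrightarrow> prefix \<mu> \<xi>"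
  unfolding prefix_def using cmp_assoc cmp_simps by metis

lemma prefix_exists:
  assumes "\<xi> \<in> mor \<Lambda>" "n \<in> N" "n \<le> deg \<Lambda> \<xi>"
  obtains \<mu> where "prefix \<mu> \<xi>" "deg \<Lambda> \<mu> = n"
proof -
  have "deg \<Lambda> \<xi> \<in> N" using assms by simp
  then obtain a where "a \<in> N" "deg \<Lambda> \<xi> = n + a" using assms natk_leE by metis
  then show ?thesis using factorization_exists assms that unfolding prefix_def by metis
qed

lemma prefix_unique: "prefix \<mu> \<xi> \<Longrightarrow> prefix \<nu> \<xi> \<Longrightarrow> deg \<Lambda> \<mu> = deg \<Lambda> \<nu> \<Longrightarrow> \<mu> = \<nu>"
  unfolding prefix_def using factorization_unique(1) by metis

text \<open>The prefix of \<nu> of degree \<open>deg \<Lambda> \<mu>\<close> is also a prefix of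
  \<xi>, and \<xi> has only one of that degree.\<close>

lemma prefix_linear:
  assumes "prefix \<mu> \<xi>" "prefix \<nu> \<xi>" "deg \<Lambda> \<mu> \<le> deg \<Lambda> \<nu>"
  shows "prefix \<mu> \<nu>"
proof -
  obtain \<mu>' where "prefix \<mu>' \<nu>" "deg \<Lambda> \<mu>' = deg \<Lambda> \<mu>"
    using assms by (metis prefix_exists prefix_mor(1) mor_simps(9))
  then show ?thesis using assms prefix_trans prefix_unique by metis
qed

text \<open>The multiples of (1, ..., 1) form a chain cofinal in N^k, so that paths can be built
  along a sequence.\<close>

definition diag :: "nat \<Rightarrow> nat \<Rightarrow> nat" where
  "diag j = (\<lambda>i. if i < k then j else 0)"

lemma diag_in [simp, intro]: "diag j \<in> N" by (auto simp: diag_def natk_def)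

lemma diag_Suc: "diag (Suc j) = diag j + diag 1" by (auto simp: diag_def)

lemma diag_0 [simp]: "diag 0 = 0" by (auto simp: diag_def)

lemma diag_cofinal: 
  assumes "n \<in> N" shows "\<exists>j. n \<le> diag j"
proof
  \<comment> \<open>The index \<open>k\<close>, where \<open>n\<close> vanishes, keeps the set
    nonempty when \<open>k\<close> is 0.\<close>
  show "n \<le> diag (Max (n ` {..k}))"
    using assms by (auto simp: le_fun_def diag_def natk_def Max_ge_iff)
qed

text \<open>The segment of degree \<open>n\<close> is read off any \<open>w j\<close> of degree at
  least \<open>n\<close>; uniqueness of prefixes makes the result independent of \<open>j\<close>
  and the segments coherent.\<close>

lemma path_of_prefixes:
  assumes pre: "\<And>j. prefix (w j) (w (Suc j))"
    and cof: "\<And>n. n \<in> N \<Longrightarrow> \<exists>j. n \<le> deg \<Lambda> (w j)"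
  obtains x where "x \<in> X" "\<And>j. x (0, deg \<Lambda> (w j)) = w j"
proof -
  have mono: "prefix (w i) (w j)" if "i \<le> j" for i j
    using that
  proof (induction rule: dec_induct)
    case base then show ?case using prefix_refl prefix_mor pre by blast
  qed (use prefix_trans pre in blast)
  have "\<exists>\<mu> j. prefix \<mu> (w j) \<and> deg \<Lambda> \<mu> = n" if "n \<in> N" for n
    using cof[OF that] that by (metis prefix_exists pre prefix_mor(1))
  then obtain f J where f: "prefix (f n) (w (J n))" "deg \<Lambda> (f n) = n" if "n \<in> N" for n by metis
  have coh: "prefix (f m) (f (m + a))" if "m \<in> N" "a \<in> N" for m a
  proof -
    define j where "j = max (J m) (J (m + a))"
    have "prefix (f m) (w j)" "prefix (f (m + a)) (w j)"
      using f(1) mono that prefix_trans by (metis j_def max.cobounded1 max.cobounded2 natk_simps(2))+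
    then show ?thesis using prefix_linear f(2) that by (metis le_add_nat_fun(1) natk_simps(2))
  qed
  obtain x where x: "x \<in> X" "\<And>n. n \<in> N \<Longrightarrow> x (0, n) = f n"
  proof (rule path_of_coherent[of f])
    show "f n \<in> mor \<Lambda> \<and> deg \<Lambda> (f n) = n" if "n \<in> N" for n using f that prefix_mor by blast
    show "\<exists>\<nu>\<in>mor \<Lambda>. src \<Lambda> (f m) = rng \<Lambda> \<nu> \<and> f (m + a) = cmp \<Lambda> (f m) \<nu>" if "m \<in> N" "a \<in> N" for m a
      using coh[OF that] unfolding prefix_def by blast
  qed blast
  have "x (0, deg \<Lambda> (w j)) = w j" for j
  proof -
    define n where "n = deg \<Lambda> (w j)"
    have n: "n \<in> N" unfolding n_def using pre[THEN prefix_mor(1)] by simp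
    have "prefix (f n) (w (max j (J n)))" "prefix (w j) (w (max j (J n)))"
      using f(1)[OF n] mono prefix_trans by (metis max.cobounded1 max.cobounded2)+
    then have "f n = w j" using prefix_unique f(2)[OF n] n_def by blast
    then show ?thesis using x(2)[OF n] n_def by simp
  qed
  then show ?thesis using that x(1) by blast
qed

lemma path_src: "x \<in> X \<Longrightarrow> n \<in> N \<Longrightarrow> x (0, n) = \<mu> \<Longrightarrow> src \<Lambda> \<mu> = x (n, n)"
  by auto

text \<open>The existence half of prepending. The chain consists of the composites of \<mu> with
  \<open>x (0, diag j)\<close>; factorizing at the degree of \<mu> recovers both \<mu> and the
  tail.\<close>

lemma prepend_exists:
  assumes "\<mu> \<in> mor \<Lambda>" "x \<in> X" "x (0, 0) = src \<Lambda> \<mu>"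
  obtains y where "y \<in> X" "y (0, deg \<Lambda> \<mu>) = \<mu>" "T (deg \<Lambda> \<mu>) y = x"
proof -
  define w where "w j = cmp \<Lambda> \<mu> (x (0, diag j))" for j
  have deg_w: "deg \<Lambda> (w j) = deg \<Lambda> \<mu> + diag j" for j
    using assms by (simp add: w_def)
  obtain y where y: "y \<in> X" "\<And>j. y (0, deg \<Lambda> \<mu> + diag j) = w j"
  proof (rule path_of_prefixes[of w, unfolded deg_w])
    fix j show "prefix (w j) (w (Suc j))"
      unfolding prefix_def w_def diag_Suc
    proof (intro conjI bexI[of _ "x (diag j, diag j + diag 1)"])
      show "cmp \<Lambda> \<mu> (x (0, diag j + diag 1)) = cmp \<Lambda> (cmp \<Lambda> \<mu> (x (0, diag j))) (x (diag j, diag j + diag 1))"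
        using assms by (subst cmp_assoc) (auto simp: path_0_cmp)
    qed (use assms in auto)
  next
    fix n assume "n \<in> N"
    then obtain j where "n \<le> diag j" using diag_cofinal by blast
    then have "n \<le> deg \<Lambda> \<mu> + diag j" by (auto simp: le_fun_def intro: trans_le_add2)
    then show "\<exists>j. n \<le> deg \<Lambda> \<mu> + diag j" ..
  qed blast
  let ?d = "deg \<Lambda> \<mu>"
  have d: "?d \<in> N" using assms by simp
  have fac: "y (0, ?d) = \<mu>" "y (?d, ?d + diag j) = x (0, diag j)" for j
  proof -
    have eq: "cmp \<Lambda> (y (0, ?d)) (y (?d, ?d + diag j)) = cmp \<Lambda> \<mu> (x (0, diag j))"
      using y(1) y(2)[of j] d by (simp add: path_0_cmp w_def)
    show "y (0, ?d) = \<mu>" "y (?d, ?d + diag j) = x (0, diag j)"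
      by (rule factorization_unique[OF _ _ _ _ _ _ eq]; use assms y(1) d in simp)+
  qed
  have "T ?d y = x"
  proof (rule path_eqI)
    fix n assume n: "n \<in> N"
    then obtain j where "n \<le> diag j" using diag_cofinal by blast
    then show "T ?d y (0, n) = x (0, n)"
      by (intro path_initial_le[of "T ?d y" x n "diag j"]) (use assms y(1) d n fac in auto)
  qed (use assms y(1) d in auto)
  then show ?thesis using that y fac by blast
qed

lemma prepend_eqI:
  assumes "y \<in> X" "\<mu> \<in> mor \<Lambda>" "y (0, deg \<Lambda> \<mu>) = \<mu>" "T (deg \<Lambda> \<mu>) y = x"
  shows "path_prepend k \<Lambda> \<mu> x = y"
  unfolding path_prepend_def
proof (rule the_equality)
  fix z assume z: "z \<in> X \<and> z (0, deg \<Lambda> \<mu>) = \<mu> \<and> T (deg \<Lambda> \<mu>) z = x"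
  show "z = y"
    by (rule path_eq_shiftI[of _ _ "deg \<Lambda> \<mu>"]) (use assms(1,2) in simp_all, simp_all only: z assms)
qed (use assms in blast)

text \<open>Trades the definite description in \<open>path_prepend\<close> for pairs of paths with
  prescribed initial segments and equal tails, the form in which cylinders are used.\<close>

lemma path_equiv_iff:
  "path_equiv k \<Lambda> \<mu> \<nu> \<longleftrightarrow> \<mu> \<in> mor \<Lambda> \<and> \<nu> \<in> mor \<Lambda> \<and> src \<Lambda> \<mu> = src \<Lambda> \<nu> \<and>
     (\<forall>x\<in>X. \<forall>y\<in>X. x (0, deg \<Lambda> \<mu>) = \<mu> \<longrightarrow> y (0, deg \<Lambda> \<nu>) = \<nu> \<longrightarrow>
        T (deg \<Lambda> \<mu>) x = T (deg \<Lambda> \<nu>) y \<longrightarrow> x = y)" (is "?L \<longleftrightarrow> ?R")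
proof
  assume L: ?L
  then have mor: "\<mu> \<in> mor \<Lambda>" "\<nu> \<in> mor \<Lambda>" "src \<Lambda> \<mu> = src \<Lambda> \<nu>"
    by (auto simp: path_equiv_def)
  have "x = y" if "x \<in> X" "y \<in> X" "x (0, deg \<Lambda> \<mu>) = \<mu>" "y (0, deg \<Lambda> \<nu>) = \<nu>"
    "T (deg \<Lambda> \<mu>) x = T (deg \<Lambda> \<nu>) y" for x y
  proof -
    have "T (deg \<Lambda> \<mu>) x (0, 0) = src \<Lambda> \<mu>" 
      using that(1,3) mor(1) path_src[of x "deg \<Lambda> \<mu>" \<mu>] by simp
    then have "path_prepend k \<Lambda> \<mu> (T (deg \<Lambda> \<mu>) x) = path_prepend k \<Lambda> \<nu> (T (deg \<Lambda> \<mu>) x)"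
      using L that mor by (auto simp: path_equiv_def)
    then show ?thesis using prepend_eqI that mor by metis
  qed
  then show ?R using mor by blast
next
  assume R: ?R
  have "path_prepend k \<Lambda> \<mu> x = path_prepend k \<Lambda> \<nu> x" if x: "x \<in> X" "x (0, 0) = src \<Lambda> \<mu>" for x
  proof -
    obtain y where y: "y \<in> X" "y (0, deg \<Lambda> \<mu>) = \<mu>" "T (deg \<Lambda> \<mu>) y = x" using prepend_exists x R by metis
    obtain z where z: "z \<in> X" "z (0, deg \<Lambda> \<nu>) = \<nu>" "T (deg \<Lambda> \<nu>) z = x" using prepend_exists x R by metis
    have "T (deg \<Lambda> \<mu>) y = T (deg \<Lambda> \<nu>) z" by (simp only: y(3) z(3))
    then have "y = z" using R y(1,2) z(1,2) by meson
    then show ?thesis using prepend_eqI[OF y(1) _ y(2,3)] prepend_eqI[OF z(1) _ z(2,3)] R by simp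
  qed
  then show ?L using R by (auto simp: path_equiv_def)
qed

section \<open>Cylinders and the groupoid topology\<close>

text \<open>The cylinder \<open>Z(x(0,l), y(0,m))\<close>.\<close>

definition nbd :: "(nat \<Rightarrow> nat) \<Rightarrow> (nat \<Rightarrow> nat) \<Rightarrow> 'a path \<Rightarrow> 'a path \<Rightarrow> ('a path \<times> (nat \<Rightarrow> int) \<times> 'a path) set" where
  "nbd l m x y = {(x', intvec l - intvec m, y') | x' y'. x' \<in> X \<and> y' \<in> X \<and>
     x' (0, l) = x (0, l) \<and> y' (0, m) = y (0, m) \<and> T l x' = T m y'}"

lemma cyl_eq:
  assumes "\<mu> \<in> mor \<Lambda>" "\<nu> \<in> mor \<Lambda>" "src \<Lambda> \<mu> = src \<Lambda> \<nu>"
  shows "cyl k \<Lambda> \<mu> \<nu> = {(x, intvec (deg \<Lambda> \<mu>) - intvec (deg \<Lambda> \<nu>), y) | x y. x \<in> X \<and> y \<in> X \<and>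
     x (0, deg \<Lambda> \<mu>) = \<mu> \<and> y (0, deg \<Lambda> \<nu>) = \<nu> \<and> T (deg \<Lambda> \<mu>) x = T (deg \<Lambda> \<nu>) y}" (is "?L = ?R")
proof
  show "?L \<subseteq> ?R"
  proof
    fix g assume "g \<in> ?L"
    then obtain x where x: "x \<in> X" "x (0, 0) = src \<Lambda> \<mu>"
      "g = (path_prepend k \<Lambda> \<mu> x, intvec (deg \<Lambda> \<mu>) - intvec (deg \<Lambda> \<nu>), path_prepend k \<Lambda> \<nu> x)"
      by (auto simp: cyl_def)
    obtain y where y: "y \<in> X" "y (0, deg \<Lambda> \<mu>) = \<mu>" "T (deg \<Lambda> \<mu>) y = x" using prepend_exists x assms by metis
    obtain z where z: "z \<in> X" "z (0, deg \<Lambda> \<nu>) = \<nu>" "T (deg \<Lambda> \<nu>) z = x" using prepend_exists x assms by metis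
    have "T (deg \<Lambda> \<mu>) y = T (deg \<Lambda> \<nu>) z" by (simp only: y(3) z(3))
    then show "g \<in> ?R" 
      using x(3) y(1,2) z(1,2) prepend_eqI[OF y(1) assms(1) y(2,3)] prepend_eqI[OF z(1) assms(2) z(2,3)] by blast
  qed
  show "?R \<subseteq> ?L"
  proof
    fix g assume "g \<in> ?R"
    then obtain x y where xy: "g = (x, intvec (deg \<Lambda> \<mu>) - intvec (deg \<Lambda> \<nu>), y)" "x \<in> X" "y \<in> X"
     "x (0, deg \<Lambda> \<mu>) = \<mu>" "y (0, deg \<Lambda> \<nu>) = \<nu>" "T (deg \<Lambda> \<mu>) x = T (deg \<Lambda> \<nu>) y" by auto
    have "T (deg \<Lambda> \<mu>) x (0, 0) = src \<Lambda> \<mu>" 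
      using xy(2-4) assms(1) path_src[of x "deg \<Lambda> \<mu>" \<mu>] by simp
    moreover have "path_prepend k \<Lambda> \<mu> (T (deg \<Lambda> \<mu>) x) = x" "path_prepend k \<Lambda> \<nu> (T (deg \<Lambda> \<mu>) x) = y"
      using prepend_eqI[OF xy(2) assms(1) xy(4) refl] prepend_eqI[OF xy(3) assms(2) xy(5) xy(6)[symmetric]]
      by simp_all
    moreover have "T (deg \<Lambda> \<mu>) x \<in> X" using xy(2) assms(1) by simp
    ultimately show "g \<in> ?L" unfolding cyl_def mem_Collect_eq 
      by (intro exI[of _ "T (deg \<Lambda> \<mu>) x"]) (simp only: xy(1) simp_thms)
  qed
qed

text \<open>The pair witnessing an arrow is kept explicit, because the degree \<open>l - m\<close>
  alone does not say where the two paths are cut.\<close>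

definition matched :: "(nat \<Rightarrow> nat) \<Rightarrow> (nat \<Rightarrow> nat) \<Rightarrow> 'a path \<Rightarrow> 'a path \<Rightarrow> bool" where
  "matched l m x y \<longleftrightarrow> x \<in> X \<and> y \<in> X \<and> l \<in> N \<and> m \<in> N \<and> T l x = T m y"

lemma matched_add: 
  assumes "matched l m x y" "a \<in> N" 
  shows "matched (l + a) (m + a) x y" "matched (a + l) (a + m) x y"
proof -
  have "T (l + a) x = T a (T l x)" "T (m + a) y = T a (T m y)" "T l x = T m y"
    using assms by (simp_all add: matched_def del: shift_shift add: shift_shift[symmetric])
  then show "matched (l + a) (m + a) x y" using assms by (metis matched_def natk_simps(2))
  then show "matched (a + l) (a + m) x y" by (simp add: add.commute)
qed

lemma matched_vertex: 
  assumes "matched l m x y" "a \<in> N" shows "x (l + a, l + a) = y (m + a, m + a)"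
  using assms shift_apply_0(2) unfolding matched_def by metis

lemma matched_vertex0: 
  assumes "matched l m x y" shows "x (l, l) = y (m, m)"
  using matched_vertex[OF assms, of 0] by simp

lemma nbd_eq_cyl:
  assumes "matched l m x y" shows "nbd l m x y = cyl k \<Lambda> (x (0, l)) (y (0, m))"
  using assms matched_vertex0[OF assms] by (subst cyl_eq) (auto simp: nbd_def matched_def)

lemma nbd_self: "matched l m x y \<Longrightarrow> (x, intvec l - intvec m, y) \<in> nbd l m x y"
  by (auto simp: nbd_def matched_def)

text \<open>Over the first \<open>a\<close> steps the tails \<open>T l x'\<close> and
  \<open>T m y'\<close> copy those of \<open>x\<close> and \<open>y\<close>, which agree; beyond
  that they agree by the matching at \<open>l + a\<close> and \<open>m + a\<close>.\<close>

lemma nbd_add_subset: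
  assumes "matched l m x y" "a \<in> N"
  shows "nbd (l + a) (m + a) x y \<subseteq> nbd l m x y"
proof
  fix g assume "g \<in> nbd (l + a) (m + a) x y"
  then obtain x' y' where g: "g = (x', intvec l - intvec m, y')" "x' \<in> X" "y' \<in> X" 
     "x' (0, l + a) = x (0, l + a)" "y' (0, m + a) = y (0, m + a)" "T (l + a) x' = T (m + a) y'"
    by (auto simp: nbd_def)
  have N: "l \<in> N" "m \<in> N" "x \<in> X" "y \<in> X" "T l x = T m y" using assms by (auto simp: matched_def)
  have "T l x' (0, a) = T m y' (0, a)"
  proof -
    have "x' (l, l + a) = x (l, l + a)" "y' (m, m + a) = y (m, m + a)"
      using g N assms path_initial(2) by blast+
    moreover have "x (l, l + a) = y (m, m + a)" using N assms shift_apply_0(1) by metis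
    ultimately show ?thesis using N assms by simp
  qed
  then have "T l x' = T m y'" 
    by (intro path_eq_shiftI[of "T l x'" "T m y'" a]) (use g N assms in auto)
  moreover have "x' (0, l) = x (0, l)" "y' (0, m) = y (0, m)"
    using g N assms path_initial(1) by blast+
  ultimately show "g \<in> nbd l m x y" using g by (auto simp: nbd_def)
qed

abbreviation G where "G \<equiv> path_groupoid k \<Lambda>"
abbreviation GT where "GT \<equiv> path_groupoid_topology k \<Lambda>"

lemma mor_G_iff: "(x, p, y) \<in> mor G \<longleftrightarrow> (\<exists>l m. matched l m x y \<and> p = intvec l - intvec m)"
  by (auto simp: path_groupoid_def matched_def)

text \<open>A cylinder depends on its centre only through two initial segments, and all of its
  members share them.\<close>

lemma nbd_recenter:
  assumes "matched l m x y" "(x', p, y') \<in> nbd l m x y"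
  shows "matched l m x' y'" "p = intvec l - intvec m" "nbd l m x' y' = nbd l m x y"
  using assms by (auto simp: nbd_def matched_def)

lemma nbd_subset_mor: "matched l m x y \<Longrightarrow> nbd l m x y \<subseteq> mor G"
  by (force dest: nbd_recenter(1,2) simp: mor_G_iff)

text \<open>Equal degrees mean \<open>m + c = d + l\<close>, so adding \<open>c\<close> to the first
  pair and \<open>l\<close> to the second produces one common pair.\<close>

lemma nbd_align:
  assumes "matched l m x y" "matched c d x y" "intvec l - intvec m = intvec c - intvec d"
  shows "nbd (l + c) (m + c) x y \<subseteq> nbd c d x y"
proof -
  have "m + c = d + l" using assms(3) by (simp add: intvec_diff_eq_iff add_ac)
  moreover have "nbd (c + l) (d + l) x y \<subseteq> nbd c d x y"
    using assms by (intro nbd_add_subset) (auto simp: matched_def)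
  ultimately show ?thesis by (simp add: add.commute)
qed

text \<open>Common refinements turn the generating cylinders from a subbasis into a basis, so
  openness can be tested with one cylinder at each arrow.\<close>

lemma openin_GT: 
  "openin GT U \<longleftrightarrow> U \<subseteq> mor G \<and> 
     (\<forall>x p y. (x, p, y) \<in> U \<longrightarrow> (\<exists>l m. matched l m x y \<and> p = intvec l - intvec m \<and> nbd l m x y \<subseteq> U))"
  (is "_ \<longleftrightarrow> ?Q U")
proof
  let ?B = "{cyl k \<Lambda> \<mu> \<nu> |\<mu> \<nu>. \<mu> \<in> mor \<Lambda> \<and> \<nu> \<in> mor \<Lambda> \<and> src \<Lambda> \<mu> = src \<Lambda> \<nu>}"
  assume "openin GT U"
  then have "generate_topology_on ?B U"
    by (simp add: path_groupoid_topology_def openin_topology_generated_by_iff)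
  then show "?Q U"
  proof induction
    case Empty then show ?case by simp
  next
    case (Int a b)
    have "\<exists>l m. matched l m x y \<and> p = intvec l - intvec m \<and> nbd l m x y \<subseteq> a \<inter> b"
      if xpy: "(x, p, y) \<in> a \<inter> b" for x p y
    proof -
      obtain l m where lm: "matched l m x y" "p = intvec l - intvec m" "nbd l m x y \<subseteq> a" 
        using Int.IH(1) xpy by (meson IntD1)
      obtain c d where cd: "matched c d x y" "p = intvec c - intvec d" "nbd c d x y \<subseteq> b" 
        using Int.IH(2) xpy by (meson IntD2)
      have "c \<in> N" using cd by (auto simp: matched_def)
      then have "nbd (l + c) (m + c) x y \<subseteq> a \<inter> b" "matched (l + c) (m + c) x y"
        using nbd_add_subset[OF lm(1)] nbd_align[OF lm(1) cd(1)] lm cd matched_add by blast+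
      then show ?thesis using lm by force
    qed
    then show ?case using Int by blast
  next
    case (UN K) then show ?case by (meson Sup_least Union_iff Union_upper subset_trans)
  next
    case (Basis s)
    then obtain \<mu> \<nu> where s: "s = cyl k \<Lambda> \<mu> \<nu>" "\<mu> \<in> mor \<Lambda>" "\<nu> \<in> mor \<Lambda>" "src \<Lambda> \<mu> = src \<Lambda> \<nu>" by blast
    have "matched (deg \<Lambda> \<mu>) (deg \<Lambda> \<nu>) x y \<and> p = intvec (deg \<Lambda> \<mu>) - intvec (deg \<Lambda> \<nu>)
      \<and> nbd (deg \<Lambda> \<mu>) (deg \<Lambda> \<nu>) x y \<subseteq> s" if "(x, p, y) \<in> s" for x p y
      using that unfolding s(1) cyl_eq[OF s(2-4)] nbd_def matched_def using s by auto
    then show ?case by (force simp: mor_G_iff)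
  qed
next
  assume Q: "?Q U"
  have "openin GT (nbd l m x y)" if "matched l m x y" for l m x y
  proof -
    have "x (0, l) \<in> mor \<Lambda> \<and> y (0, m) \<in> mor \<Lambda> \<and> src \<Lambda> (x (0, l)) = src \<Lambda> (y (0, m))"
      using that matched_vertex0[OF that] by (auto simp: matched_def)
    then show ?thesis
      unfolding path_groupoid_topology_def nbd_eq_cyl[OF that] 
      by (intro topology_generated_by_Basis) blast
  qed
  then have "openin GT (\<Union>{nbd l m x y |l m x y. matched l m x y \<and> nbd l m x y \<subseteq> U})"
    by (intro openin_Union) blast
  also have "\<Union>{nbd l m x y |l m x y. matched l m x y \<and> nbd l m x y \<subseteq> U} = U"
  proof (intro equalityI Union_least subsetI)
    fix g assume "g \<in> U"
    moreover obtain x p y where g: "g = (x, p, y)" by (cases g)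
    ultimately obtain l m where "matched l m x y" "p = intvec l - intvec m" "nbd l m x y \<subseteq> U"
      using Q by blast
    then show "g \<in> \<Union>{nbd l m x y |l m x y. matched l m x y \<and> nbd l m x y \<subseteq> U}"
      unfolding g using nbd_self by blast
  qed blast
  finally show "openin GT U" .
qed

lemma openin_nbd: "matched l m x y \<Longrightarrow> openin GT (nbd l m x y)"
  unfolding openin_GT using nbd_subset_mor nbd_recenter by (metis order_refl)

lemma topspace_GT [simp]: "topspace GT = mor G"
proof -
  have "openin GT (mor G)"
    unfolding openin_GT using nbd_subset_mor mor_G_iff by blast
  then show ?thesis using openin_GT by (metis openin_subset openin_topspace subset_antisym)
qed

text \<open>The cylinder refines a prescribed pair, whatever pair openness provides. This lets the
  cylinders of several arrows be cut at the same degree.\<close>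

lemma openin_GT_matched:
  assumes "openin GT U" "matched l m x y" "(x, intvec l - intvec m, y) \<in> U"
  obtains a where "a \<in> N" "nbd (l + a) (m + a) x y \<subseteq> U"
proof -
  obtain c d where cd: "matched c d x y" "intvec l - intvec m = intvec c - intvec d" "nbd c d x y \<subseteq> U" 
    using assms openin_GT by metis
  then show ?thesis using that[of c] nbd_align[OF assms(2) cd(1)] by (auto simp: matched_def)
qed

lemma splice:
  assumes "x \<in> X" "n \<in> N" "w \<in> X" "w (0, 0) = x (n, n)"
  obtains y where "y \<in> X" "y (0, n) = x (0, n)" "T n y = w"
  using prepend_exists[of "x (0, n)" w] assms by auto

section \<open>The topology of the path space\<close>

definition cylinder :: "(nat \<Rightarrow> nat) \<Rightarrow> 'a path \<Rightarrow> 'a path set" where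
  "cylinder n x = {x' \<in> X. x' (0, n) = x (0, n)}"

lemma cylinder_mono: "n \<in> N \<Longrightarrow> m \<in> N \<Longrightarrow> n \<le> m \<Longrightarrow> x \<in> X \<Longrightarrow> cylinder m x \<subseteq> cylinder n x"
  unfolding cylinder_def using path_initial_le by blast

text \<open>Equal initial segments and equal tails force equal paths, so this cylinder contains
  units only. It translates between the groupoid topology and the path space.\<close>

lemma nbd_diag: "n \<in> N \<Longrightarrow> nbd n n x x = (\<lambda>x'. (x', 0, x')) ` cylinder n x"
proof -
  assume n: "n \<in> N"
  have "x' = y'" if "x' \<in> X" "y' \<in> X" "x' (0, n) = x (0, n)" "y' (0, n) = x (0, n)" "T n x' = T n y'" for x' y'
    by (rule path_eq_shiftI[of _ _ n]) (use that n in simp_all)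
  then show ?thesis unfolding nbd_def cylinder_def by auto
qed

abbreviation XT where "XT \<equiv> inf_path_topology k \<Lambda>"

lemma matched_0: "x \<in> X \<Longrightarrow> matched 0 0 x x"
  by (simp add: matched_def)

lemma unit_in_mor: "x \<in> X \<Longrightarrow> (x, 0, x) \<in> mor G"
  using matched_0 nbd_self[OF matched_0] nbd_subset_mor by fastforce

lemma openin_XT: "openin XT U \<longleftrightarrow> U \<subseteq> X \<and> (\<forall>x\<in>U. \<exists>n\<in>N. cylinder n x \<subseteq> U)"
proof
  assume "openin XT U"
  then obtain V where V: "openin GT V" "U = (\<lambda>x. (x, 0, x)) -` V \<inter> X"
    unfolding inf_path_topology_def openin_pullback_topology by blast
  have "\<exists>n\<in>N. cylinder n x \<subseteq> U" if "x \<in> U" for x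
  proof -
    have x: "matched 0 0 x x" "(x, intvec 0 - intvec 0, x) \<in> V" using that V(2) by (auto simp: matched_0)
    obtain a where a: "a \<in> N" "nbd (0 + a) (0 + a) x x \<subseteq> V"
      using openin_GT_matched[OF V(1) x] by blast
    then have "nbd a a x x \<subseteq> V" by simp
    then have "cylinder a x \<subseteq> U" unfolding V(2) nbd_diag[OF a(1)] by (auto simp: cylinder_def)
    then show ?thesis using a by blast
  qed
  then show "U \<subseteq> X \<and> (\<forall>x\<in>U. \<exists>n\<in>N. cylinder n x \<subseteq> U)" using V by blast
next
  assume U: "U \<subseteq> X \<and> (\<forall>x\<in>U. \<exists>n\<in>N. cylinder n x \<subseteq> U)"
  define V where "V = \<Union>{nbd n n x x | n x. n \<in> N \<and> x \<in> X \<and> cylinder n x \<subseteq> U}"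
  have "openin GT V" unfolding V_def
    by (rule openin_Union) (auto intro!: openin_nbd simp: matched_def)
  moreover have "U = (\<lambda>x. (x, 0, x)) -` V \<inter> X"
  proof (intro equalityI subsetI)
    fix x assume x: "x \<in> U"
    then obtain n where n: "n \<in> N" "cylinder n x \<subseteq> U" using U by blast
    then have "(x, 0, x) \<in> nbd n n x x" using x U by (auto simp: nbd_diag cylinder_def)
    then show "x \<in> (\<lambda>x. (x, 0, x)) -` V \<inter> X" unfolding V_def using x U n by blast
  next
    fix x assume "x \<in> (\<lambda>x. (x, 0, x)) -` V \<inter> X"
    then obtain n y where "n \<in> N" "cylinder n y \<subseteq> U" "(x, 0, x) \<in> nbd n n y y" unfolding V_def by blast
    then show "x \<in> U" by (auto simp: nbd_diag)
  qed
  ultimately show "openin XT U" unfolding inf_path_topology_def openin_pullback_topology by blast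
qed

lemma topspace_XT [simp]: "topspace XT = X"
proof -
  have "openin XT X" unfolding openin_XT cylinder_def using natk_simps(1) by blast
  then show ?thesis using openin_XT by (metis openin_subset openin_topspace subset_antisym)
qed

lemma openin_cylinder: "n \<in> N \<Longrightarrow> openin XT (cylinder n x)"
  unfolding openin_XT cylinder_def by (auto intro!: bexI[of _ n])

lemma Hausdorff_XT: "Hausdorff_space XT"
  unfolding Hausdorff_space_def topspace_XT
proof (intro allI impI)
  fix x y assume xy: "x \<in> X \<and> y \<in> X \<and> x \<noteq> y"
  then obtain n where n: "n \<in> N" "x (0, n) \<noteq> y (0, n)" using path_eqI by blast
  show "\<exists>U V. openin XT U \<and> openin XT V \<and> x \<in> U \<and> y \<in> V \<and> disjnt U V"
    by (intro exI[of _ "cylinder n x"] exI[of _ "cylinder n y"] conjI openin_cylinder n)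
      (use xy n in \<open>auto simp: cylinder_def disjnt_def\<close>)
qed

section \<open>Periodicity\<close>

text \<open>The local form of a period. Unlike ~ it refers to no particular morphisms, so it can be
  moved between vertices and added.\<close>

definition per_at :: "'a \<Rightarrow> (nat \<Rightarrow> nat) \<Rightarrow> (nat \<Rightarrow> nat) \<Rightarrow> bool" where
  "per_at v l m \<longleftrightarrow> l \<in> N \<and> m \<in> N \<and> (\<forall>w\<in>X. w (0, 0) = v \<longrightarrow> T l w = T m w)"

lemma per_atD: "per_at v l m \<Longrightarrow> w \<in> X \<Longrightarrow> w (0, 0) = v \<Longrightarrow> T l w = T m w"
  by (auto simp: per_at_def)

lemma per_at_0: "per_at v 0 0"
  by (simp add: per_at_def)

text \<open>A path \<open>w\<close> from the source of \<mu> is the tail of a path starting with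
  \<mu>, and shifts commute.\<close>

lemma per_at_hereditary:
  assumes "per_at (rng \<Lambda> \<mu>) l m" "\<mu> \<in> mor \<Lambda>"
  shows "per_at (src \<Lambda> \<mu>) l m"
  unfolding per_at_def
proof (intro conjI ballI impI)
  show lm: "l \<in> N" "m \<in> N" using assms by (auto simp: per_at_def)
  fix w assume w: "w \<in> X" "w (0, 0) = src \<Lambda> \<mu>"
  obtain y where y: "y \<in> X" "y (0, deg \<Lambda> \<mu>) = \<mu>" "T (deg \<Lambda> \<mu>) y = w"
    using prepend_exists[OF assms(2) w] by blast
  have d: "deg \<Lambda> \<mu> \<in> N" using assms(2) by simp
  have "y (0, 0) = rng \<Lambda> \<mu>" using path_0_simps(4)[OF y(1) d] y(2) by simp
  then have "T (deg \<Lambda> \<mu>) (T l y) = T (deg \<Lambda> \<mu>) (T m y)" using per_atD[OF assms(1) y(1)] by simp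
  then have "T l (T (deg \<Lambda> \<mu>) y) = T m (T (deg \<Lambda> \<mu>) y)" using y(1) lm d by (simp add: add.commute)
  then show "T l w = T m w" by (simp only: y(3))
qed

lemma per_at_shift:
  assumes "per_at (x (n, n)) l m" "x \<in> X" "n \<in> N" "a \<in> N"
  shows "per_at (x (n + a, n + a)) l m"
  using per_at_hereditary[of "x (n, n + a)" l m] assms by simp

text \<open>Both hypotheses speak of \<open>w\<close> itself and not of its shifts; commuting the
  shifts brings the second one back to \<open>w\<close>.\<close>

lemma per_at_add:
  assumes "per_at v l m" "per_at v l' m'"
  shows "per_at v (l + l') (m + m')"
  unfolding per_at_def
proof (intro conjI ballI impI)
  show "l + l' \<in> N" "m + m' \<in> N" using assms by (auto simp: per_at_def)
  fix w assume w: "w \<in> X" "w (0, 0) = v"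
  have N: "l \<in> N" "m \<in> N" "l' \<in> N" "m' \<in> N" using assms by (auto simp: per_at_def)
  have "T (l + l') w = T l' (T l w)" using w N by simp
  also have "\<dots> = T l' (T m w)" using per_atD[OF assms(1)] w by simp
  also have "\<dots> = T m (T l' w)" using w N by (simp add: add.commute)
  also have "\<dots> = T m (T m' w)" using per_atD[OF assms(2)] w by simp
  also have "\<dots> = T (m + m') w" using w N by (simp add: add.commute)
  finally show "T (l + l') w = T (m + m') w" .
qed

lemma path_equiv_sym: "path_equiv k \<Lambda> \<mu> \<nu> \<Longrightarrow> path_equiv k \<Lambda> \<nu> \<mu>"
  unfolding path_equiv_def by metis

text \<open>If \<open>u\<close> is the common path obtained from \<open>z\<close> by prepending
  \<mu> or \<nu>, then either shift takes \<open>u\<close> to \<open>z\<close>. Applying both shifts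
  to \<open>u\<close> in the two orders gives the two sides.\<close>

lemma path_equiv_per_at:
  assumes "path_equiv k \<Lambda> \<mu> \<nu>"
  shows "per_at (src \<Lambda> \<mu>) (deg \<Lambda> \<mu>) (deg \<Lambda> \<nu>)"
  unfolding per_at_def
proof (intro conjI ballI impI)
  have mor: "\<mu> \<in> mor \<Lambda>" "\<nu> \<in> mor \<Lambda>" "src \<Lambda> \<mu> = src \<Lambda> \<nu>" using assms by (auto simp: path_equiv_def)
  then show N: "deg \<Lambda> \<mu> \<in> N" "deg \<Lambda> \<nu> \<in> N" by simp_all
  fix z assume z: "z \<in> X" "z (0, 0) = src \<Lambda> \<mu>"
  obtain u where u: "u \<in> X" "u (0, deg \<Lambda> \<mu>) = \<mu>" "T (deg \<Lambda> \<mu>) u = z"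
    using prepend_exists[OF mor(1) z] by blast
  obtain u' where u': "u' \<in> X" "u' (0, deg \<Lambda> \<nu>) = \<nu>" "T (deg \<Lambda> \<nu>) u' = z"
    using prepend_exists[OF mor(2) z(1)] z(2) mor(3) by metis
  have "T (deg \<Lambda> \<mu>) u = T (deg \<Lambda> \<nu>) u'" by (simp only: u u')
  then have "u = u'" using assms u(1,2) u'(1,2) unfolding path_equiv_iff by blast
  then have "T (deg \<Lambda> \<nu>) u = z" using u' by simp
  moreover have "T (deg \<Lambda> \<mu>) (T (deg \<Lambda> \<nu>) u) = T (deg \<Lambda> \<nu>) (T (deg \<Lambda> \<mu>) u)"
    using u(1) N by (simp add: add.commute)
  ultimately show "T (deg \<Lambda> \<mu>) z = T (deg \<Lambda> \<nu>) z" by (simp only: u(3))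
qed

text \<open>The first segment has degree at least \<open>m\<close>, so it decides the initial segment of
  degree \<open>m\<close>, and periodicity then decides the one of degree \<open>m + m\<close>.\<close>

lemma per_at_path_equiv:
  assumes "per_at (y (0, 0)) l m" "y \<in> X"
  shows "path_equiv k \<Lambda> (y (0, l + m)) (y (0, m + m))"
proof -
  have N: "l \<in> N" "m \<in> N" using assms by (auto simp: per_at_def)
  have N2: "l + m \<in> N" "m + m \<in> N" using N by auto
  have Ty: "T l y = T m y" using per_atD[OF assms] by simp
  have "x = x'" if x: "x \<in> X" "x' \<in> X" "x (0, l + m) = y (0, l + m)" "x' (0, m + m) = y (0, m + m)"
    "T (l + m) x = T (m + m) x'" for x x'
  proof (rule path_eq_shiftI)
    have "x (0, 0) = y (0, 0)" using path_initial_le[OF x(1) assms(2) _ N2(1) _ x(3)] by simp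
    then have Tx: "T l x = T m x" using per_atD[OF assms(1) x(1)] by simp
    have "x (m, m + m) = T m x (0, m)" using N by simp
    also have "\<dots> = T l x (0, m)" by (simp only: Tx)
    also have "\<dots> = x (l, l + m)" using N by simp
    also have "\<dots> = y (l, l + m)" using path_initial(2)[OF x(1) assms(2) N x(3)] .
    also have "\<dots> = T l y (0, m)" using N by simp
    also have "\<dots> = T m y (0, m)" by (simp only: Ty)
    also have "\<dots> = y (m, m + m)" using N by simp
    finally have "x (m, m + m) = y (m, m + m)" .
    moreover have "x (0, m) = y (0, m)" 
      using path_initial_le[of x y m "l + m"] x(1,3) assms(2) N(2) N2(1) by simp
    ultimately have "x (0, m + m) = y (0, m + m)" 
      using path_0_cmp[OF x(1) N(2) N(2)] path_0_cmp[OF assms(2) N(2) N(2)] by simp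
    then show "x (0, m + m) = x' (0, m + m)" using x(4) by simp
    have "T (m + m) x = T m (T m x)" using N x(1) by simp
    also have "\<dots> = T m (T l x)" by (simp only: Tx)
    also have "\<dots> = T (l + m) x" using N x(1) by simp
    finally show "T (m + m) x = T (m + m) x'" using x(5) by simp
  qed (use x(1,2) N2 in auto)
  moreover have "y (l + m, l + m) = y (m + m, m + m)"
    using Ty shift_apply_0(2)[OF N(1) N(2), of y] shift_apply_0(2)[OF N(2) N(2), of y] by simp
  ultimately show ?thesis
    unfolding path_equiv_iff using assms(2) N2 by simp
qed

lemma per_at_Per:
  assumes "per_at (y (0, 0)) l m" "y \<in> X"
  shows "intvec l - intvec m \<in> Per k \<Lambda>"
proof -
  have N: "l \<in> N" "m \<in> N" using assms by (auto simp: per_at_def)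
  then have "intvec (deg \<Lambda> (y (0, l + m))) - intvec (deg \<Lambda> (y (0, m + m))) = intvec l - intvec m"
    using assms(2) by (simp del: intvec_simps add: intvec_diff_eq_iff add_ac)
  then show ?thesis unfolding Per_def using per_at_path_equiv[OF assms] by (metis (mono_tags, lifting) mem_Collect_eq)
qed

lemma per_at_Per_vertex:
  assumes "per_at (x (n, n)) l m" "x \<in> X" "n \<in> N"
  shows "intvec l - intvec m \<in> Per k \<Lambda>"
  using per_at_Per[of "T n x" l m] assms shift_apply_0(2)[of n 0 x] by simp

section \<open>Interior isotropy and local periods\<close>

abbreviation I where "I \<equiv> interior_isotropy k \<Lambda>"

lemma isotropy_iff: "(x, p, y) \<in> isotropy G \<longleftrightarrow> (x, p, y) \<in> mor G \<and> x = y"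
  by (auto simp: isotropy_def path_groupoid_def)

lemma mem_I_iff: 
  "(x, p, y) \<in> I \<longleftrightarrow> x = y \<and> (\<exists>l m. matched l m x x \<and> p = intvec l - intvec m \<and> nbd l m x x \<subseteq> isotropy G)"
proof
  assume "(x, p, y) \<in> I"
  then obtain U where U: "openin GT U" "(x, p, y) \<in> U" "U \<subseteq> isotropy G"
    unfolding interior_isotropy_def interior_of_def by blast
  then have xy: "x = y" using isotropy_iff by blast
  obtain l m where "matched l m x x" "p = intvec l - intvec m" "nbd l m x x \<subseteq> U"
    using U(1,2) unfolding openin_GT xy by blast
  then show "x = y \<and> (\<exists>l m. matched l m x x \<and> p = intvec l - intvec m \<and> nbd l m x x \<subseteq> isotropy G)"
    using xy U(3) by blast
next
  assume "x = y \<and> (\<exists>l m. matched l m x x \<and> p = intvec l - intvec m \<and> nbd l m x x \<subseteq> isotropy G)"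
  then obtain l m where lm: "x = y" "matched l m x x" "p = intvec l - intvec m" "nbd l m x x \<subseteq> isotropy G" by blast
  have "nbd l m x x \<subseteq> I"
    unfolding interior_isotropy_def by (rule interior_of_maximal[OF lm(4) openin_nbd[OF lm(2)]])
  then show "(x, p, y) \<in> I" using nbd_self[OF lm(2)] lm(1,3) by blast
qed

lemma openin_I: "openin GT I"
  unfolding interior_isotropy_def by simp

text \<open>A cylinder inside the isotropy forces \<open>x' = y'\<close> for all of its pairs, which
  is the criterion \<open>path_equiv_iff\<close> for its two initial segments.\<close>

lemma nbd_isotropyD:
  assumes "nbd l m x x \<subseteq> isotropy G" "matched l m x x"
  shows "path_equiv k \<Lambda> (x (0, l)) (x (0, m))"
proof -
  have xN: "x \<in> X" "l \<in> N" "m \<in> N" using assms(2) by (auto simp: matched_def)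
  have "x' = y'" if "x' \<in> X" "y' \<in> X" "x' (0, l) = x (0, l)" "y' (0, m) = x (0, m)" "T l x' = T m y'" for x' y'
  proof -
    have "(x', intvec l - intvec m, y') \<in> nbd l m x x" unfolding nbd_def using that by blast
    then show ?thesis using assms(1) isotropy_iff by blast
  qed
  then show ?thesis unfolding path_equiv_iff using xN matched_vertex0[OF assms(2)] by simp
qed

lemma mem_I_Per: "(x, p, y) \<in> I \<Longrightarrow> x = y \<and> x \<in> X \<and> p \<in> Per k \<Lambda>"
proof -
  assume "(x, p, y) \<in> I"
  then obtain l m where lm: "x = y" "matched l m x x" "p = intvec l - intvec m" "nbd l m x x \<subseteq> isotropy G"
    unfolding mem_I_iff by blast
  then have "deg \<Lambda> (x (0, l)) = l" "deg \<Lambda> (x (0, m)) = m" "x \<in> X" by (auto simp: matched_def)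
  then show ?thesis using nbd_isotropyD[OF lm(4,2)] lm(1,3) unfolding Per_def by force
qed

text \<open>The witnessing cylinder cuts at \<open>n + (l + m)\<close> and
  \<open>n + (m + m)\<close>. Up to \<open>n\<close> both ends of its arrows follow
  \<open>x\<close>; past \<open>n\<close> they start with equivalent segments and have equal tails,
  so they coincide.\<close>

lemma per_at_mem_I:
  assumes x: "x \<in> X" and n: "n \<in> N" and per: "per_at (x (n, n)) l m"
  shows "(x, intvec l - intvec m, x) \<in> I"
proof -
  have N: "l \<in> N" "m \<in> N" using per by (auto simp: per_at_def)
  have N2: "n + (l + m) \<in> N" "n + (m + m) \<in> N" "l + m \<in> N" "m + m \<in> N" using N n by auto
  define y where "y = T n x"
  have y: "y \<in> X" "y (0, 0) = x (n, n)" using x n shift_apply_0(2)[of n 0 x] by (auto simp: y_def)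
  have pe: "path_equiv k \<Lambda> (y (0, l + m)) (y (0, m + m))"
    by (rule per_at_path_equiv) (use per y in auto)
  have "T (n + (l + m)) x = T m (T l y)" unfolding y_def using x n N by (simp add: add.assoc)
  also have "\<dots> = T m (T m y)" using per_atD[OF per y] by simp
  also have "\<dots> = T (n + (m + m)) x" unfolding y_def using x n N by (simp add: add.assoc)
  finally have mt: "matched (n + (l + m)) (n + (m + m)) x x"
    using N2 x by (auto simp: matched_def)
  have "x' = y'" if xy: "x' \<in> X" "y' \<in> X" "x' (0, n + (l + m)) = x (0, n + (l + m))" 
    "y' (0, n + (m + m)) = x (0, n + (m + m))" "T (n + (l + m)) x' = T (n + (m + m)) y'" for x' y'
  proof (rule path_eq_shiftI)
    note ix = path_initial[of x' x n "l + m", OF xy(1) x n N2(3) xy(3)]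
      and iy = path_initial[of y' x n "m + m", OF xy(2) x n N2(4) xy(4)]
    show "x' (0, n) = y' (0, n)" using ix iy by simp
    have "T (l + m) (T n x') = T (m + m) (T n y')" using xy(1,2,5) N2 n by simp
    moreover have "T n x' (0, l + m) = y (0, l + m)" "T n y' (0, m + m) = y (0, m + m)"
      using ix iy n N2 by (simp_all add: y_def)
    moreover have "T n x' \<in> X" "T n y' \<in> X" using xy n by auto
    moreover have "deg \<Lambda> (y (0, l + m)) = l + m" "deg \<Lambda> (y (0, m + m)) = m + m" using y(1) N2 by auto
    ultimately show "T n x' = T n y'" using pe unfolding path_equiv_iff by metis
  qed (use xy(1,2) n in auto)
  then have eq: "x' = y'" if "(x', p, y') \<in> nbd (n + (l + m)) (n + (m + m)) x x" for x' p y'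
    using that unfolding nbd_def by blast
  then have "nbd (n + (l + m)) (n + (m + m)) x x \<subseteq> isotropy G"
    using nbd_subset_mor[OF mt] isotropy_iff by (smt (verit) prod_cases3 subset_iff)
  moreover have "intvec l - intvec m = intvec (n + (l + m)) - intvec (n + (m + m))"
    by (simp only: intvec_diff_eq_iff) (simp add: add_ac)
  ultimately show ?thesis unfolding mem_I_iff using mt by blast
qed

end

section \<open>Cofinality and the group of periods\<close>

locale cofinal_graph = higher_rank_graph +
  assumes cofinal: "kgraph_cofinal k \<Lambda>"
begin

text \<open>Cofinality supplies a morphism whose range is the source of \<mu> and whose source lies
  on \<open>x\<close>, and local periods pass from range to source.\<close>

lemma Per_per_at:
  assumes "p \<in> Per k \<Lambda>" "x \<in> X"
  obtains n l m where "n \<in> N" "p = intvec l - intvec m" "per_at (x (n, n)) l m"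
proof -
  obtain \<mu> \<nu> where p: "p = intvec (deg \<Lambda> \<mu>) - intvec (deg \<Lambda> \<nu>)" "path_equiv k \<Lambda> \<mu> \<nu>"
    using assms(1) unfolding Per_def by blast
  have "\<mu> \<in> mor \<Lambda>" using p(2) by (simp add: path_equiv_def)
  then have "src \<Lambda> \<mu> \<in> of_degree \<Lambda> 0" by (simp add: of_degree_def)
  then obtain n \<xi> where n: "n \<in> N" "\<xi> \<in> mor \<Lambda>" "rng \<Lambda> \<xi> = src \<Lambda> \<mu>" "src \<Lambda> \<xi> = x (n, n)"
    using cofinal assms(2) unfolding kgraph_cofinal_def by blast
  have "per_at (src \<Lambda> \<xi>) (deg \<Lambda> \<mu>) (deg \<Lambda> \<nu>)"
    by (rule per_at_hereditary) (use path_equiv_per_at[OF p(2)] n in simp_all)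
  then show ?thesis using that n p(1) by metis
qed

lemma I_eq: "I = {(x, m, x) |x m. x \<in> X \<and> m \<in> Per k \<Lambda>}"
proof
  show "I \<subseteq> {(x, m, x) |x m. x \<in> X \<and> m \<in> Per k \<Lambda>}" using mem_I_Per by fast
  show "{(x, m, x) |x m. x \<in> X \<and> m \<in> Per k \<Lambda>} \<subseteq> I"
    using Per_per_at per_at_mem_I by (smt (verit, best) mem_Collect_eq subsetI)
qed

lemma mem_I: "(x, p, y) \<in> I \<longleftrightarrow> x = y \<and> x \<in> X \<and> p \<in> Per k \<Lambda>"
  unfolding I_eq by auto

lemma Per_0: "x \<in> X \<Longrightarrow> 0 \<in> Per k \<Lambda>"
  using per_at_Per[of x 0 0] per_at_0 by simp

lemma Per_uminus: "p \<in> Per k \<Lambda> \<Longrightarrow> - p \<in> Per k \<Lambda>"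
proof -
  assume "p \<in> Per k \<Lambda>"
  then obtain \<mu> \<nu> where p: "p = intvec (deg \<Lambda> \<mu>) - intvec (deg \<Lambda> \<nu>)" "path_equiv k \<Lambda> \<mu> \<nu>"
    unfolding Per_def by blast
  then have "- p = intvec (deg \<Lambda> \<nu>) - intvec (deg \<Lambda> \<mu>)" by simp
  then show ?thesis unfolding Per_def using path_equiv_sym[OF p(2)] by blast
qed

text \<open>Periods witnessed at \<open>x (n, n)\<close> and at \<open>x (n', n')\<close> both
  persist to the vertex at \<open>n + n'\<close>, where they can be added.\<close>

lemma Per_add: 
  assumes "x \<in> X" "p \<in> Per k \<Lambda>" "q \<in> Per k \<Lambda>" 
  shows "p + q \<in> Per k \<Lambda>"
proof -
  obtain n l m where 1: "n \<in> N" "p = intvec l - intvec m" "per_at (x (n, n)) l m" 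
    using Per_per_at assms by blast
  obtain n' l' m' where 2: "n' \<in> N" "q = intvec l' - intvec m'" "per_at (x (n', n')) l' m'" 
    using Per_per_at assms by blast
  have "per_at (x (n + n', n + n')) (l + l') (m + m')"
    using per_at_add per_at_shift[OF 1(3) assms(1) 1(1) 2(1)] per_at_shift[OF 2(3) assms(1) 2(1) 1(1)]
    by (simp add: add.commute)
  then have "intvec (l + l') - intvec (m + m') \<in> Per k \<Lambda>"
    using per_at_Per_vertex assms(1) 1(1) 2(1) by blast
  moreover have "intvec (l + l') - intvec (m + m') = p + q" unfolding 1(2) 2(2) by simp
  ultimately show ?thesis by simp
qed

lemma Per_diff: "x \<in> X \<Longrightarrow> p \<in> Per k \<Lambda> \<Longrightarrow> q \<in> Per k \<Lambda> \<Longrightarrow> p - q \<in> Per k \<Lambda>"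
  using Per_add[of x p "- q"] Per_uminus by simp

end

section \<open>Compactness of cylinders\<close>

locale rf_cofinal_graph = cofinal_graph +
  assumes row_finite: "row_finite_no_sources k \<Lambda>"
begin

definition fincov :: "'a path set set \<Rightarrow> 'a \<Rightarrow> bool" where
  "fincov \<U> \<mu> \<longleftrightarrow> (\<exists>\<F>. finite \<F> \<and> \<F> \<subseteq> \<U> \<and> {x\<in>X. x (0, deg \<Lambda> \<mu>) = \<mu>} \<subseteq> \<Union>\<F>)"

text \<open>By row-finiteness the cylinder of \<mu> splits into finitely many cylinders of
  extensions by degree \<open>diag 1\<close>; finite covers of all of them would combine to one of
  the whole.\<close>

lemma fincov_extend:
  assumes mu: "\<mu> \<in> mor \<Lambda>" and "\<not> fincov \<U> \<mu>"
  obtains \<xi> where "prefix \<mu> \<xi>" "deg \<Lambda> \<xi> = deg \<Lambda> \<mu> + diag 1" "\<not> fincov \<U> \<xi>"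
proof (rule ccontr)
  assume "\<not> thesis"
  then have H: "\<And>\<xi>. prefix \<mu> \<xi> \<Longrightarrow> deg \<Lambda> \<xi> = deg \<Lambda> \<mu> + diag 1 \<Longrightarrow> fincov \<U> \<xi>" using that by blast
  define E where "E = {\<alpha> \<in> of_degree \<Lambda> (diag 1). rng \<Lambda> \<alpha> = src \<Lambda> \<mu>}"
  have E: "finite E" 
    using row_finite mu unfolding E_def row_finite_no_sources_def by (auto simp: of_degree_def)
  have "\<forall>\<alpha>\<in>E. \<exists>\<F>. finite \<F> \<and> \<F> \<subseteq> \<U> \<and> {x\<in>X. x (0, deg \<Lambda> \<mu> + diag 1) = cmp \<Lambda> \<mu> \<alpha>} \<subseteq> \<Union>\<F>"
  proof
    fix \<alpha> assume that: "\<alpha> \<in> E"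
    have a: "\<alpha> \<in> mor \<Lambda>" "deg \<Lambda> \<alpha> = diag 1" "rng \<Lambda> \<alpha> = src \<Lambda> \<mu>" using that by (auto simp: E_def of_degree_def)
    have d: "deg \<Lambda> (cmp \<Lambda> \<mu> \<alpha>) = deg \<Lambda> \<mu> + diag 1" using a mu by simp
    have "prefix \<mu> (cmp \<Lambda> \<mu> \<alpha>)" unfolding prefix_def using mu a by metis
    then have "fincov \<U> (cmp \<Lambda> \<mu> \<alpha>)" using H d by blast
    then show "\<exists>\<F>. finite \<F> \<and> \<F> \<subseteq> \<U> \<and> {x\<in>X. x (0, deg \<Lambda> \<mu> + diag 1) = cmp \<Lambda> \<mu> \<alpha>} \<subseteq> \<Union>\<F>"
      unfolding fincov_def d .
  qed
  from bchoice[OF this] obtain \<F> where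
    F: "\<forall>\<alpha>\<in>E. finite (\<F> \<alpha>) \<and> \<F> \<alpha> \<subseteq> \<U> \<and> {x\<in>X. x (0, deg \<Lambda> \<mu> + diag 1) = cmp \<Lambda> \<mu> \<alpha>} \<subseteq> \<Union>(\<F> \<alpha>)"
    by blast
  have "fincov \<U> \<mu>"
    unfolding fincov_def
  proof (intro exI[of _ "\<Union>(\<F> ` E)"] conjI subsetI)
    show "finite (\<Union>(\<F> ` E))" using E F by blast
    show "\<And>U. U \<in> \<Union>(\<F> ` E) \<Longrightarrow> U \<in> \<U>" using F by blast
    fix x assume "x \<in> {x\<in>X. x (0, deg \<Lambda> \<mu>) = \<mu>}"
    then have x: "x \<in> X" "x (0, deg \<Lambda> \<mu>) = \<mu>" by auto
    define \<alpha> where "\<alpha> = x (deg \<Lambda> \<mu>, deg \<Lambda> \<mu> + diag 1)"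
    have d: "deg \<Lambda> \<mu> \<in> N" using mu by simp
    have "\<alpha> \<in> E" unfolding E_def \<alpha>_def of_degree_def using x(1) d path_src[OF x(1) d x(2)] by simp
    moreover have "x (0, deg \<Lambda> \<mu> + diag 1) = cmp \<Lambda> \<mu> \<alpha>" 
      using path_0_cmp[OF x(1) d, of "diag 1"] x(2) by (simp add: \<alpha>_def)
    moreover from calculation have "x \<in> {x\<in>X. x (0, deg \<Lambda> \<mu> + diag 1) = cmp \<Lambda> \<mu> \<alpha>}" using x(1) by simp
    ultimately have "\<alpha> \<in> E" "x \<in> \<Union>(\<F> \<alpha>)" using F by (simp_all only: subset_iff)
    then show "x \<in> \<Union>(\<Union>(\<F> ` E))" by blast
  qed
  then show False using assms by blast
qed

text \<open>Koenig's lemma: a path all of whose cylinders lack a finite subcover lies in no member of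
  the cover.\<close>

lemma compactin_cylinder:
  assumes x: "x \<in> X" "n \<in> N"
  shows "compactin XT (cylinder n x)"
  unfolding compactin_def topspace_XT
proof (intro conjI allI impI)
  show "cylinder n x \<subseteq> X" by (auto simp: cylinder_def)
  fix \<U> assume U: "Ball \<U> (openin XT) \<and> cylinder n x \<subseteq> \<Union>\<U>"
  show "\<exists>\<F>. finite \<F> \<and> \<F> \<subseteq> \<U> \<and> cylinder n x \<subseteq> \<Union>\<F>"
  proof (rule ccontr)
    assume neg: "\<not> ?thesis"
    define P where "P \<mu> \<longleftrightarrow> \<mu> \<in> mor \<Lambda> \<and> \<not> fincov \<U> \<mu>" for \<mu>
    have d: "deg \<Lambda> (x (0, n)) = n" using x by simp
    have "\<not> fincov \<U> (x (0, n))" using neg unfolding fincov_def cylinder_def d .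
    then have P0: "P (x (0, n))" unfolding P_def using x by simp
    obtain w where w: "w 0 = x (0, n)" "\<And>j. P (w j)" 
      "\<And>j. prefix (w j) (w (Suc j)) \<and> deg \<Lambda> (w (Suc j)) = deg \<Lambda> (w j) + diag 1"
    proof -
      define step where "step \<mu> = (SOME \<xi>. prefix \<mu> \<xi> \<and> deg \<Lambda> \<xi> = deg \<Lambda> \<mu> + diag 1 \<and> \<not> fincov \<U> \<xi>)" for \<mu>
      have step: "prefix \<mu> (step \<mu>) \<and> deg \<Lambda> (step \<mu>) = deg \<Lambda> \<mu> + diag 1 \<and> \<not> fincov \<U> (step \<mu>)" if "P \<mu>" for \<mu>
        unfolding step_def by (rule someI_ex) (use that fincov_extend P_def in metis)
      define w where "w j = (step ^^ j) (x (0, n))" for j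
      have P: "P (w j)" for j
      proof (induction j)
        case 0 then show ?case using P0 by (simp add: w_def)
      next
        case (Suc j) then show ?case using step[OF Suc] prefix_mor(2) by (auto simp: w_def P_def)
      qed
      have "prefix (w j) (w (Suc j)) \<and> deg \<Lambda> (w (Suc j)) = deg \<Lambda> (w j) + diag 1" for j
        using step[OF P[of j]] by (simp add: w_def)
      then show ?thesis using that[of w] P by (simp add: w_def)
    qed
    have dw: "deg \<Lambda> (w j) = n + diag j" for j
    proof (induction j)
      case 0 then show ?case using w(1) d by simp
    next
      case (Suc j)
      then show ?case using w(3)[of j] by (simp only: diag_Suc add.assoc)
    qed
    obtain y where y: "y \<in> X" "\<And>j. y (0, n + diag j) = w j"
    proof (rule path_of_prefixes[of w, unfolded dw])
      show "prefix (w j) (w (Suc j))" for j using w(3) by blast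
      fix a assume "a \<in> N"
      then obtain j where "a \<le> diag j" using diag_cofinal by blast
      then show "\<exists>j. a \<le> n + diag j" by (intro exI[of _ j]) (auto simp: le_fun_def intro: trans_le_add2)
    qed blast
    have "y (0, n) = x (0, n)" using y(2)[of 0] w(1) by simp
    then have "y \<in> cylinder n x" using y(1) by (simp add: cylinder_def)
    then obtain V where V: "V \<in> \<U>" "y \<in> V" using U by blast
    then obtain a where a: "a \<in> N" "cylinder a y \<subseteq> V" using U openin_XT by blast
    obtain j where j: "a \<le> diag j" using diag_cofinal a by blast
    have "a \<le> n + diag j" using j by (auto simp: le_fun_def intro: trans_le_add2)
    then have "cylinder (n + diag j) y \<subseteq> V" using cylinder_mono[OF a(1) _ _ y(1)] a(2) x(2) by blast
    then have "fincov \<U> (w j)" unfolding fincov_def dw using V(1)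
      by (intro exI[of _ "{V}"]) (auto simp: cylinder_def y(2))
    then show False using w(2) P_def by blast
  qed
qed

lemma locally_compact_XT: "locally_compact_space XT"
  unfolding locally_compact_space_def topspace_XT
proof
  fix x assume "x \<in> X"
  then show "\<exists>U K. openin XT U \<and> compactin XT K \<and> x \<in> U \<and> U \<subseteq> K"
    by (intro exI[of _ "cylinder 0 x"] conjI openin_cylinder compactin_cylinder) (auto simp: cylinder_def)
qed

end

section \<open>Continuity of the groupoid operations\<close>

text \<open>Composition matters on composable pairs only, so continuity is tested with open boxes
  cut down to \<open>S\<close>.\<close>

lemma continuous_map_subtopology_prodI:
  assumes "\<And>x y. x \<in> topspace A \<Longrightarrow> y \<in> topspace B \<Longrightarrow> (x, y) \<in> S \<Longrightarrow> f (x, y) \<in> topspace C"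
    and nbhd: "\<And>x y W. x \<in> topspace A \<Longrightarrow> y \<in> topspace B \<Longrightarrow> (x, y) \<in> S \<Longrightarrow> openin C W \<Longrightarrow> f (x, y) \<in> W \<Longrightarrow>
      \<exists>U V. openin A U \<and> openin B V \<and> x \<in> U \<and> y \<in> V \<and> (\<forall>x'\<in>U. \<forall>y'\<in>V. (x', y') \<in> S \<longrightarrow> f (x', y') \<in> W)"
  shows "continuous_map (subtopology (prod_topology A B) S) C f"
  unfolding continuous_map_def
proof (intro conjI allI impI)
  show "f \<in> topspace (subtopology (prod_topology A B) S) \<rightarrow> topspace C"
    using assms(1) by auto
  fix W assume W: "openin C W"
  let ?P = "{p \<in> topspace (subtopology (prod_topology A B) S). f p \<in> W}"
  have "\<exists>T. openin (subtopology (prod_topology A B) S) T \<and> p \<in> T \<and> T \<subseteq> ?P" if p: "p \<in> ?P" for p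
  proof -
    obtain x y where xy: "p = (x, y)" "x \<in> topspace A" "y \<in> topspace B" "(x, y) \<in> S" "f (x, y) \<in> W"
      using p by auto
    obtain U V where UV: "openin A U" "openin B V" "x \<in> U" "y \<in> V" 
      "\<forall>x'\<in>U. \<forall>y'\<in>V. (x', y') \<in> S \<longrightarrow> f (x', y') \<in> W"
      using nbhd[OF xy(2-4) W xy(5)] by blast
    have "U \<subseteq> topspace A" "V \<subseteq> topspace B" using UV(1,2) openin_subset by blast+
    moreover have "openin (subtopology (prod_topology A B) S) (S \<inter> U \<times> V)"
      using UV(1,2) by (intro openin_subtopology_Int2) (simp add: openin_prod_Times_iff)
    ultimately show ?thesis using UV xy by (intro exI[of _ "S \<inter> U \<times> V"]) auto
  qed
  then show "openin (subtopology (prod_topology A B) S) ?P" by (subst openin_subopen) blast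
qed

lemma local_homeomorphismI:
  assumes "continuous_map X Y f" "open_map X Y f"
    and "\<And>x. x \<in> topspace X \<Longrightarrow> \<exists>U. openin X U \<and> x \<in> U \<and> inj_on f U"
  shows "local_homeomorphism X Y f"
  unfolding local_homeomorphism_def
proof
  fix x assume "x \<in> topspace X"
  then obtain U where U: "openin X U" "x \<in> U" "inj_on f U" using assms(3) by blast
  have fU: "openin Y (f ` U)" using U(1) assms(2) by (simp add: open_map_def)
  have "homeomorphic_map (subtopology X U) (subtopology Y (f ` U)) f"
  proof (rule bijective_open_imp_homeomorphic_map)
    show "continuous_map (subtopology X U) (subtopology Y (f ` U)) f"
      using assms(1) by (simp add: continuous_map_in_subtopology continuous_map_from_subtopology)
    show "open_map (subtopology X U) (subtopology Y (f ` U)) f"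
      unfolding open_map_def
    proof (intro allI impI)
      fix V assume "openin (subtopology X U) V"
      then have "openin X V" "V \<subseteq> U" using U(1) openin_open_subtopology by blast+
      then show "openin (subtopology Y (f ` U)) (f ` V)"
        using assms(2) fU by (simp add: openin_open_subtopology open_map_def image_mono)
    qed
    have UV: "U \<subseteq> topspace X" "f ` U \<subseteq> topspace Y" using U(1) fU openin_subset by blast+
    then show "f ` topspace (subtopology X U) = topspace (subtopology Y (f ` U))"
      by (simp add: Int_absorb1 topspace_subtopology_subset)
    show "inj_on f (topspace (subtopology X U))" using U(3) UV by (simp add: Int_absorb1)
  qed
  then show "\<exists>U. openin X U \<and> x \<in> U \<and> openin Y (f ` U) \<and> homeomorphic_map (subtopology X U) (subtopology Y (f ` U)) f"
    using U fU by blast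
qed

context higher_rank_graph
begin

abbreviation px :: "'a path \<times> (nat \<Rightarrow> int) \<times> 'a path \<Rightarrow> 'a path" where "px \<equiv> \<lambda>(x, p, y). x"
abbreviation py :: "'a path \<times> (nat \<Rightarrow> int) \<times> 'a path \<Rightarrow> 'a path" where "py \<equiv> \<lambda>(x, p, y). y"

lemma G_simps [simp]:
  "src G (x, p, y) = (y, 0, y)" "rng G (x, p, y) = (x, 0, x)" 
  "cmp G (x, p, y) (y', r, z) = (x, p + r, z)" "ginv G (x, p, y) = (y, - p, x)"
  by (simp_all add: path_groupoid_def)

lemma mor_GD: "(x, p, y) \<in> mor G \<Longrightarrow> x \<in> X" "(x, p, y) \<in> mor G \<Longrightarrow> y \<in> X"
  by (auto simp: path_groupoid_def)

lemma matched_sym: "matched l m x y \<Longrightarrow> matched m l y x"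
  by (auto simp: matched_def)

text \<open>Adding \<open>l'\<close> to the first pair and \<open>m\<close> to the second cuts the
  shared path \<open>y\<close> at \<open>l' + m\<close> on both sides.\<close>

lemma matched_trans:
  assumes "matched l m x y" "matched l' m' y z"
  shows "matched (l + l') (l' + m) x y" "matched (l' + m) (m' + m) y z" "matched (l + l') (m' + m) x z"
proof -
  have N: "l \<in> N" "m \<in> N" "l' \<in> N" "m' \<in> N" using assms by (auto simp: matched_def)
  show 1: "matched (l + l') (l' + m) x y" using matched_add(1)[OF assms(1) N(3)] by (simp add: add.commute)
  show 2: "matched (l' + m) (m' + m) y z" using matched_add(1)[OF assms(2) N(2)] .
  show "matched (l + l') (m' + m) x z" using 1 2 by (simp add: matched_def)
qed

lemma mor_G_cmp:
  assumes "(x, p, y) \<in> mor G" "(y, r, z) \<in> mor G"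
  shows "(x, p + r, z) \<in> mor G"
proof -
  obtain l m l' m' where "matched l m x y" "p = intvec l - intvec m" "matched l' m' y z" "r = intvec l' - intvec m'"
    using assms unfolding mor_G_iff by blast
  then have "matched (l + l') (m' + m) x z" "p + r = intvec (l + l') - intvec (m' + m)"
    using matched_trans(3) by (blast, simp)
  then show ?thesis unfolding mor_G_iff by blast
qed

lemma mor_G_ginv: 
  assumes "(x, p, y) \<in> mor G" shows "(y, - p, x) \<in> mor G"
proof -
  obtain l m where "matched l m x y" "p = intvec l - intvec m" using assms unfolding mor_G_iff by blast
  then have "matched m l y x" "- p = intvec m - intvec l" using matched_sym by auto
  then show ?thesis unfolding mor_G_iff by blast
qed

text \<open>\<open>y'\<close> is the segment \<open>y (0, m)\<close> continued by the tail of
  \<open>x'\<close>. Together with \<open>nbd_inj\<close> this presents each basic set as the graph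
  of a map on a cylinder.\<close>

lemma nbd_section:
  assumes "matched l m x y" "x' \<in> cylinder l x"
  obtains y' where "(x', intvec l - intvec m, y') \<in> nbd l m x y"
proof -
  have N: "l \<in> N" "m \<in> N" "y \<in> X" "x \<in> X" using assms(1) by (auto simp: matched_def)
  have x': "x' \<in> X" "x' (0, l) = x (0, l)" using assms(2) by (auto simp: cylinder_def)
  have "T l x' (0, 0) = x' (l, l)" using N by simp
  also have "\<dots> = x (l, l)" using path_0_simps(3)[OF x'(1) N(1)] path_0_simps(3)[OF N(4,1)] x'(2) by simp
  also have "\<dots> = y (m, m)" by (rule matched_vertex0[OF assms(1)])
  finally have v: "T l x' (0, 0) = y (m, m)" .
  obtain y' where y': "y' \<in> X" "y' (0, m) = y (0, m)" "T m y' = T l x'"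
    using splice[OF N(3,2) shift_in[OF x'(1) N(1)] v] by blast
  have "(x', intvec l - intvec m, y') \<in> nbd l m x y"
    unfolding nbd_def using x' y'(1,2) y'(3)[symmetric] by blast
  then show ?thesis by (rule that)
qed

lemma nbd_inj:
  assumes "matched l m x y" "(x', p, y') \<in> nbd l m x y" "(x', r, y'') \<in> nbd l m x y"
  shows "y' = y''"
proof -
  have "m \<in> N" using assms(1) by (simp add: matched_def)
  moreover have "y' \<in> X" "y'' \<in> X" "y' (0, m) = y'' (0, m)" "T m y' = T m y''"
    using assms(2,3) unfolding nbd_def by auto
  ultimately show ?thesis using path_eq_shiftI by blast
qed

lemma nbd_px: "(x', p, y') \<in> nbd l m x y \<Longrightarrow> x' \<in> cylinder l x"
  by (auto simp: nbd_def cylinder_def)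

lemma px_nbd: "matched l m x y \<Longrightarrow> px ` nbd l m x y = cylinder l x"
proof (intro equalityI subsetI)
  fix x' assume "matched l m x y" "x' \<in> cylinder l x"
  then obtain y' where "(x', intvec l - intvec m, y') \<in> nbd l m x y" by (rule nbd_section)
  then show "x' \<in> px ` nbd l m x y" by force
next
  fix x' assume "x' \<in> px ` nbd l m x y"
  then show "x' \<in> cylinder l x" using nbd_px by auto
qed

lemma nbd_ginv: "g \<in> nbd l m x y \<Longrightarrow> ginv G g \<in> nbd m l y x"
  by (auto simp: nbd_def)

lemma inj_on_px_nbd: 
  assumes "matched l m x y" shows "inj_on px (nbd l m x y)"
proof (rule inj_onI)
  fix g h assume gh: "g \<in> nbd l m x y" "h \<in> nbd l m x y" "px g = px h"
  obtain a p b where g: "g = (a, p, b)" by (cases g)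
  obtain a' p' b' where h: "h = (a', p', b')" by (cases h)
  have "a = a'" using gh(3) g h by simp
  moreover have "p = p'" using gh(1,2) unfolding g h nbd_def by simp
  moreover have "b = b'" using nbd_inj[OF assms] gh(1,2) unfolding g h \<open>a = a'\<close> by blast
  ultimately show "g = h" using g h by simp
qed

lemma inj_on_py_nbd: 
  assumes "matched l m x y" shows "inj_on py (nbd l m x y)"
proof (rule inj_onI)
  fix g h assume gh: "g \<in> nbd l m x y" "h \<in> nbd l m x y" "py g = py h"
  have "px (ginv G g) = px (ginv G h)" using gh(3) by (cases g, cases h) simp
  then have "ginv G g = ginv G h"
    using inj_onD[OF inj_on_px_nbd[OF matched_sym[OF assms]]] nbd_ginv gh(1,2) by blast
  then show "g = h" by (cases g, cases h) simp
qed

lemma openin_GT_I: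
  assumes "U \<subseteq> mor G"
    and "\<And>x l m y. matched l m x y \<Longrightarrow> (x, intvec l - intvec m, y) \<in> U \<Longrightarrow> \<exists>a\<in>N. nbd (l + a) (m + a) x y \<subseteq> U"
  shows "openin GT U"
  unfolding openin_GT
proof (intro conjI allI impI assms(1))
  fix x p y assume xy: "(x, p, y) \<in> U"
  then obtain l m where lm: "matched l m x y" "p = intvec l - intvec m" using assms(1) mor_G_iff by blast
  then obtain a where a: "a \<in> N" "nbd (l + a) (m + a) x y \<subseteq> U" using assms(2) xy by blast
  then have "matched (l + a) (m + a) x y" "p = intvec (l + a) - intvec (m + a)" using lm matched_add by auto
  then show "\<exists>l m. matched l m x y \<and> p = intvec l - intvec m \<and> nbd l m x y \<subseteq> U" using a by blast
qed

text \<open>All arrows of a basic cylinder have the same degree, so the degree is locally constant.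
  This later separates arrows with the same ends.\<close>

lemma openin_degree: "openin GT {(x, p, y). (x, p, y) \<in> mor G \<and> p \<in> D}"
proof (rule openin_GT_I)
  fix x y l m assume *: "matched l m x y" "(x, intvec l - intvec m, y) \<in> {(x, p, y). (x, p, y) \<in> mor G \<and> p \<in> D}"
  have "nbd l m x y \<subseteq> {(x, p, y). (x, p, y) \<in> mor G \<and> p \<in> D}"
  proof (intro subsetI)
    fix g assume g: "g \<in> nbd l m x y"
    obtain x' p' y' where g': "g = (x', p', y')" by (cases g)
    have "p' = intvec l - intvec m" "g \<in> mor G" using g g' nbd_subset_mor[OF *(1)] unfolding nbd_def by auto
    then show "g \<in> {(x, p, y). (x, p, y) \<in> mor G \<and> p \<in> D}" using * g' by simp
  qed
  then show "\<exists>a\<in>N. nbd (l + a) (m + a) x y \<subseteq> {(x, p, y). (x, p, y) \<in> mor G \<and> p \<in> D}"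
    by (intro bexI[of _ 0]) simp_all
qed auto

lemma continuous_px: "continuous_map GT XT px"
  unfolding continuous_map_def
proof (intro conjI allI impI)
  show "px \<in> topspace GT \<rightarrow> topspace XT" using mor_GD(1) by auto
  fix U assume U: "openin XT U"
  show "openin GT {g \<in> topspace GT. px g \<in> U}"
  proof (rule openin_GT_I)
    show "{g \<in> topspace GT. px g \<in> U} \<subseteq> mor G" by auto
    fix x y l m assume *: "matched l m x y" "(x, intvec l - intvec m, y) \<in> {g \<in> topspace GT. px g \<in> U}"
    then obtain n where n: "n \<in> N" "cylinder n x \<subseteq> U" using U openin_XT by auto
    have lN: "l \<in> N" "m \<in> N" "x \<in> X" using *(1) by (auto simp: matched_def)
    have mt: "matched (l + n) (m + n) x y" using matched_add(1)[OF *(1) n(1)] .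
    have "nbd (l + n) (m + n) x y \<subseteq> {g \<in> topspace GT. px g \<in> U}"
    proof (intro subsetI)
      fix g assume g: "g \<in> nbd (l + n) (m + n) x y"
      then have "px g \<in> cylinder (l + n) x" using px_nbd[OF mt] by blast
      also have "\<dots> \<subseteq> cylinder n x" by (rule cylinder_mono) (use n lN in auto)
      finally show "g \<in> {g \<in> topspace GT. px g \<in> U}" using g nbd_subset_mor[OF mt] n(2) by auto
    qed
    then show "\<exists>a\<in>N. nbd (l + a) (m + a) x y \<subseteq> {g \<in> topspace GT. px g \<in> U}" using n(1) by blast
  qed
qed

lemma openin_XT_I:
  assumes "U \<subseteq> X" "\<And>x. x \<in> U \<Longrightarrow> \<exists>n\<in>N. cylinder n x \<subseteq> U"
  shows "openin XT U"
  using assms openin_XT by blast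

lemma open_map_px: "open_map GT XT px"
  unfolding open_map_def
proof (intro allI impI)
  fix V assume V: "openin GT V"
  then have VG: "V \<subseteq> mor G" using openin_GT by blast
  show "openin XT (px ` V)"
  proof (rule openin_XT_I)
    show "px ` V \<subseteq> X" using VG mor_GD(1) by auto
    fix x assume "x \<in> px ` V"
    then obtain p y where "(x, p, y) \<in> V" by auto
    then obtain l m where lm: "matched l m x y" "nbd l m x y \<subseteq> V" using V openin_GT by blast
    then have "cylinder l x \<subseteq> px ` V" using px_nbd[OF lm(1)] by blast
    moreover have "l \<in> N" using lm(1) by (simp add: matched_def)
    ultimately show "\<exists>n\<in>N. cylinder n x \<subseteq> px ` V" by blast
  qed
qed

lemma ginv_ginv_G [simp]: "ginv G (ginv G g) = g" by (cases g) simp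

lemma ginv_mor_G: "g \<in> mor G \<Longrightarrow> ginv G g \<in> mor G"
  using mor_G_ginv by (cases g) simp

lemma openin_ginv_vimage: 
  assumes V: "openin GT V" shows "openin GT {g \<in> mor G. ginv G g \<in> V}"
proof (rule openin_GT_I)
  fix x y l m assume *: "matched l m x y" "(x, intvec l - intvec m, y) \<in> {g \<in> mor G. ginv G g \<in> V}"
  then have "(y, intvec m - intvec l, x) \<in> V" by simp
  then obtain a where a: "a \<in> N" "nbd (m + a) (l + a) y x \<subseteq> V"
    using openin_GT_matched[OF V matched_sym[OF *(1)]] by blast
  have "nbd (l + a) (m + a) x y \<subseteq> {g \<in> mor G. ginv G g \<in> V}"
    using nbd_ginv nbd_subset_mor[OF matched_add(1)[OF *(1) a(1)]] a(2) by blast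
  then show "\<exists>a\<in>N. nbd (l + a) (m + a) x y \<subseteq> {g \<in> mor G. ginv G g \<in> V}" using a(1) by blast
qed auto

lemma continuous_ginv_G: "continuous_map GT GT (ginv G)"
  unfolding continuous_map_def using openin_ginv_vimage ginv_mor_G by auto

text \<open>Source is range after inversion, so continuity and openness of \<open>py\<close> come
  from those of \<open>px\<close> and \<open>ginv G\<close>.\<close>

lemma py_eq: "py = px \<circ> ginv G" by (auto simp: fun_eq_iff)

lemma continuous_py: "continuous_map GT XT py"
  unfolding py_eq by (rule continuous_map_compose[OF continuous_ginv_G continuous_px])

lemma open_map_ginv_G: "open_map GT GT (ginv G)"
  unfolding open_map_def
proof (intro allI impI)
  fix V assume V: "openin GT V"
  then have "V \<subseteq> mor G" using openin_GT by blast
  then have "ginv G ` V = {g \<in> mor G. ginv G g \<in> V}"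
    using ginv_mor_G by (auto simp del: G_simps intro: rev_image_eqI[of "ginv G _"])
  then show "openin GT (ginv G ` V)" using openin_ginv_vimage[OF V] by simp
qed

lemma open_map_py: "open_map GT XT py"
  unfolding py_eq by (rule open_map_compose[OF open_map_ginv_G open_map_px])

lemma openin_units: 
  assumes "openin XT U" shows "openin GT ((\<lambda>x. (x, 0, x)) ` U)"
proof -
  have U: "U \<subseteq> X" "\<forall>x\<in>U. \<exists>n\<in>N. cylinder n x \<subseteq> U" using assms openin_XT by blast+
  have "(\<lambda>x. (x, 0, x)) ` U = \<Union>{nbd n n x x | n x. n \<in> N \<and> x \<in> U \<and> cylinder n x \<subseteq> U}" (is "?L = \<Union>?R")
  proof (intro equalityI subsetI)
    fix g assume "g \<in> ?L"
    then obtain x where x: "x \<in> U" "g = (x, 0, x)" by blast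
    then obtain n where n: "n \<in> N" "cylinder n x \<subseteq> U" using U by blast
    have "g \<in> nbd n n x x" unfolding nbd_diag[OF n(1)] x(2) using x(1) U(1) by (auto simp: cylinder_def)
    then show "g \<in> \<Union>?R" using x n by blast
  next
    fix g assume "g \<in> \<Union>?R"
    then obtain n x where n: "n \<in> N" "x \<in> U" "cylinder n x \<subseteq> U" "g \<in> nbd n n x x" by blast
    then show "g \<in> ?L" unfolding nbd_diag[OF n(1)] by blast
  qed
  moreover have "openin GT (\<Union>?R)"
  proof (rule openin_Union)
    fix V assume "V \<in> ?R"
    then obtain n x where "V = nbd n n x x" "n \<in> N" "x \<in> U" by blast
    then show "openin GT V" using openin_nbd[of n n x x] U(1) by (auto simp: matched_def)
  qed
  ultimately show ?thesis by simp
qed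

lemma continuous_unit: "continuous_map XT GT (\<lambda>x. (x, 0, x))"
  unfolding continuous_map_def
proof (intro conjI allI impI)
  show "(\<lambda>x. (x, 0, x)) \<in> topspace XT \<rightarrow> topspace GT" using unit_in_mor by simp
  fix U assume "openin GT U"
  then have "openin XT ((\<lambda>x. (x, 0, x)) -` U \<inter> X)"
    unfolding inf_path_topology_def openin_pullback_topology by blast
  moreover have "(\<lambda>x. (x, 0, x)) -` U \<inter> X = {x \<in> topspace XT. (x, 0, x) \<in> U}" by auto
  ultimately show "openin XT {x \<in> topspace XT. (x, 0, x) \<in> U}" by simp
qed

lemma nbd_cmp:
  assumes "(x', p, y') \<in> nbd l m x y" "(y', r, z') \<in> nbd m n y z"
  shows "(x', p + r, z') \<in> nbd l n x z"
  using assms unfolding nbd_def by auto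

text \<open>Cylinders of the factors that share the segment of \<open>y\<close> in the middle
  multiply into a cylinder of the product. The pointwise form serves both the interior isotropy and
  the quotient.\<close>

lemma cmp_nbhd_G:
  assumes "(x, p, y) \<in> mor G" "(y, r, z) \<in> mor G" "openin GT W" "(x, p + r, z) \<in> W"
  obtains U V where "openin GT U" "openin GT V" "(x, p, y) \<in> U" "(y, r, z) \<in> V"
    "\<And>x' p' y' r' z'. (x', p', y') \<in> U \<Longrightarrow> (y', r', z') \<in> V \<Longrightarrow> (x', p' + r', z') \<in> W"
proof -
  obtain l m l' m' where lm: "matched l m x y" "p = intvec l - intvec m" "matched l' m' y z" "r = intvec l' - intvec m'"
    using assms(1,2) unfolding mor_G_iff by blast
  note mt = matched_trans[OF lm(1,3)]
  have pr: "p + r = intvec (l + l') - intvec (m' + m)" using lm by simp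
  obtain a where a: "a \<in> N" "nbd (l + l' + a) (m' + m + a) x z \<subseteq> W" 
    using openin_GT_matched[OF assms(3) mt(3)] assms(4) unfolding pr by blast
  note mta = mt(1,2)[THEN matched_add(1), OF a(1)]
  show ?thesis
  proof (rule that[OF openin_nbd[OF mta(1)] openin_nbd[OF mta(2)]])
    show "(x, p, y) \<in> nbd (l + l' + a) (l' + m + a) x y" using nbd_self[OF mta(1)] lm(2) by simp
    show "(y, r, z) \<in> nbd (l' + m + a) (m' + m + a) y z" using nbd_self[OF mta(2)] lm(4) by simp
  qed (use nbd_cmp a(2) in blast)
qed

lemma I_subset_mor: "I \<subseteq> mor G"
  using openin_I openin_GT by blast

end

section \<open>Closedness of the interior and the trivial bundle\<close>

context cofinal_graph
begin

text \<open>An arrow outside \<open>I\<close> either has different ends, an open condition as the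
  path space is Hausdorff, or has a degree outside Per, an open condition as the degree is locally
  constant.\<close>

lemma closedin_I: "closedin GT I"
proof -
  have "openin GT (topspace GT - I)"
  proof -
    have "mor G - I = {g \<in> mor G. (px g, py g) \<in> X \<times> X - {(x, x) |x. True}} \<union> {(x, p, y). (x, p, y) \<in> mor G \<and> p \<in> - Per k \<Lambda>}"
      using mem_I mor_GD by auto
    moreover have "openin GT {g \<in> mor G. (px g, py g) \<in> X \<times> X - {(x, x) |x. True}}"
    proof -
      have "closedin (prod_topology XT XT) ((\<lambda>x. (x, x)) ` topspace XT)"
        using Hausdorff_XT Hausdorff_space_closedin_diagonal by blast
      then have "openin (prod_topology XT XT) (X \<times> X - (\<lambda>x. (x, x)) ` X)"
        unfolding closedin_def by simp
      moreover have "continuous_map GT (prod_topology XT XT) (\<lambda>g. (px g, py g))"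
        using continuous_px continuous_py by (simp add: continuous_map_paired)
      ultimately have "openin GT {g \<in> topspace GT. (px g, py g) \<in> X \<times> X - (\<lambda>x. (x, x)) ` X}"
        using openin_continuous_map_preimage by blast
      moreover have "X \<times> X - {(x, x) |x. True} = X \<times> X - (\<lambda>x. (x, x)) ` X" by auto
      ultimately show ?thesis by simp
    qed
    ultimately show ?thesis using openin_degree[of "- Per k \<Lambda>"] by (simp only: topspace_GT openin_Un)
  qed
  then show ?thesis unfolding closedin_def using I_subset_mor by simp
qed

abbreviation "IG \<equiv> interior_isotropy_groupoid k \<Lambda>"
abbreviation "IT \<equiv> interior_isotropy_topology k \<Lambda>"
abbreviation "PB \<equiv> Per_bundle k \<Lambda>"
abbreviation "PT \<equiv> Per_bundle_topology k \<Lambda>"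

lemma topspace_IT [simp]: "topspace IT = I"
  unfolding interior_isotropy_topology_def using I_subset_mor by auto

lemma IG_simps [simp]: "mor IG = I" "src IG = src G" "rng IG = rng G" "cmp IG = cmp G" "ginv IG = ginv G"
  by (simp_all add: interior_isotropy_groupoid_def)

lemma PB_simps [simp]: "mor PB = X \<times> Per k \<Lambda>" "src PB (x, m) = (x, 0)" "rng PB (x, m) = (x, 0)" 
  "cmp PB (x, m) (y, n) = (x, m + n)" "ginv PB (x, m) = (x, - m)"
  by (simp_all add: Per_bundle_def)

lemma topspace_PT [simp]: "topspace PT = X \<times> Per k \<Lambda>"
  by (simp add: Per_bundle_topology_def)

lemma openin_IT: "openin IT V \<longleftrightarrow> openin GT V \<and> V \<subseteq> I"
  unfolding interior_isotropy_topology_def using openin_open_subtopology[OF openin_I] .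

lemma topological_groupoid_IG: "topological_groupoid IG IT"
  unfolding topological_groupoid_def
proof (intro conjI)
  show "groupoid IG"
    unfolding groupoid_def category_def
    by (auto simp: I_eq add.assoc intro: Per_0 Per_add Per_uminus)
  show "continuous_map (subtopology (prod_topology IT IT) {(g, h). src IG g = rng IG h}) IT (\<lambda>(g, h). cmp IG g h)"
  proof (rule continuous_map_subtopology_prodI)
    fix g h assume "g \<in> topspace IT" "h \<in> topspace IT" "(g, h) \<in> {(g, h). src IG g = rng IG h}"
    then show "(case (g, h) of (g, h) \<Rightarrow> cmp IG g h) \<in> topspace IT"
      by (auto simp: I_eq intro: Per_add)
    fix W assume W: "openin IT W" "(case (g, h) of (g, h) \<Rightarrow> cmp IG g h) \<in> W"
    assume gh: "g \<in> topspace IT" "h \<in> topspace IT" "(g, h) \<in> {(g, h). src IG g = rng IG h}"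
    obtain x p y where g: "g = (x, p, y)" by (cases g)
    obtain y' r z where h: "h = (y', r, z)" by (cases h)
    have [simp]: "y' = y" using gh(3) g h by simp
    have "(x, p, y) \<in> mor G" "(y, r, z) \<in> mor G" using gh(1,2) I_subset_mor g h by auto
    moreover have "openin GT W" "(x, p + r, z) \<in> W" using W g h openin_IT by auto
    ultimately obtain U V where UV: "openin GT U" "openin GT V" "(x, p, y) \<in> U" "(y, r, z) \<in> V"
      "\<And>x' p' y' r' z'. (x', p', y') \<in> U \<Longrightarrow> (y', r', z') \<in> V \<Longrightarrow> (x', p' + r', z') \<in> W"
      by (rule cmp_nbhd_G) blast
    have "openin IT (U \<inter> I)" "openin IT (V \<inter> I)" "g \<in> U \<inter> I" "h \<in> V \<inter> I"
      using UV(1-4) openin_I openin_IT gh(1,2) g h by auto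
    moreover have "cmp G g' h' \<in> W" if "g' \<in> U \<inter> I" "h' \<in> V \<inter> I" "src G g' = rng G h'" for g' h'
      using that UV(5) by (cases g', cases h') auto
    ultimately show "\<exists>U V. openin IT U \<and> openin IT V \<and> g \<in> U \<and> h \<in> V \<and>
      (\<forall>x'\<in>U. \<forall>y'\<in>V. (x', y') \<in> {(g, h). src IG g = rng IG h} \<longrightarrow> (case (x', y') of (g, h) \<Rightarrow> cmp IG g h) \<in> W)"
      by (intro exI[of _ "U \<inter> I"] exI[of _ "V \<inter> I"]) simp
  qed
  have "ginv G ` I \<subseteq> I" by (auto simp: I_eq intro: Per_uminus)
  then show "continuous_map IT IT (ginv IG)"
    unfolding interior_isotropy_topology_def using continuous_ginv_G I_subset_mor
    by (auto simp: continuous_map_in_subtopology continuous_map_from_subtopology Int_absorb1)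
qed simp

lemma topological_groupoid_PB: "topological_groupoid PB PT"
  unfolding topological_groupoid_def
proof (intro conjI)
  show "groupoid PB"
    unfolding groupoid_def category_def
    by (auto simp: add.assoc intro: Per_0 Per_add Per_uminus)
  show "continuous_map (subtopology (prod_topology PT PT) {(g, h). src PB g = rng PB h}) PT (\<lambda>(g, h). cmp PB g h)"
  proof (rule continuous_map_subtopology_prodI)
    fix g h assume "g \<in> topspace PT" "h \<in> topspace PT" "(g, h) \<in> {(g, h). src PB g = rng PB h}"
    then show "(case (g, h) of (g, h) \<Rightarrow> cmp PB g h) \<in> topspace PT"
      by (auto intro: Per_add)
    fix W assume W: "openin PT W" "(case (g, h) of (g, h) \<Rightarrow> cmp PB g h) \<in> W"
    assume gh: "g \<in> topspace PT" "h \<in> topspace PT" "(g, h) \<in> {(g, h). src PB g = rng PB h}"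
    obtain x p where g: "g = (x, p)" by (cases g)
    obtain y r where h: "h = (y, r)" by (cases h)
    have [simp]: "y = x" using gh(3) g h by simp
    have "(x, p + r) \<in> W" using W(2) g h by simp
    then obtain A B where AB: "openin XT A" "x \<in> A" "p + r \<in> B" "A \<times> B \<subseteq> W"
      using W(1) unfolding Per_bundle_topology_def openin_prod_topology_alt by blast
    have "openin PT (A \<times> {p})" "openin PT (A \<times> {r})"
      unfolding Per_bundle_topology_def using AB(1) gh(1,2) g h by (auto simp: openin_prod_Times_iff)
    then show "\<exists>U V. openin PT U \<and> openin PT V \<and> g \<in> U \<and> h \<in> V \<and>
      (\<forall>x'\<in>U. \<forall>y'\<in>V. (x', y') \<in> {(g, h). src PB g = rng PB h} \<longrightarrow> (case (x', y') of (g, h) \<Rightarrow> cmp PB g h) \<in> W)"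
      using AB g h by (intro exI[of _ "A \<times> {p}"] exI[of _ "A \<times> {r}"]) auto
  qed
  have eq: "ginv PB = (\<lambda>(x, m). (x, - m))" by (simp add: Per_bundle_def)
  show "continuous_map PT PT (ginv PB)"
    unfolding eq Per_bundle_topology_def continuous_map_prod_top
    by (auto intro: Per_uminus)
qed simp

lemma iso_IG_PB: "topological_groupoid_iso IG IT PB PT (\<lambda>(x, m, y). (x, m))" (is "topological_groupoid_iso _ _ _ _ ?f")
  unfolding topological_groupoid_iso_def
proof (intro conjI topological_groupoid_IG topological_groupoid_PB)
  show "cat_functor IG PB ?f"
    unfolding cat_functor_def by (auto simp: mem_I intro: Per_0)
  show "homeomorphic_map IT PT ?f"
  proof (rule bijective_open_imp_homeomorphic_map)
    have "continuous_map IT XT px"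
      unfolding interior_isotropy_topology_def by (rule continuous_map_from_subtopology[OF continuous_px])
    moreover have "continuous_map IT (discrete_topology (Per k \<Lambda>)) (\<lambda>(x, m, y). m)"
      unfolding continuous_map_def
    proof (intro conjI allI impI)
      fix D assume "openin (discrete_topology (Per k \<Lambda>)) D"
      have "{g \<in> topspace IT. (case g of (x, m, y) \<Rightarrow> m) \<in> D} = {(x, p, y). (x, p, y) \<in> mor G \<and> p \<in> D} \<inter> I"
        using I_subset_mor by auto
      then show "openin IT {g \<in> topspace IT. (case g of (x, m, y) \<Rightarrow> m) \<in> D}"
        using openin_degree[of D] openin_I by (simp add: openin_IT openin_Int)
    qed (auto simp: mem_I)
    ultimately have "continuous_map IT PT (\<lambda>g. (px g, (\<lambda>(x, m, y). m) g))"
      unfolding Per_bundle_topology_def by (simp add: continuous_map_paired)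
    moreover have "(\<lambda>g. (px g, (\<lambda>(x, m, y). m) g)) = ?f" by (auto simp: fun_eq_iff)
    ultimately show "continuous_map IT PT ?f" by simp
    show "open_map IT PT ?f"
      unfolding open_map_def
    proof (intro allI impI)
      fix V assume V: "openin IT V"
      then have VI: "openin GT V" "V \<subseteq> I" using openin_IT by blast+
      show "openin PT (?f ` V)"
        unfolding Per_bundle_topology_def openin_prod_topology_alt
      proof (intro allI impI)
        fix x m assume "(x, m) \<in> ?f ` V"
        then have xm: "(x, m, x) \<in> V" "m \<in> Per k \<Lambda>" using VI(2) mem_I by auto
        \<comment> \<open>On arrows of a single degree the bundle map is the range map, which is
          open; hence the restriction to degree \<open>m\<close>.\<close>
        let ?V = "V \<inter> {(x, p, y). (x, p, y) \<in> mor G \<and> p \<in> {m}}"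
        have "openin GT ?V" using VI(1) openin_degree by (rule openin_Int)
        then have "openin XT (px ` ?V)" using open_map_px open_map_def by blast
        moreover have "x \<in> px ` ?V" using xm VI(2) I_subset_mor by force
        moreover have "px ` ?V \<times> {m} \<subseteq> ?f ` V" by force
        ultimately show "\<exists>U W. openin XT U \<and> openin (discrete_topology (Per k \<Lambda>)) W \<and> x \<in> U \<and> m \<in> W \<and> U \<times> W \<subseteq> ?f ` V"
          using xm(2) by (intro exI[of _ "px ` ?V"] exI[of _ "{m}"]) simp
      qed
    qed
    show "?f ` topspace IT = topspace PT" by (auto simp: I_eq image_iff)
    show "inj_on ?f (topspace IT)" by (auto simp: I_eq inj_on_def)
  qed
qed

end

section \<open>The quotient groupoid\<close>

context cofinal_graph
begin

abbreviation q where "q \<equiv> gcoset G I"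
abbreviation H where "H \<equiv> H_groupoid k \<Lambda>"
abbreviation HT where "HT \<equiv> H_topology k \<Lambda>"

text \<open>The coset in coordinates: the ends are kept and the degree is known modulo Per
  only.\<close>

definition arrow_class :: "'a path \<Rightarrow> (nat \<Rightarrow> int) \<Rightarrow> 'a path \<Rightarrow> ('a path \<times> (nat \<Rightarrow> int) \<times> 'a path) set" where
  "arrow_class x p y = {(x, p + c, y) |c. c \<in> Per k \<Lambda>}"

lemma q_eq: "y \<in> X \<Longrightarrow> q (x, p, y) = arrow_class x p y"
  unfolding gcoset_def arrow_class_def I_eq by auto

lemma mem_arrow_class: "x \<in> X \<Longrightarrow> (x, p, y) \<in> arrow_class x p y"
  unfolding arrow_class_def using Per_0 by fastforce

text \<open>That overlapping classes coincide rests on sums and differences of periods being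
  periods.\<close>

lemma arrow_class_eq_iff:
  assumes "x \<in> X"
  shows "arrow_class x p y = arrow_class x' p' y' \<longleftrightarrow> x = x' \<and> y = y' \<and> p - p' \<in> Per k \<Lambda>"
proof
  assume "arrow_class x p y = arrow_class x' p' y'"
  then have "(x, p, y) \<in> arrow_class x' p' y'" using mem_arrow_class[OF assms] by blast
  then show "x = x' \<and> y = y' \<and> p - p' \<in> Per k \<Lambda>" unfolding arrow_class_def by auto
next
  assume *: "x = x' \<and> y = y' \<and> p - p' \<in> Per k \<Lambda>"
  have "(\<exists>c\<in>Per k \<Lambda>. r = p + c) \<longleftrightarrow> (\<exists>c\<in>Per k \<Lambda>. r = p' + c)" for r
  proof
    assume "\<exists>c\<in>Per k \<Lambda>. r = p + c"
    then obtain c where "c \<in> Per k \<Lambda>" "r = p + c" by blast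
    then have "(p - p') + c \<in> Per k \<Lambda>" "r = p' + ((p - p') + c)" using * Per_add[OF assms] by auto
    then show "\<exists>c\<in>Per k \<Lambda>. r = p' + c" by blast
  next
    assume "\<exists>c\<in>Per k \<Lambda>. r = p' + c"
    then obtain c where "c \<in> Per k \<Lambda>" "r = p' + c" by blast
    then have "c - (p - p') \<in> Per k \<Lambda>" "r = p + (c - (p - p'))" using * Per_diff[OF assms] by auto
    then show "\<exists>c\<in>Per k \<Lambda>. r = p + c" by blast
  qed
  then show "arrow_class x p y = arrow_class x' p' y'" unfolding arrow_class_def using * by blast
qed

lemma mor_H: "mor H = {arrow_class x p y |x p y. (x, p, y) \<in> mor G}"
proof -
  have "mor H = q ` mor G" by (simp add: H_groupoid_def quotient_groupoid_def)
  also have "\<dots> = {arrow_class x p y |x p y. (x, p, y) \<in> mor G}"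
  proof (intro equalityI subsetI)
    fix A assume "A \<in> q ` mor G"
    then obtain x p y where "A = q (x, p, y)" "(x, p, y) \<in> mor G" by auto
    then show "A \<in> {arrow_class x p y |x p y. (x, p, y) \<in> mor G}" using q_eq mor_GD(2) by blast
  next
    fix A assume "A \<in> {arrow_class x p y |x p y. (x, p, y) \<in> mor G}"
    then obtain x p y where "A = arrow_class x p y" "(x, p, y) \<in> mor G" by blast
    then have "A = q (x, p, y)" "(x, p, y) \<in> mor G" using q_eq mor_GD(2) by auto
    then show "A \<in> q ` mor G" by (rule image_eqI)
  qed
  finally show ?thesis .
qed

lemma mor_H_E:
  assumes "A \<in> mor H" obtains x p y where "A = arrow_class x p y" "(x, p, y) \<in> mor G" "x \<in> X" "y \<in> X"
  using assms unfolding mor_H using mor_GD by blast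

lemma arrow_class_mor_H [intro, simp]: "(x, p, y) \<in> mor G \<Longrightarrow> arrow_class x p y \<in> mor H"
  unfolding mor_H by blast

text \<open>The operations of the quotient are unions over representatives, which collapse once
  every representative gives the same class.\<close>

lemma UN_eq_const: "A \<noteq> {} \<Longrightarrow> (\<And>a. a \<in> A \<Longrightarrow> f a = C) \<Longrightarrow> (\<Union>a\<in>A. f a) = C"
  by blast

lemma H_ops:
  assumes "(x, p, y) \<in> mor G"
  shows "src H (arrow_class x p y) = arrow_class y 0 y" "rng H (arrow_class x p y) = arrow_class x 0 x" "ginv H (arrow_class x p y) = arrow_class y (- p) x"
proof -
  note X = mor_GD[OF assms]
  have ne: "arrow_class x p y \<noteq> {}" using mem_arrow_class[OF X(1)] by blast
  show "src H (arrow_class x p y) = arrow_class y 0 y"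
    unfolding H_groupoid_def quotient_groupoid_def cat.simps
    by (rule UN_eq_const[OF ne]) (auto simp: arrow_class_def[of x p y] q_eq X)
  show "rng H (arrow_class x p y) = arrow_class x 0 x"
    unfolding H_groupoid_def quotient_groupoid_def cat.simps
    by (rule UN_eq_const[OF ne]) (auto simp: arrow_class_def[of x p y] q_eq X)
  show "ginv H (arrow_class x p y) = arrow_class y (- p) x"
    unfolding H_groupoid_def quotient_groupoid_def gpd.simps
  proof (rule UN_eq_const[OF ne])
    fix a assume "a \<in> arrow_class x p y"
    then obtain c where c: "a = (x, p + c, y)" "c \<in> Per k \<Lambda>" unfolding arrow_class_def by blast
    have "arrow_class y (- (p + c)) x = arrow_class y (- p) x" using c(2) Per_uminus by (simp add: arrow_class_eq_iff[OF X(2)])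
    then show "q (ginv G a) = arrow_class y (- p) x" using c X by (simp add: q_eq)
  qed
qed

lemma H_cmp:
  assumes "(x, p, y) \<in> mor G" "(y, r, z) \<in> mor G"
  shows "cmp H (arrow_class x p y) (arrow_class y r z) = arrow_class x (p + r) z"
proof -
  note X = mor_GD[OF assms(1)] mor_GD(2)[OF assms(2)]
  have ne: "arrow_class x p y \<noteq> {}" "arrow_class y r z \<noteq> {}" using mem_arrow_class X by blast+
  have eq: "q (cmp G a b) = arrow_class x (p + r) z" if ab: "a \<in> arrow_class x p y" "b \<in> arrow_class y r z" for a b
  proof -
    obtain c c' where c: "a = (x, p + c, y)" "c \<in> Per k \<Lambda>" "b = (y, r + c', z)" "c' \<in> Per k \<Lambda>"
      using ab unfolding arrow_class_def by blast
    have "p + c + (r + c') - (p + r) = c + c'" by simp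
    then show ?thesis using c X Per_add[OF X(1)] by (simp add: q_eq arrow_class_eq_iff)
  qed
  \<comment> \<open>Representatives of a class differ in degree only, so every pair from the two
    classes is composable.\<close>
  have "{b \<in> arrow_class y r z. src G a = rng G b} = arrow_class y r z" if "a \<in> arrow_class x p y" for a
    using that unfolding arrow_class_def by auto
  then have "(\<Union>b\<in>{b \<in> arrow_class y r z. src G a = rng G b}. q (cmp G a b)) = arrow_class x (p + r) z" if "a \<in> arrow_class x p y" for a
    using UN_eq_const[OF ne(2) eq[OF that]] that by simp
  then show ?thesis
    unfolding H_groupoid_def quotient_groupoid_def cat.simps by (intro UN_eq_const[OF ne(1)])
qed

lemma groupoid_H: "groupoid H"
proof -
  have unit: "(x, 0, x) \<in> mor G" if "x \<in> X" for x using unit_in_mor that .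
  have c: "category H"
    unfolding category_def
  proof (intro conjI ballI impI)
    fix f assume "f \<in> mor H"
    then obtain x p y where f: "f = arrow_class x p y" "(x, p, y) \<in> mor G" "x \<in> X" "y \<in> X" by (rule mor_H_E)
    note s = H_ops[OF f(2)] H_ops[OF unit[OF f(3)]] H_ops[OF unit[OF f(4)]] 
      H_cmp[OF unit[OF f(3)] f(2)] H_cmp[OF f(2) unit[OF f(4)]] unit[OF f(3)] unit[OF f(4)]
    show "src H f \<in> mor H" "rng H f \<in> mor H"
      "src H (src H f) = src H f" "rng H (src H f) = src H f" "src H (rng H f) = rng H f"
      "rng H (rng H f) = rng H f" "cmp H (rng H f) f = f" "cmp H f (src H f) = f"
      unfolding f(1) by (simp_all add: s)
  next
    fix f g assume fg: "f \<in> mor H" "g \<in> mor H" "src H f = rng H g"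
    obtain x p y where f: "f = arrow_class x p y" "(x, p, y) \<in> mor G" "x \<in> X" "y \<in> X" using fg(1) by (rule mor_H_E)
    obtain y' r z where g: "g = arrow_class y' r z" "(y', r, z) \<in> mor G" "y' \<in> X" "z \<in> X" using fg(2) by (rule mor_H_E)
    have "y' = y" using fg(3) unfolding f(1) g(1) by (simp add: H_ops[OF f(2)] H_ops[OF g(2)] arrow_class_eq_iff[OF f(4)])
    note g = g[unfolded this]
    note s = H_ops[OF f(2)] H_ops[OF g(2)] H_cmp[OF f(2) g(2)] mor_G_cmp[OF f(2) g(2)] H_ops[OF mor_G_cmp[OF f(2) g(2)]]
    show "cmp H f g \<in> mor H" "src H (cmp H f g) = src H g" "rng H (cmp H f g) = rng H f"
      unfolding f(1) g(1) by (simp_all add: s)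
    fix h assume h': "h \<in> mor H" "src H g = rng H h"
    obtain z' t w where h: "h = arrow_class z' t w" "(z', t, w) \<in> mor G" "z' \<in> X" "w \<in> X" using h'(1) by (rule mor_H_E)
    have "z' = z" using h'(2) unfolding g(1) h(1) by (simp add: H_ops[OF g(2)] H_ops[OF h(2)] arrow_class_eq_iff[OF g(4)])
    note h = h[unfolded this]
    show "cmp H (cmp H f g) h = cmp H f (cmp H g h)"
      unfolding f(1) g(1) h(1) 
      by (simp add: H_cmp[OF f(2) g(2)] H_cmp[OF g(2) h(2)] H_cmp[OF mor_G_cmp[OF f(2) g(2)] h(2)]
          H_cmp[OF f(2) mor_G_cmp[OF g(2) h(2)]] add.assoc)
  qed
  show ?thesis
    unfolding groupoid_def
  proof (intro conjI c ballI)
    fix f assume "f \<in> mor H"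
    then obtain x p y where f: "f = arrow_class x p y" "(x, p, y) \<in> mor G" "x \<in> X" "y \<in> X" by (rule mor_H_E)
    note i = mor_G_ginv[OF f(2)]
    note s = H_ops[OF f(2)] H_ops[OF i] H_cmp[OF i f(2)] H_cmp[OF f(2) i] i
    show "ginv H f \<in> mor H" "src H (ginv H f) = rng H f" "rng H (ginv H f) = src H f"
      "cmp H f (ginv H f) = rng H f" "cmp H (ginv H f) f = src H f"
      unfolding f(1) s using i by (simp_all only: arrow_class_mor_H add.left_inverse add.right_inverse)
  qed
qed

definition unit_class :: "'a path \<Rightarrow> ('a path \<times> (nat \<Rightarrow> int) \<times> 'a path) set" where
  "unit_class x = arrow_class x 0 x"

lemma units_H: "units H = unit_class ` X"
proof (intro equalityI subsetI)
  fix u assume "u \<in> units H"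
  then have u: "u \<in> mor H" "src H u = u" by (auto simp: units_def)
  then obtain x p y where f: "u = arrow_class x p y" "(x, p, y) \<in> mor G" "x \<in> X" "y \<in> X" by (metis mor_H_E)
  have "u = unit_class y" using u(2) H_ops(1)[OF f(2)] f(1) by (simp add: unit_class_def)
  then show "u \<in> unit_class ` X" using f by blast
next
  fix u assume "u \<in> unit_class ` X"
  then obtain x where "x \<in> X" "u = arrow_class x 0 x" by (auto simp: unit_class_def)
  then show "u \<in> units H" using H_ops[OF unit_in_mor] unit_in_mor by (auto simp: units_def)
qed

lemma inj_unit_class: "inj_on unit_class X"
  by (auto simp: inj_on_def unit_class_def arrow_class_eq_iff)

section \<open>Quotient topology and etale structure\<close>

lemma openin_HT: "openin HT U \<longleftrightarrow> U \<subseteq> mor H \<and> openin GT {g \<in> mor G. q g \<in> U}"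
  unfolding H_topology_def openin_quotient_topology by (simp add: H_groupoid_def quotient_groupoid_def)

lemma topspace_HT [simp]: "topspace HT = mor H"
  unfolding H_topology_def topspace_quotient_topology by (simp add: H_groupoid_def quotient_groupoid_def)

lemma quotient_map_q: "quotient_map GT HT q"
  unfolding H_topology_def by (rule quotient_map_quotient_topology)

lemma continuous_q: "continuous_map GT HT q"
  using quotient_map_q by (rule quotient_imp_continuous_map)

lemma q_mor: "g \<in> mor G \<Longrightarrow> q g \<in> mor H"
  by (simp add: H_groupoid_def quotient_groupoid_def)

text \<open>The saturation of an open set \<open>V\<close> is the product \<open>V I\<close> of open sets.\<close>

lemma open_map_q: "open_map GT HT q"
  unfolding open_map_def
proof (intro allI impI)
  fix V assume V: "openin GT V"
  then have VG: "V \<subseteq> mor G" using openin_GT by blast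
  have "openin GT {g \<in> mor G. q g \<in> q ` V}"
  proof (rule openin_GT[THEN iffD2], intro conjI allI impI)
    fix x p y assume "(x, p, y) \<in> {g \<in> mor G. q g \<in> q ` V}"
    then obtain g where g: "(x, p, y) \<in> mor G" "g \<in> V" "q (x, p, y) = q g" by blast
    obtain a r b where gabr: "g = (a, r, b)" by (cases g)
    note X = mor_GD[OF g(1)]
    have "(a, r, b) \<in> mor G" using g(2) VG gabr by blast
    then have "arrow_class x p y = arrow_class a r b" using g(3) gabr q_eq[OF X(2)] q_eq[OF mor_GD(2)] by simp
    then have eq: "a = x" "b = y" "p - r \<in> Per k \<Lambda>" using arrow_class_eq_iff[OF X(1)] by auto
    define c where "c = p - r"
    have c: "p = r + c" "c \<in> Per k \<Lambda>" using eq by (auto simp: c_def)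
    have rV: "(x, r, y) \<in> V" using g gabr eq by simp
    obtain l m where lm: "matched l m x y" "r = intvec l - intvec m" "nbd l m x y \<subseteq> V"
      using V rV openin_GT by blast
    have "(y, c, y) \<in> I" using mem_I c X by blast
    then obtain l' m' where lm': "matched l' m' y y" "c = intvec l' - intvec m'" "nbd l' m' y y \<subseteq> I"
      using openin_I openin_GT by blast
    note mt = matched_trans[OF lm(1) lm'(1)]
    have N: "l \<in> N" "m \<in> N" "l' \<in> N" "m' \<in> N" using lm lm' by (auto simp: matched_def)
    have "nbd (l + l') (m' + m) x y \<subseteq> {g \<in> mor G. q g \<in> q ` V}"
    proof
      fix h assume h: "h \<in> nbd (l + l') (m' + m) x y"
      obtain x' s y' where h': "h = (x', s, y')" by (cases h)
      have hG: "h \<in> mor G" using nbd_subset_mor[OF mt(3)] h by blast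
      have x'cylinder: "x' \<in> cylinder (l + l') x" using nbd_px h h' by blast
      \<comment> \<open>The first cylinder contains an arrow from \<open>V\<close> with range
        \<open>x'\<close>. Once its source \<open>y''\<close> is known to be \<open>y'\<close>, the
        arrow \<open>h\<close> differs from it by a period only.\<close>
      obtain y'' where y'': "(x', intvec (l + l') - intvec (l' + m), y'') \<in> nbd (l + l') (l' + m) x y"
        using nbd_section[OF mt(1) x'cylinder] by blast
      have "nbd (l + l') (l' + m) x y \<subseteq> nbd l m x y" 
        using nbd_add_subset[OF lm(1) N(3)] by (simp add: add.commute)
      then have V1: "(x', r, y'') \<in> V" using y'' lm(2,3) by auto
      have "nbd (l' + m) (m' + m) y y \<subseteq> nbd l' m' y y" using nbd_add_subset[OF lm'(1) N(2)] .
      \<comment> \<open>Both tails equal \<open>T (l + l') x'\<close>. Lying in \<open>I\<close>,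
        the remaining factor then has equal ends.\<close>
      moreover have "(y'', intvec (l' + m) - intvec (m' + m), y') \<in> nbd (l' + m) (m' + m) y y"
        using y'' h unfolding h' nbd_def by auto
      ultimately have "y'' = y'" using lm'(3) mem_I by blast
      then have "(x', r, y') \<in> V" using V1 by simp
      moreover have "s = r + c" using h lm(2) lm'(2) unfolding h' nbd_def by simp
      then have "q h = q (x', r, y')" using c(2) hG mor_GD unfolding h' by (simp add: q_eq arrow_class_eq_iff)
      ultimately show "h \<in> {g \<in> mor G. q g \<in> q ` V}" using hG by blast
    qed
    moreover have "p = intvec (l + l') - intvec (m' + m)" using c lm lm' by simp
    ultimately show "\<exists>l m. matched l m x y \<and> p = intvec l - intvec m \<and> nbd l m x y \<subseteq> {g \<in> mor G. q g \<in> q ` V}"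
      using mt(3) by blast
  qed blast
  moreover have "q ` V \<subseteq> mor H" using VG q_mor by blast
  ultimately show "openin HT (q ` V)" unfolding openin_HT by blast
qed

lemma rng_H_q: "g \<in> mor G \<Longrightarrow> rng H (q g) = unit_class (px g)"
  using mor_GD H_ops by (cases g) (simp add: q_eq unit_class_def)

lemma src_H_q: "g \<in> mor G \<Longrightarrow> src H (q g) = unit_class (py g)"
  using mor_GD H_ops by (cases g) (simp add: q_eq unit_class_def)

lemma unit_class_q: "x \<in> X \<Longrightarrow> unit_class x = q (x, 0, x)"
  by (simp add: q_eq unit_class_def)

lemma continuous_unit_class: "continuous_map XT HT unit_class"
proof (rule continuous_map_eq)
  show "continuous_map XT HT (q \<circ> (\<lambda>x. (x, 0, x)))"
    by (rule continuous_map_compose[OF continuous_unit continuous_q])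
qed (simp add: unit_class_q)

lemma open_map_unit_class: "open_map XT HT unit_class"
  unfolding open_map_def
proof (intro allI impI)
  fix U assume U: "openin XT U"
  then have "U \<subseteq> X" using openin_XT by blast
  then have "unit_class ` U = q ` (\<lambda>x. (x, 0, x)) ` U" using unit_class_q by (auto simp: image_image)
  then show "openin HT (unit_class ` U)" using openin_units[OF U] open_map_q unfolding open_map_def by simp
qed

abbreviation UT where "UT \<equiv> subtopology HT (units H)"

lemma units_subset: "units H \<subseteq> mor H" by (auto simp: units_def)

lemma topspace_UT: "topspace UT = units H"
  using units_subset by (simp add: Int_absorb1)

lemma openin_units_H: "openin HT (units H)"
  using open_map_unit_class openin_topspace[of XT] unfolding open_map_def units_H by simp

lemma openin_UT: "openin UT V \<longleftrightarrow> openin HT V \<and> V \<subseteq> units H"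
  using openin_open_subtopology[OF openin_units_H] .

lemma homeomorphic_unit_class: "homeomorphic_map XT UT unit_class"
proof (rule bijective_open_imp_homeomorphic_map)
  show "continuous_map XT UT unit_class"
    using continuous_unit_class by (simp add: continuous_map_in_subtopology units_H)
  show "open_map XT UT unit_class"
    unfolding open_map_def
  proof (intro allI impI)
    fix U assume "openin XT U"
    then have "openin HT (unit_class ` U)" "U \<subseteq> X" using open_map_unit_class openin_XT unfolding open_map_def by blast+
    then show "openin UT (unit_class ` U)" unfolding openin_UT unfolding units_H by blast
  qed
  show "unit_class ` topspace XT = topspace UT" unfolding topspace_UT by (simp add: units_H)
  show "inj_on unit_class (topspace XT)" using inj_unit_class by simp
qed

lemma continuous_HT_I:
  assumes "continuous_map GT Y f" "\<And>g. g \<in> mor G \<Longrightarrow> F (q g) = f g"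
  shows "continuous_map HT Y F"
proof -
  have "continuous_map GT Y (F \<circ> q)" by (rule continuous_map_eq[OF assms(1)]) (simp add: assms(2))
  then show ?thesis using continuous_compose_quotient_map_eq[OF quotient_map_q] by blast
qed

text \<open>Surjectivity of \<open>q\<close> lets the image of an open set be computed on its
  preimage in \<open>G\<close>.\<close>

lemma open_map_HT_I:
  assumes "open_map GT Y f" "\<And>g. g \<in> mor G \<Longrightarrow> F (q g) = f g"
  shows "open_map HT Y F"
  unfolding open_map_def
proof (intro allI impI)
  fix U assume "openin HT U"
  then have U: "U \<subseteq> mor H" "openin GT {g \<in> mor G. q g \<in> U}" using openin_HT by blast+
  have "U = q ` {g \<in> mor G. q g \<in> U}"
  proof (intro equalityI subsetI)
    fix A assume A: "A \<in> U"
    then have "A \<in> q ` mor G" using U(1) by (auto simp: H_groupoid_def quotient_groupoid_def)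
    then show "A \<in> q ` {g \<in> mor G. q g \<in> U}" using A by (elim imageE) simp
  next
    fix A assume "A \<in> q ` {g \<in> mor G. q g \<in> U}"
    then show "A \<in> U" by (elim imageE) simp
  qed
  then have "F ` U = F ` q ` {g \<in> mor G. q g \<in> U}" by simp
  also have "\<dots> = f ` {g \<in> mor G. q g \<in> U}" unfolding image_image using assms(2) by (intro image_cong) auto
  finally have "F ` U = f ` {g \<in> mor G. q g \<in> U}" .
  then show "openin Y (F ` U)" using U(2) assms(1) unfolding open_map_def by simp
qed

lemma range_source_maps:
  "continuous_map HT UT (rng H)" "open_map HT UT (rng H)" 
  "continuous_map HT UT (src H)" "open_map HT UT (src H)"
proof -
  have u: "continuous_map XT UT unit_class" "open_map XT UT unit_class"
    using homeomorphic_unit_class homeomorphic_imp_continuous_map homeomorphic_imp_open_map by blast+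
  show "continuous_map HT UT (rng H)"
    by (rule continuous_HT_I[OF continuous_map_compose[OF continuous_px u(1)]]) (simp add: rng_H_q)
  show "open_map HT UT (rng H)"
    by (rule open_map_HT_I[OF open_map_compose[OF open_map_px u(2)]]) (simp add: rng_H_q)
  show "continuous_map HT UT (src H)"
    by (rule continuous_HT_I[OF continuous_map_compose[OF continuous_py u(1)]]) (simp add: src_H_q)
  show "open_map HT UT (src H)"
    by (rule open_map_HT_I[OF open_map_compose[OF open_map_py u(2)]]) (simp add: src_H_q)
qed

lemma HT_nbhd:
  assumes "A \<in> mor H"
  obtains l m x y where "matched l m x y" "A \<in> q ` nbd l m x y" "openin HT (q ` nbd l m x y)"
proof -
  obtain x p y where A: "A = arrow_class x p y" "(x, p, y) \<in> mor G" "y \<in> X" using assms by (rule mor_H_E)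
  then obtain l m where lm: "matched l m x y" "p = intvec l - intvec m" using mor_G_iff by blast
  have "A = q (x, p, y)" using A q_eq by simp
  then have "A \<in> q ` nbd l m x y" using nbd_self[OF lm(1)] lm(2) by blast
  then show ?thesis using that lm(1) openin_nbd[OF lm(1)] open_map_q unfolding open_map_def by blast
qed

text \<open>\<open>q\<close> keeps both ends of an arrow, so an open bisection of \<open>G\<close>
  remains one in \<open>H\<close>.\<close>

lemma inj_on_rng_nbd:
  assumes "matched l m x y"
  shows "inj_on (rng H) (q ` nbd l m x y)" "inj_on (src H) (q ` nbd l m x y)"
proof -
  note G = nbd_subset_mor[OF assms]
  have "g = h" if gh: "g \<in> nbd l m x y" "h \<in> nbd l m x y" "rng H (q g) = rng H (q h)" for g h
  proof -
    have m: "g \<in> mor G" "h \<in> mor G" using gh G by blast+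
    have "px g \<in> X" "px h \<in> X" using m mor_GD(1) by (cases g, simp, cases h, simp)
    then have "px g = px h" using gh(3) rng_H_q m inj_onD[OF inj_unit_class] by simp
    then show ?thesis using inj_onD[OF inj_on_px_nbd[OF assms]] gh by blast
  qed
  then show "inj_on (rng H) (q ` nbd l m x y)" unfolding inj_on_def by blast
  have "g = h" if gh: "g \<in> nbd l m x y" "h \<in> nbd l m x y" "src H (q g) = src H (q h)" for g h
  proof -
    have m: "g \<in> mor G" "h \<in> mor G" using gh G by blast+
    have "py g \<in> X" "py h \<in> X" using m mor_GD(2) by (cases g, simp, cases h, simp)
    then have "py g = py h" using gh(3) src_H_q m inj_onD[OF inj_unit_class] by simp
    then show ?thesis using inj_onD[OF inj_on_py_nbd[OF assms]] gh by blast
  qed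
  then show "inj_on (src H) (q ` nbd l m x y)" unfolding inj_on_def by blast
qed

lemma topological_groupoid_H: "topological_groupoid H HT"
  unfolding topological_groupoid_def
proof (intro conjI groupoid_H)
  show "continuous_map (subtopology (prod_topology HT HT) {(g, h). src H g = rng H h}) HT (\<lambda>(g, h). cmp H g h)"
  proof (rule continuous_map_subtopology_prodI)
    fix A B assume AB: "A \<in> topspace HT" "B \<in> topspace HT" "(A, B) \<in> {(g, h). src H g = rng H h}"
    then show "(case (A, B) of (g, h) \<Rightarrow> cmp H g h) \<in> topspace HT"
      using groupoid_H unfolding groupoid_def category_def by simp
    fix W assume W: "openin HT W" "(case (A, B) of (g, h) \<Rightarrow> cmp H g h) \<in> W"
    have "A \<in> mor H" "B \<in> mor H" using AB by auto
    obtain x p y where A: "A = arrow_class x p y" "(x, p, y) \<in> mor G" "x \<in> X" "y \<in> X" using \<open>A \<in> mor H\<close> by (rule mor_H_E)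
    obtain y' r z where B: "B = arrow_class y' r z" "(y', r, z) \<in> mor G" "y' \<in> X" "z \<in> X" using \<open>B \<in> mor H\<close> by (rule mor_H_E)
    have "y' = y" using AB(3) unfolding A(1) B(1) by (simp add: H_ops[OF A(2)] H_ops[OF B(2)] arrow_class_eq_iff[OF A(4)])
    note B = B[unfolded this]
    let ?W = "{g \<in> mor G. q g \<in> W}"
    have oW: "openin GT ?W" using W(1) openin_HT by blast
    have "arrow_class x (p + r) z \<in> W" using W(2) A(1) B(1) H_cmp[OF A(2) B(2)] by simp
    then have xW: "(x, p + r, z) \<in> ?W" using mor_G_cmp[OF A(2) B(2)] q_eq[OF B(4)] by simp
    obtain U V where UV: "openin GT U" "openin GT V" "(x, p, y) \<in> U" "(y, r, z) \<in> V"
      "\<And>x' p' y' r' z'. (x', p', y') \<in> U \<Longrightarrow> (y', r', z') \<in> V \<Longrightarrow> (x', p' + r', z') \<in> ?W"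
      using cmp_nbhd_G[OF A(2) B(2) oW xW] by blast
    have UVG: "U \<subseteq> mor G" "V \<subseteq> mor G" using UV(1,2) openin_GT by blast+
    \<comment> \<open>Composable classes have composable representatives in \<open>U\<close> and
      \<open>V\<close>, because the shared unit class determines the shared path.\<close>
    have "cmp H A' B' \<in> W" if A': "A' \<in> q ` U" and B': "B' \<in> q ` V" and e: "src H A' = rng H B'" for A' B'
    proof -
      obtain a s b where g: "A' = q (a, s, b)" "(a, s, b) \<in> U" using A' by auto
      obtain b' t c where h: "B' = q (b', t, c)" "(b', t, c) \<in> V" using B' by auto
      have gG: "(a, s, b) \<in> mor G" and hG: "(b', t, c) \<in> mor G" using g(2) h(2) UVG by blast+
      note X = mor_GD[OF gG] mor_GD[OF hG]
      have "unit_class b = unit_class b'" using e rng_H_q[OF hG] src_H_q[OF gG] g(1) h(1) by simp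
      then have bb: "b' = b" using inj_onD[OF inj_unit_class] X by metis
      then have "(a, s + t, c) \<in> ?W" using UV(5) g h by blast
      then have "arrow_class a (s + t) c \<in> W" using q_eq[OF X(4)] by simp
      moreover have "cmp H A' B' = arrow_class a (s + t) c"
        using H_cmp[OF gG hG[unfolded bb]] g(1) h(1) bb q_eq X by simp
      ultimately show ?thesis by simp
    qed
    moreover have "openin HT (q ` U)" "openin HT (q ` V)" using UV(1,2) open_map_q unfolding open_map_def by blast+
    moreover have "A \<in> q ` U" "B \<in> q ` V" 
      using UV(3,4) A(1) B(1) q_eq[OF A(4)] q_eq[OF B(4)] by (metis imageI)+
    ultimately show "\<exists>U V. openin HT U \<and> openin HT V \<and> A \<in> U \<and> B \<in> V \<and>
      (\<forall>x'\<in>U. \<forall>y'\<in>V. (x', y') \<in> {(g, h). src H g = rng H h} \<longrightarrow> (case (x', y') of (g, h) \<Rightarrow> cmp H g h) \<in> W)"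
      by (intro exI[of _ "q ` U"] exI[of _ "q ` V"]) simp
  qed
  show "continuous_map HT HT (ginv H)"
  proof (rule continuous_HT_I[OF continuous_map_compose[OF continuous_ginv_G continuous_q]])
    fix g assume g: "g \<in> mor G"
    obtain x p y where [simp]: "g = (x, p, y)" by (cases g)
    show "ginv H (q g) = (q \<circ> ginv G) g" using g mor_GD[of x p y] H_ops(3)[of x p y] by (simp add: q_eq)
  qed
qed simp

lemma etale_H: "etale_groupoid H HT"
  unfolding etale_groupoid_def
proof (intro conjI topological_groupoid_H)
  have "\<exists>U. openin HT U \<and> A \<in> U \<and> inj_on (rng H) U" "\<exists>U. openin HT U \<and> A \<in> U \<and> inj_on (src H) U"
    if "A \<in> topspace HT" for A
  proof -
    have "A \<in> mor H" using that by simp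
    then obtain l m x y where *: "matched l m x y" "A \<in> q ` nbd l m x y" "openin HT (q ` nbd l m x y)"
      by (rule HT_nbhd)
    show "\<exists>U. openin HT U \<and> A \<in> U \<and> inj_on (rng H) U" "\<exists>U. openin HT U \<and> A \<in> U \<and> inj_on (src H) U"
      by (intro exI conjI, fact *(3), fact *(2), fact inj_on_rng_nbd[OF *(1)])+
  qed
  then show "local_homeomorphism HT UT (rng H)" "local_homeomorphism HT UT (src H)"
    using range_source_maps by (auto intro!: local_homeomorphismI)
qed

text \<open>As \<open>q\<close> is open, it suffices to find open sets of \<open>G\<close> no arrow
  of which is congruent modulo periods to one of the other. Different ends are separated in the path
  space, equal ends by the degree.\<close>

lemma Hausdorff_HT: "Hausdorff_space HT"
  unfolding Hausdorff_space_def topspace_HT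
proof (intro allI impI)
  fix A B assume AB: "A \<in> mor H \<and> B \<in> mor H \<and> A \<noteq> B"
  obtain x p y where A: "A = arrow_class x p y" "(x, p, y) \<in> mor G" "x \<in> X" "y \<in> X" using AB mor_H_E by blast
  obtain x' p' y' where B: "B = arrow_class x' p' y'" "(x', p', y') \<in> mor G" "x' \<in> X" "y' \<in> X" using AB mor_H_E by blast
  have sep: "\<exists>U V. openin HT U \<and> openin HT V \<and> A \<in> U \<and> B \<in> V \<and> disjnt U V"
    if "openin GT U" "openin GT V" "(x, p, y) \<in> U" "(x', p', y') \<in> V" 
      "\<And>a r b s. (a, r, b) \<in> U \<Longrightarrow> (a, s, b) \<in> V \<Longrightarrow> r - s \<notin> Per k \<Lambda>" for U V
  proof (intro exI conjI)
    show "openin HT (q ` U)" "openin HT (q ` V)" using that(1,2) open_map_q unfolding open_map_def by blast+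
    show "A \<in> q ` U" "B \<in> q ` V" using that(3,4) A B q_eq by (metis imageI)+
    have UV: "U \<subseteq> mor G" "V \<subseteq> mor G" using that(1,2) openin_GT by blast+
    have "q g \<noteq> q h" if "g \<in> U" "h \<in> V" for g h
    proof
      obtain a r b where g: "g = (a, r, b)" by (cases g)
      obtain a' s b' where h: "h = (a', s, b')" by (cases h)
      have X: "a \<in> X" "b \<in> X" "b' \<in> X" using that UV g h mor_GD by blast+
      assume "q g = q h"
      then have "a = a'" "b = b'" "r - s \<in> Per k \<Lambda>" using g h X by (simp_all add: q_eq arrow_class_eq_iff)
      then show False using \<open>\<And>a r b s. (a, r, b) \<in> U \<Longrightarrow> (a, s, b) \<in> V \<Longrightarrow> r - s \<notin> Per k \<Lambda>\<close> that g h by blast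
    qed
    then show "disjnt (q ` U) (q ` V)" unfolding disjnt_def by blast
  qed
  have XT_sep: "\<exists>U V. openin XT U \<and> openin XT V \<and> a \<in> U \<and> b \<in> V \<and> disjnt U V" if "a \<in> X" "b \<in> X" "a \<noteq> b" for a b
    using Hausdorff_XT that unfolding Hausdorff_space_def by simp
  consider "x \<noteq> x'" | "y \<noteq> y'" | "x = x'" "y = y'" by blast
  then show "\<exists>U V. openin HT U \<and> openin HT V \<and> A \<in> U \<and> B \<in> V \<and> disjnt U V"
  proof cases
    case 1
    then obtain U V where UV: "openin XT U" "openin XT V" "x \<in> U" "x' \<in> V" "disjnt U V" using XT_sep A B by blast
    show ?thesis
    proof (rule sep[of "{g \<in> topspace GT. px g \<in> U}" "{g \<in> topspace GT. px g \<in> V}"])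
      show "openin GT {g \<in> topspace GT. px g \<in> U}" "openin GT {g \<in> topspace GT. px g \<in> V}"
        using openin_continuous_map_preimage[OF continuous_px] UV by blast+
    qed (use UV A B in \<open>auto simp: disjnt_iff\<close>)
  next
    case 2
    then obtain U V where UV: "openin XT U" "openin XT V" "y \<in> U" "y' \<in> V" "disjnt U V" using XT_sep A B by blast
    show ?thesis
    proof (rule sep[of "{g \<in> topspace GT. py g \<in> U}" "{g \<in> topspace GT. py g \<in> V}"])
      show "openin GT {g \<in> topspace GT. py g \<in> U}" "openin GT {g \<in> topspace GT. py g \<in> V}"
        using openin_continuous_map_preimage[OF continuous_py] UV by blast+
    qed (use UV A B in \<open>auto simp: disjnt_iff\<close>)
  next
    case 3
    then have n: "p - p' \<notin> Per k \<Lambda>" using AB A B arrow_class_eq_iff by blast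
    show ?thesis
    proof (rule sep[OF openin_degree[of "{p}"] openin_degree[of "{p'}"]])
    qed (use n A B in auto)
  qed
qed

end

context rf_cofinal_graph
begin

text \<open>The range map carries the bisection homeomorphically onto a compact cylinder of
  paths.\<close>

lemma compactin_nbd:
  assumes "matched l m x y" shows "compactin GT (nbd l m x y)"
proof -
  let ?N = "nbd l m x y"
  have xl: "x \<in> X" "l \<in> N" using assms by (auto simp: matched_def)
  have sub: "?N \<subseteq> mor G" by (rule nbd_subset_mor[OF assms])
  have tN: "topspace (subtopology GT ?N) = ?N" using sub by auto
  have ZX: "cylinder l x \<subseteq> X" by (auto simp: cylinder_def)
  have "homeomorphic_map (subtopology GT ?N) (subtopology XT (cylinder l x)) px"
  proof (rule bijective_open_imp_homeomorphic_map)
    show "continuous_map (subtopology GT ?N) (subtopology XT (cylinder l x)) px"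
      unfolding continuous_map_in_subtopology tN
      using continuous_map_from_subtopology[OF continuous_px] px_nbd[OF assms] by blast
    show "open_map (subtopology GT ?N) (subtopology XT (cylinder l x)) px"
      using open_map_px px_nbd[OF assms]
      unfolding open_map_def openin_open_subtopology[OF openin_nbd[OF assms]] openin_open_subtopology[OF openin_cylinder[OF xl(2)]]
      by blast
    show "px ` topspace (subtopology GT ?N) = topspace (subtopology XT (cylinder l x))"
      unfolding tN px_nbd[OF assms] using ZX by auto
    show "inj_on px (topspace (subtopology GT ?N))" unfolding tN by (rule inj_on_px_nbd[OF assms])
  qed
  then have "compactin (subtopology XT (cylinder l x)) (px ` ?N) \<longleftrightarrow> compactin (subtopology GT ?N) ?N"
    using homeomorphic_map_compactness[of _ _ px ?N] tN by blast
  moreover have "compactin (subtopology XT (cylinder l x)) (px ` ?N)"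
    using compactin_cylinder[OF xl] unfolding px_nbd[OF assms] by (simp add: compactin_subtopology)
  ultimately show ?thesis by (simp add: compactin_subtopology)
qed

lemma locally_compact_HT: "locally_compact_space HT"
  unfolding locally_compact_space_def topspace_HT
proof
  fix A assume "A \<in> mor H"
  then obtain l m x y where *: "matched l m x y" "A \<in> q ` nbd l m x y" "openin HT (q ` nbd l m x y)"
    by (rule HT_nbhd)
  then show "\<exists>U K. openin HT U \<and> compactin HT K \<and> A \<in> U \<and> U \<subseteq> K"
    using image_compactin[OF compactin_nbd[OF *(1)] continuous_q] by blast
qed

section \<open>Topological principality by Baire category\<close>

lemma countable_natk: "countable N"
proof (rule countable_subset)
  let ?F = "\<lambda>f i. if i < k then f i else (0::nat)"
  show "countable (?F ` (Pi\<^sub>E {..<k} (\<lambda>_. UNIV)))" by (intro countable_image countable_PiE) auto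
  show "N \<subseteq> ?F ` (Pi\<^sub>E {..<k} (\<lambda>_. UNIV))"
  proof
    fix n assume "n \<in> N"
    then have "n = ?F (restrict n {..<k})" by (auto simp: natk_def fun_eq_iff)
    moreover have "restrict n {..<k} \<in> Pi\<^sub>E {..<k} (\<lambda>_. UNIV)" by simp
    ultimately show "n \<in> ?F ` (Pi\<^sub>E {..<k} (\<lambda>_. UNIV))" by blast
  qed
qed

text \<open>At these paths every isotropy arrow of \<open>G\<close> has its degree in Per, so the
  isotropy of their unit class in \<open>H\<close> is trivial.\<close>

definition aperiodic :: "'a path set" where
  "aperiodic = {x \<in> X. \<forall>l\<in>N. \<forall>m\<in>N. T l x = T m x \<longrightarrow> intvec l - intvec m \<in> Per k \<Lambda>}"

lemma closedin_equalizer: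
  assumes "l \<in> N" "m \<in> N"
  shows "closedin XT {x \<in> X. T l x = T m x}"
proof -
  have "openin XT (X - {x \<in> X. T l x = T m x})"
  proof (rule openin_XT_I)
    fix x assume "x \<in> X - {x \<in> X. T l x = T m x}"
    then have x: "x \<in> X" "T l x \<noteq> T m x" by auto
    then obtain n where n: "n \<in> N" "T l x (0, n) \<noteq> T m x (0, n)" 
      using path_eqI[of "T l x" "T m x"] assms by auto
    \<comment> \<open>Degree \<open>l + m + n\<close> is large enough to fix the segments of
      \<open>y\<close> over both \<open>(l, l + n)\<close> and \<open>(m, m + n)\<close>.\<close>
    have "T l y \<noteq> T m y" if "y \<in> cylinder (l + m + n) x" for y
    proof
      have y: "y \<in> X" "y (0, l + m + n) = x (0, l + m + n)" using that by (auto simp: cylinder_def)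
      have "y (0, l + n) = x (0, l + n)" "y (0, m + n) = x (0, m + n)"
        using path_initial_le[of y x "l + n" "l + m + n"] path_initial_le[of y x "m + n" "l + m + n"]
          y x(1) assms n(1) by (simp_all add: le_fun_def)
      then have "y (l, l + n) = x (l, l + n)" "y (m, m + n) = x (m, m + n)"
        using path_initial(2)[OF y(1) x(1)] assms n(1) by blast+
      moreover assume "T l y = T m y"
      then have "T l y (0, n) = T m y (0, n)" by simp
      ultimately show False using n assms by simp
    qed
    moreover have "cylinder (l + m + n) x \<subseteq> X" by (auto simp: cylinder_def)
    ultimately have "cylinder (l + m + n) x \<subseteq> X - {x \<in> X. T l x = T m x}" by blast
    then show "\<exists>n\<in>N. cylinder n x \<subseteq> X - {x \<in> X. T l x = T m x}" using assms n(1) by (intro bexI[of _ "l + m + n"]) auto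
  qed blast
  then show ?thesis unfolding closedin_def by auto
qed

text \<open>If the equation holds on the cylinder of \<open>x (0, n)\<close>, then shifting by
  \<open>n\<close> gives it for every path starting at \<open>x (n, n)\<close>. That is a local
  period, so \<open>l - m\<close> would belong to Per.\<close>

lemma interior_equalizer:
  assumes "l \<in> N" "m \<in> N" "intvec l - intvec m \<notin> Per k \<Lambda>"
  shows "XT interior_of {x \<in> X. T l x = T m x} = {}"
proof (rule ccontr)
  assume "\<not> ?thesis"
  then obtain U x where U: "openin XT U" "x \<in> U" "U \<subseteq> {x \<in> X. T l x = T m x}" 
    unfolding interior_of_def by blast
  then obtain n where n: "n \<in> N" "cylinder n x \<subseteq> U" "x \<in> X" using openin_XT by blast
  have "per_at (x (n, n)) l m"
    unfolding per_at_def
  proof (intro conjI ballI impI assms(1,2))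
    fix w assume w: "w \<in> X" "w (0, 0) = x (n, n)"
    obtain y where y: "y \<in> X" "y (0, n) = x (0, n)" "T n y = w" using splice[OF n(3,1) w] by blast
    then have "T l y = T m y" using U(3) n(2) unfolding cylinder_def by blast
    then have "T n (T l y) = T n (T m y)" by simp
    then have "T l (T n y) = T m (T n y)" using y(1) assms n by (simp add: add.commute)
    then show "T l w = T m w" by (simp only: y(3))
  qed
  then show False using per_at_Per_vertex[OF _ n(3,1)] assms(3) by blast
qed

text \<open>There are only countably many pairs \<open>(l, m)\<close>, so aperiodic paths are what
  remains after removing countably many closed sets without interior from a locally compact
  Hausdorff space.\<close>

lemma dense_aperiodic: "XT closure_of aperiodic = X"
proof -
  let ?B = "{(l, m). l \<in> N \<and> m \<in> N \<and> intvec l - intvec m \<notin> Per k \<Lambda>}"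
  let ?G = "(\<lambda>(l, m). {x \<in> X. T l x = T m x}) ` ?B"
  have "countable ?B" by (rule countable_subset[of _ "N \<times> N"]) (auto simp: countable_natk)
  then have "XT interior_of \<Union>?G = {}"
  proof (intro Baire_category_alt)
    show "completely_metrizable_space XT \<or> locally_compact_space XT \<and> regular_space XT"
      using locally_compact_XT Hausdorff_XT locally_compact_Hausdorff_imp_regular_space by blast
  qed (use closedin_equalizer interior_equalizer in auto)
  then have "topspace XT \<subseteq> XT closure_of (topspace XT - \<Union>?G)"
    by (simp only: interior_of_closure_of Diff_eq_empty_iff)
  then have "XT closure_of (topspace XT - \<Union>?G) = X" 
    using closure_of_subset_topspace[of XT "topspace XT - \<Union>?G"] by (simp only: topspace_XT subset_antisym)
  moreover have "topspace XT - \<Union>?G = aperiodic" unfolding aperiodic_def by auto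
  ultimately show ?thesis by simp
qed

lemma topologically_principal_H: "topologically_principal H HT"
  unfolding topologically_principal_def
proof
  let ?S = "{u \<in> units H. {g \<in> mor H. rng H g = u \<and> src H g = u} = {u}}"
  show "UT closure_of ?S \<subseteq> units H" using closure_of_subset_topspace[of UT ?S] topspace_UT by blast
  have "unit_class ` aperiodic \<subseteq> ?S"
  proof
    fix u assume "u \<in> unit_class ` aperiodic"
    then obtain x where x: "x \<in> aperiodic" "u = unit_class x" by blast
    have xX: "x \<in> X" using x(1) by (simp add: aperiodic_def)
    have "g = u" if g: "g \<in> mor H" "rng H g = u" "src H g = u" for g
    proof -
      obtain a p b where ab: "g = arrow_class a p b" "(a, p, b) \<in> mor G" "a \<in> X" "b \<in> X" using g(1) by (rule mor_H_E)
      have "a = x" "b = x" 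
        using g(2,3) H_ops(1,2)[OF ab(2)] ab x(2) by (simp_all add: unit_class_def arrow_class_eq_iff)
      \<comment> \<open>An isotropy class at the unit of \<open>x\<close> lifts to an arrow with
        both ends \<open>x\<close>; aperiodicity puts its degree in Per, so the class is the
        unit.\<close>
      then obtain l m where "matched l m x x" "p = intvec l - intvec m" using ab(2) mor_G_iff by blast
      then have "p \<in> Per k \<Lambda>" using x(1) unfolding aperiodic_def matched_def by blast
      then show ?thesis using ab x(2) \<open>a = x\<close> \<open>b = x\<close> xX by (simp add: unit_class_def arrow_class_eq_iff)
    qed
    moreover have "u \<in> mor H" "rng H u = u" "src H u = u" "u \<in> units H"
      using H_ops[OF unit_in_mor[OF xX]] unit_in_mor[OF xX] x(2) xX unfolding units_H by (auto simp: unit_class_def)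
    ultimately show "u \<in> ?S" by blast
  qed
  then have "UT closure_of (unit_class ` aperiodic) \<subseteq> UT closure_of ?S" by (rule closure_of_mono)
  moreover have "UT closure_of (unit_class ` aperiodic) = unit_class ` (XT closure_of aperiodic)"
    by (rule homeomorphic_map_closure_of[OF homeomorphic_unit_class]) (auto simp: aperiodic_def)
  ultimately show "units H \<subseteq> UT closure_of ?S" unfolding dense_aperiodic units_H by simp
qed

end

section \<open>Amenability\<close>

lemma has_sum_sum_family:
  fixes f :: "'i \<Rightarrow> 'b \<Rightarrow> 'c::topological_comm_monoid_add"
  assumes "\<And>i. i \<in> J \<Longrightarrow> (f i has_sum s i) A"
  shows "((\<lambda>x. \<Sum>i\<in>J. f i x) has_sum (\<Sum>i\<in>J. s i)) A"
  using assms by (induction J rule: infinite_finite_induct) (auto intro: has_sum_add has_sum_0)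

lemma has_sum_delta:
  assumes "b \<in> A" shows "((\<lambda>a. f a * of_bool (a = b)) has_sum (f b :: real)) A"
  by (rule has_sum_finite_neutralI[of "{b}"]) (use assms in auto)

text \<open>The comparison also supplies summability of \<open>D\<close>, without which
  \<open>infsum\<close> would be the default 0.\<close>

lemma infsum_le_has_sum:
  fixes D :: "'b \<Rightarrow> real"
  assumes "(E has_sum e) A" "\<And>a. a \<in> A \<Longrightarrow> 0 \<le> D a" "\<And>a. a \<in> A \<Longrightarrow> D a \<le> E a"
  shows "infsum D A \<le> e"
proof -
  have E: "E summable_on A" using assms(1) by (rule has_sum_imp_summable)
  then have "D summable_on A" by (rule summable_on_comparison_test) (use assms in auto)
  then have "infsum D A \<le> infsum E A" using E assms(3) by (rule infsum_mono)
  then show ?thesis using infsumI[OF assms(1)] by simp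
qed

definition natbox :: "nat \<Rightarrow> nat \<Rightarrow> (nat \<Rightarrow> nat) set" where
  "natbox k n = {a \<in> natk k. \<forall>i<k. a i < n}"

lemma bij_natbox: "bij_betw (\<lambda>f. restrict f {..<k}) (natbox k n) (Pi\<^sub>E {..<k} (\<lambda>_. {..<n}))"
proof (rule bij_betwI[of _ _ _ "\<lambda>f i. if i < k then f i else 0"])
  show "(\<lambda>f i. if i < k then f i else 0) (restrict a {..<k}) = a" if "a \<in> natbox k n" for a
    using that by (auto simp: natbox_def natk_def fun_eq_iff)
  show "restrict ((\<lambda>f i. if i < k then f i else 0) f) {..<k} = f" if "f \<in> Pi\<^sub>E {..<k} (\<lambda>_. {..<n})" for f
    using that by (auto simp: fun_eq_iff restrict_def PiE_def extensional_def)
qed (auto simp: natbox_def natk_def PiE_def Pi_def)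

lemma finite_natbox: "finite (natbox k n)"
  using bij_betw_finite[OF bij_natbox] by (simp add: finite_PiE)

lemma card_natbox: "card (natbox k n) = n ^ k"
  using bij_betw_same_card[OF bij_natbox] by (simp add: card_PiE)

text \<open>\<open>C\<close> collects the \<open>b\<close> both of whose translates stay in the box.
  For them the terms at \<open>m + b\<close> and \<open>l + b\<close> cancel, and the bound consists
  of the terms without a partner.\<close>

lemma abs_box_sums_diff_le:
  assumes R: "\<And>b. b \<in> natk k \<Longrightarrow> R (m + b) = (S (l + b) :: 'b)"
    and C: "C = {b \<in> natk k. l + b \<in> natbox k n \<and> m + b \<in> natbox k n}"
  shows "\<bar>(\<Sum>a\<in>natbox k n. of_bool (h = R a)) - (\<Sum>a\<in>natbox k n. of_bool (h = S a))\<bar> \<le>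
    (\<Sum>a\<in>natbox k n - (+) m ` C. of_bool (h = R a)) + (\<Sum>a\<in>natbox k n - (+) l ` C. of_bool (h = S a) :: real)"
proof -
  have sub: "(+) m ` C \<subseteq> natbox k n" "(+) l ` C \<subseteq> natbox k n" using C by auto
  have "(\<Sum>a\<in>(+) m ` C. of_bool (h = R a)) = (\<Sum>b\<in>C. of_bool (h = R (m + b)) :: real)"
    by (subst sum.reindex) (auto simp: inj_on_def)
  also have "\<dots> = (\<Sum>b\<in>C. of_bool (h = S (l + b)))"
    using R C by (intro sum.cong) auto
  also have "\<dots> = (\<Sum>a\<in>(+) l ` C. of_bool (h = S a))"
    by (subst sum.reindex) (auto simp: inj_on_def)
  finally have eq: "(\<Sum>a\<in>(+) m ` C. of_bool (h = R a)) = (\<Sum>a\<in>(+) l ` C. of_bool (h = S a) :: real)" .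
  have "(\<Sum>a\<in>natbox k n. of_bool (h = R a)) = (\<Sum>a\<in>natbox k n - (+) m ` C. of_bool (h = R a)) + (\<Sum>a\<in>(+) m ` C. of_bool (h = R a) :: real)"
    "(\<Sum>a\<in>natbox k n. of_bool (h = S a)) = (\<Sum>a\<in>natbox k n - (+) l ` C. of_bool (h = S a)) + (\<Sum>a\<in>(+) l ` C. of_bool (h = S a) :: real)"
    using sum.subset_diff[OF sub(1) finite_natbox] sum.subset_diff[OF sub(2) finite_natbox] by blast+
  moreover have "0 \<le> (\<Sum>a\<in>natbox k n - (+) m ` C. of_bool (h = R a) :: real)"
    "0 \<le> (\<Sum>a\<in>natbox k n - (+) l ` C. of_bool (h = S a) :: real)"
    by (simp_all add: sum_nonneg)
  ultimately show ?thesis using eq by linarith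
qed

text \<open>Translation is injective, so each leftover set has \<open>n ^ k\<close> minus the number
  of elements of \<open>C\<close> points.\<close>

lemma card_natbox_overlap:
  assumes "l \<in> natk k" "m \<in> natk k" "\<forall>i. l i \<le> M \<and> m i \<le> M"
    and C: "C = {b \<in> natk k. l + b \<in> natbox k n \<and> m + b \<in> natbox k n}"
  shows "real (card (natbox k n - (+) m ` C)) \<le> real n ^ k - real (n - M) ^ k"
    "real (card (natbox k n - (+) l ` C)) \<le> real n ^ k - real (n - M) ^ k"
proof -
  have sub: "(+) m ` C \<subseteq> natbox k n" "(+) l ` C \<subseteq> natbox k n" using C by auto
  have fin: "finite C" using finite_imageD[OF finite_subset[OF sub(1) finite_natbox]] by (auto simp: inj_on_def)
  \<comment> \<open>Translating by at most \<open>M\<close> in each coordinate keeps a box of side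
    \<open>n - M\<close> inside one of side \<open>n\<close>.\<close>
  have "natbox k (n - M) \<subseteq> C"
  proof
    fix b assume b: "b \<in> natbox k (n - M)"
    have "l i + b i < n \<and> m i + b i < n" if "i < k" for i
    proof -
      have "b i < n - M" "l i \<le> M" "m i \<le> M" using b that assms(3) by (auto simp: natbox_def)
      then show ?thesis by linarith
    qed
    then show "b \<in> C" using b assms(1,2) unfolding C natbox_def by auto
  qed
  then have "(n - M) ^ k \<le> card C" using card_mono[OF fin] card_natbox[of k "n - M"] by metis
  then have c: "real (n - M) ^ k \<le> real (card C)" by (metis of_nat_le_iff of_nat_power)
  have "card ((+) m ` C) = card C" "card ((+) l ` C) = card C" by (auto intro!: card_image simp: inj_on_def)
  moreover have "card (natbox k n - (+) m ` C) + card ((+) m ` C) = n ^ k" "card (natbox k n - (+) l ` C) + card ((+) l ` C) = n ^ k"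
    using card_Diff_subset[OF finite_subset[OF sub(1) finite_natbox] sub(1)] card_mono[OF finite_natbox sub(1)]
      card_Diff_subset[OF finite_subset[OF sub(2) finite_natbox] sub(2)] card_mono[OF finite_natbox sub(2)] card_natbox[of k n] by simp_all
  ultimately have "real (card (natbox k n - (+) m ` C)) + real (card C) = real n ^ k"
    "real (card (natbox k n - (+) l ` C)) + real (card C) = real n ^ k" by (metis of_nat_add of_nat_power)+
  then show "real (card (natbox k n - (+) m ` C)) \<le> real n ^ k - real (n - M) ^ k"
    "real (card (natbox k n - (+) l ` C)) \<le> real n ^ k - real (n - M) ^ k" using c by linarith+
qed

text \<open>The factor 2 accounts for the two leftover sets. From \<open>n > M\<close> on, the
  truncated \<open>n - M\<close> is a true difference and the quotient is a power of
  \<open>1 - M / n\<close>, up to constants.\<close>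

lemma box_ratio_tendsto: "(\<lambda>n. 2 * (real n ^ k - real (n - M) ^ k) / real n ^ k) \<longlonglongrightarrow> 0"
proof (rule Lim_transform_eventually)
  have "(\<lambda>n. 2 * (1 - (1 - real M / real n) ^ k)) \<longlonglongrightarrow> 2 * (1 - (1 - 0) ^ k)"
    by (intro tendsto_intros lim_const_over_n)
  then show "(\<lambda>n. 2 * (1 - (1 - real M / real n) ^ k)) \<longlonglongrightarrow> 0" by simp
  show "\<forall>\<^sub>F n in sequentially. 2 * (1 - (1 - real M / real n) ^ k) = 2 * (real n ^ k - real (n - M) ^ k) / real n ^ k"
    using eventually_gt_at_top[of M]
  proof eventually_elim
    case (elim n)
    then have "1 - real M / real n = real (n - M) / real n" by (simp add: of_nat_diff field_simps)
    then show ?case using elim by (simp add: power_divide field_simps)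
  qed
qed

section \<open>Box averages on the fibres\<close>

context cofinal_graph
begin

definition shift_class :: "(nat \<Rightarrow> nat) \<Rightarrow> 'a path \<Rightarrow> ('a path \<times> (nat \<Rightarrow> int) \<times> 'a path) set" where
  "shift_class a x = arrow_class x (intvec a) (T a x)"

lemma matched_shift: "x \<in> X \<Longrightarrow> a \<in> N \<Longrightarrow> matched a 0 x (T a x)"
  by (simp add: matched_def)

lemma section_mor_G: "x \<in> X \<Longrightarrow> a \<in> N \<Longrightarrow> (x, intvec a, T a x) \<in> mor G"
  using nbd_self[OF matched_shift] nbd_subset_mor[OF matched_shift] by fastforce

lemma shift_class_fibre: "x \<in> X \<Longrightarrow> a \<in> N \<Longrightarrow> shift_class a x \<in> rfibre H (unit_class x)"
  using section_mor_G H_ops(2) by (auto simp: rfibre_def shift_class_def unit_class_def)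

lemma fibre_E:
  assumes "A \<in> rfibre H (unit_class x)" "x \<in> X"
  obtains r z where "A = arrow_class x r z" "(x, r, z) \<in> mor G" "z \<in> X"
proof -
  have A: "A \<in> mor H" "rng H A = unit_class x" using assms by (auto simp: rfibre_def)
  obtain a r z where a: "A = arrow_class a r z" "(a, r, z) \<in> mor G" "a \<in> X" "z \<in> X" using A(1) by (rule mor_H_E)
  have "a = x" using A(2) a H_ops(2)[OF a(2)] by (simp add: unit_class_def arrow_class_eq_iff)
  then show ?thesis using a that by blast
qed

text \<open>Every cylinder with the pair \<open>(a, 0)\<close> centred at such an arrow consists of
  arrows of this form. With openness of \<open>px\<close> this gives continuity of the
  section.\<close>

lemma openin_section:
  assumes a: "a \<in> N" shows "openin GT ((\<lambda>x. (x, intvec a, T a x)) ` X)"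
  unfolding openin_GT
proof (intro conjI allI impI)
  show "(\<lambda>x. (x, intvec a, T a x)) ` X \<subseteq> mor G" using section_mor_G a by blast
  fix x p y assume "(x, p, y) \<in> (\<lambda>x. (x, intvec a, T a x)) ` X"
  then have x: "x \<in> X" "p = intvec a" "y = T a x" by auto
  have "nbd a 0 x y \<subseteq> (\<lambda>x. (x, intvec a, T a x)) ` X" unfolding nbd_def by auto
  moreover have "matched a 0 x y" using matched_shift[OF x(1) a] x(3) by simp
  ultimately show "\<exists>l m. matched l m x y \<and> p = intvec l - intvec m \<and> nbd l m x y \<subseteq> (\<lambda>x. (x, intvec a, T a x)) ` X"
    using x(2) by (intro exI[of _ a] exI[of _ 0]) simp
qed

lemma continuous_shift_class:
  assumes a: "a \<in> N" shows "continuous_map XT HT (shift_class a)"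
proof (rule continuous_map_eq)
  have "continuous_map XT GT (\<lambda>x. (x, intvec a, T a x))"
    unfolding continuous_map_def
  proof (intro conjI allI impI)
    show "(\<lambda>x. (x, intvec a, T a x)) \<in> topspace XT \<rightarrow> topspace GT" using section_mor_G a by simp
    fix V assume "openin GT V"
    then have "openin XT (px ` (V \<inter> (\<lambda>x. (x, intvec a, T a x)) ` X))"
      using open_map_px openin_section[OF a] unfolding open_map_def by (simp add: openin_Int)
    moreover have "px ` (V \<inter> (\<lambda>x. (x, intvec a, T a x)) ` X) = {x \<in> topspace XT. (x, intvec a, T a x) \<in> V}"
      by force
    ultimately show "openin XT {x \<in> topspace XT. (x, intvec a, T a x) \<in> V}" by simp
  qed
  then show "continuous_map XT HT (q \<circ> (\<lambda>x. (x, intvec a, T a x)))"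
    using continuous_q by (rule continuous_map_compose)
  fix x assume "x \<in> topspace XT"
  then have "T a x \<in> X" using a by simp
  then show "(q \<circ> (\<lambda>x. (x, intvec a, T a x))) x = shift_class a x" by (simp add: q_eq shift_class_def)
qed

text \<open>On the fibre over \<open>x\<close>, this is the uniform distribution on the classes of
  \<open>(x, a, T\<^sup>a x)\<close> for \<open>a\<close> in the box, with multiplicities.\<close>

definition box_measure :: "nat \<Rightarrow> ('a path \<times> (nat \<Rightarrow> int) \<times> 'a path) set \<Rightarrow> real" where
  "box_measure n A = (\<Sum>a\<in>natbox k n. of_bool (A \<in> shift_class a ` X)) / real n ^ k"

lemma box_N: "a \<in> natbox k n \<Longrightarrow> a \<in> N"
  by (simp add: natbox_def)

text \<open>Membership in the image of \<open>shift_class a\<close> names no base path, but the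
  range of \<open>A\<close> determines it.\<close>

lemma box_measure_fibre:
  assumes "x \<in> X" "A \<in> rfibre H (unit_class x)"
  shows "box_measure n A = (\<Sum>a\<in>natbox k n. of_bool (A = shift_class a x)) / real n ^ k"
proof -
  obtain r z where A: "A = arrow_class x r z" "(x, r, z) \<in> mor G" using assms fibre_E by metis
  have "A \<in> shift_class a ` X \<longleftrightarrow> A = shift_class a x" for a
    using A assms(1) by (auto simp: shift_class_def arrow_class_eq_iff)
  then show ?thesis unfolding box_measure_def by simp
qed

text \<open>Each point mass is summed over the fibre separately, so a class hit by several
  \<open>a\<close> is counted with its multiplicity.\<close>

lemma has_sum_box_measure:
  assumes x: "x \<in> X"
  shows "((\<lambda>A. f A * box_measure n A) has_sum ((\<Sum>a\<in>natbox k n. f (shift_class a x)) / real n ^ k)) (rfibre H (unit_class x))"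
proof -
  let ?R = "rfibre H (unit_class x)"
  have "((\<lambda>A. \<Sum>a\<in>natbox k n. f A * of_bool (A = shift_class a x)) has_sum (\<Sum>a\<in>natbox k n. f (shift_class a x))) ?R"
    by (intro has_sum_sum_family has_sum_delta shift_class_fibre x box_N)
  then have "((\<lambda>A. (1 / real n ^ k) * (\<Sum>a\<in>natbox k n. f A * of_bool (A = shift_class a x))) has_sum (1 / real n ^ k) * (\<Sum>a\<in>natbox k n. f (shift_class a x))) ?R"
    by (rule has_sum_cmult_right)
  also have "?this \<longleftrightarrow> ((\<lambda>A. f A * box_measure n A) has_sum (1 / real n ^ k) * (\<Sum>a\<in>natbox k n. f (shift_class a x))) ?R"
    by (intro has_sum_cong) (simp add: box_measure_fibre[OF x] sum_distrib_left sum_divide_distrib)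
  finally show ?thesis by simp
qed

lemma continuous_prob_system_box_measure:
  assumes n: "n \<ge> 1" shows "continuous_prob_system H HT (box_measure n)"
  unfolding continuous_prob_system_def
proof (intro conjI ballI allI impI)
  show "0 \<le> box_measure n g" for g unfolding box_measure_def by (intro divide_nonneg_nonneg sum_nonneg) auto
  fix u assume "u \<in> units H"
  then obtain x where x: "x \<in> X" "u = unit_class x" unfolding units_H by blast
  show "(box_measure n has_sum 1) (rfibre H u)"
    using has_sum_box_measure[OF x(1), of "\<lambda>_. 1" n] x(2) n by (simp add: card_natbox)
next
  fix f assume "compactly_supported HT f"
  then have f: "continuous_map HT euclideanreal f" by (simp add: compactly_supported_def)
  let ?F = "\<lambda>u. \<Sum>\<^sub>\<infinity>g\<in>rfibre H u. f g * box_measure n g"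
  \<comment> \<open>Along \<open>unit_class\<close> the fibre sum becomes a finite average of the
    functions \<open>f (shift_class a x)\<close>, each continuous in \<open>x\<close>.\<close>
  have "continuous_map XT euclideanreal (\<lambda>x. (\<Sum>a\<in>natbox k n. f (shift_class a x)) / real n ^ k)"
  proof -
    have "continuous_map XT euclideanreal (\<lambda>x. f (shift_class a x))" if "a \<in> natbox k n" for a
      using continuous_map_compose[OF continuous_shift_class[OF box_N[OF that]] f] by (simp add: o_def)
    then have "continuous_map XT euclideanreal (\<lambda>x. \<Sum>a\<in>natbox k n. f (shift_class a x))"
      by (intro continuous_map_sum finite_natbox) 
    then have "continuous_map XT euclideanreal (\<lambda>x. (\<Sum>a\<in>natbox k n. f (shift_class a x)) * (1 / real n ^ k))"
      by (intro continuous_map_real_mult continuous_map_const[THEN iffD2]) auto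
    then show ?thesis by simp
  qed
  then have "continuous_map XT euclideanreal (?F \<circ> unit_class)"
    by (rule continuous_map_eq) (simp add: infsumI[OF has_sum_box_measure])
  then show "continuous_map UT euclideanreal ?F"
    using continuous_compose_quotient_map_eq[of XT UT unit_class] homeomorphic_unit_class[unfolded homeomorphic_map_def]
    by blast
qed

definition variation :: "(('a path \<times> (nat \<Rightarrow> int) \<times> 'a path) set \<Rightarrow> real) \<Rightarrow> ('a path \<times> (nat \<Rightarrow> int) \<times> 'a path) set \<Rightarrow> real" where
  "variation m g = (\<Sum>\<^sub>\<infinity>h\<in>rfibre H (rng H g). \<bar>m (cmp H (ginv H g) h) - m h\<bar>)"

text \<open>Multiplying \<open>h\<close> by the inverse of \<open>g\<close> gives
  \<open>shift_class a y\<close> exactly if \<open>h\<close> is \<open>R a\<close>, the product of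
  \<open>g\<close> with that class. The fibre over \<open>x\<close> thus carries two families of
  point masses, and the common tail \<open>T l x = T m y\<close> identifies \<open>R (m + b)\<close>
  with \<open>shift_class (l + b) x\<close>.\<close>

lemma variation_box_measure_le:
  assumes lm: "matched l m x y" and M: "\<forall>i. l i \<le> M \<and> m i \<le> M" and n: "n \<ge> 1"
    and g: "g = arrow_class x (intvec l - intvec m) y"
  shows "variation (box_measure n) g \<le> 2 * (real n ^ k - real (n - M) ^ k) / real n ^ k"
proof -
  have N: "l \<in> N" "m \<in> N" "x \<in> X" "y \<in> X" "T l x = T m y" using lm by (auto simp: matched_def)
  let ?p = "intvec l - intvec m"
  have gG: "(x, ?p, y) \<in> mor G" using lm mor_G_iff by blast
  have rg: "rng H g = unit_class x" using H_ops(2)[OF gG] g by (simp add: unit_class_def)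
  define R where "R a = arrow_class x (?p + intvec a) (T a y)" for a
  define C where "C = {b \<in> N. l + b \<in> natbox k n \<and> m + b \<in> natbox k n}"
  let ?E = "\<lambda>h. (\<Sum>a\<in>natbox k n - (+) m ` C. of_bool (h = R a)) + (\<Sum>a\<in>natbox k n - (+) l ` C. of_bool (h = shift_class a x) :: real)"
  have Rfib: "R a \<in> rfibre H (unit_class x)" if "a \<in> N" for a
  proof -
    have "(x, ?p + intvec a, T a y) \<in> mor G" using mor_G_cmp[OF gG section_mor_G[OF N(4) that]] .
    then show ?thesis using H_ops(2) by (auto simp: rfibre_def R_def unit_class_def)
  qed
  have RS: "R (m + b) = shift_class (l + b) x" if "b \<in> N" for b
  proof -
    have "T (m + b) y = T b (T m y)" using N that by simp
    also have "\<dots> = T b (T l x)" using N(5) by simp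
    also have "\<dots> = T (l + b) x" using N(1,3) that by simp
    finally show ?thesis unfolding R_def shift_class_def by simp
  qed
  have le: "\<bar>box_measure n (cmp H (ginv H g) h) - box_measure n h\<bar> \<le> (1 / real n ^ k) * ?E h" if h: "h \<in> rfibre H (unit_class x)" for h
  proof -
    obtain r z where hz: "h = arrow_class x r z" "(x, r, z) \<in> mor G" "z \<in> X" using fibre_E[OF h N(3)] by blast
    note gi = mor_G_ginv[OF gG]
    have c: "cmp H (ginv H g) h = arrow_class y (- ?p + r) z"
      unfolding g hz(1) H_ops(3)[OF gG] by (rule H_cmp[OF gi hz(2)])
    have "arrow_class y (- ?p + r) z \<in> rfibre H (unit_class y)"
      using mor_G_cmp[OF gi hz(2)] H_ops(2) by (auto simp: rfibre_def unit_class_def)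
    then have "box_measure n (cmp H (ginv H g) h) = (\<Sum>a\<in>natbox k n. of_bool (arrow_class y (- ?p + r) z = shift_class a y)) / real n ^ k"
      unfolding c using box_measure_fibre[OF N(4)] by blast
    also have "\<dots> = (\<Sum>a\<in>natbox k n. of_bool (h = R a)) / real n ^ k"
    proof -
      have eq: "- ?p + r - intvec a = r - (?p + intvec a)" for a by (simp add: algebra_simps)
      have "arrow_class y (- ?p + r) z = shift_class a y \<longleftrightarrow> h = R a" for a
        unfolding hz(1) shift_class_def R_def arrow_class_eq_iff[OF N(3)] arrow_class_eq_iff[OF N(4)] eq by blast
      then show ?thesis by simp
    qed
    finally have 1: "box_measure n (cmp H (ginv H g) h) = (\<Sum>a\<in>natbox k n. of_bool (h = R a)) / real n ^ k" .
    have "\<bar>(\<Sum>a\<in>natbox k n. of_bool (h = R a)) - (\<Sum>a\<in>natbox k n. of_bool (h = shift_class a x))\<bar> \<le> ?E h"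
      by (rule abs_box_sums_diff_le[where S = "\<lambda>a. shift_class a x", OF RS C_def])
    then show ?thesis
      unfolding 1 box_measure_fibre[OF N(3) h] diff_divide_distrib[symmetric] using n by (simp add: divide_right_mono)
  qed
  \<comment> \<open>Every leftover point mass lies in this fibre and has total mass 1, so the norm
    is bounded by the number of leftovers.\<close>
  have "((\<lambda>h. (1 / real n ^ k) * ?E h) has_sum (1 / real n ^ k) * ((\<Sum>a\<in>natbox k n - (+) m ` C. 1) + (\<Sum>a\<in>natbox k n - (+) l ` C. 1))) (rfibre H (unit_class x))"
  proof (intro has_sum_cmult_right has_sum_add has_sum_sum_family)
    show "((\<lambda>h. of_bool (h = R a)) has_sum (1 :: real)) (rfibre H (unit_class x))" if "a \<in> natbox k n - (+) m ` C" for a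
      using has_sum_delta[OF Rfib[OF box_N], of a n "\<lambda>_. 1"] that by simp
    show "((\<lambda>h. of_bool (h = shift_class a x)) has_sum (1 :: real)) (rfibre H (unit_class x))" if "a \<in> natbox k n - (+) l ` C" for a
      using has_sum_delta[OF shift_class_fibre[OF N(3) box_N], of a n "\<lambda>_. 1"] that by simp
  qed
  then have "variation (box_measure n) g \<le> (1 / real n ^ k) * ((\<Sum>a\<in>natbox k n - (+) m ` C. 1) + (\<Sum>a\<in>natbox k n - (+) l ` C. 1))"
    unfolding variation_def rg by (rule infsum_le_has_sum) (use le in auto)
  also have "\<dots> \<le> (1 / real n ^ k) * (2 * (real n ^ k - real (n - M) ^ k))"
    using card_natbox_overlap[OF N(1,2) M C_def] by (intro mult_left_mono) auto
  finally show ?thesis by simp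
qed

text \<open>Classes of arrows with a pair bounded by \<open>M\<close> form an increasing open
  exhaustion of \<open>H\<close>, so a compact set lies in one stage. Recentring a cylinder keeps
  its pair and hence the bound.\<close>

lemma compactin_HT_bounded:
  assumes K: "compactin HT K"
  obtains M where "\<And>g. g \<in> K \<Longrightarrow> \<exists>l m x y. matched l m x y \<and> (\<forall>i. l i \<le> M \<and> m i \<le> M) \<and> g = arrow_class x (intvec l - intvec m) y"
proof -
  define B where "B M = \<Union>{q ` nbd l m x y | l m x y. matched l m x y \<and> (\<forall>i. l i \<le> M \<and> m i \<le> M)}" for M :: nat
  have mono: "B M \<subseteq> B M'" if "M \<le> M'" for M M'
  proof
    fix A assume "A \<in> B M"
    then obtain l m x y where *: "matched l m x y" "\<forall>i. l i \<le> M \<and> m i \<le> M" "A \<in> q ` nbd l m x y" unfolding B_def by blast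
    then have "\<forall>i. l i \<le> M' \<and> m i \<le> M'" using that by (meson le_trans)
    then show "A \<in> B M'" unfolding B_def using * by blast
  qed
  have "openin HT (B M)" for M
    unfolding B_def
  proof (rule openin_Union)
    fix U assume "U \<in> {q ` nbd l m x y | l m x y. matched l m x y \<and> (\<forall>i. l i \<le> M \<and> m i \<le> M)}"
    then obtain l m x y where "U = q ` nbd l m x y" "matched l m x y" by blast
    then show "openin HT U" using openin_nbd open_map_q unfolding open_map_def by blast
  qed
  moreover have "K \<subseteq> \<Union>(range B)"
  proof
    fix A assume "A \<in> K"
    then have "A \<in> mor H" using K compactin_subset_topspace by fastforce
    then obtain l m x y where *: "matched l m x y" "A \<in> q ` nbd l m x y" by (rule HT_nbhd)
    \<comment> \<open>Beyond the index \<open>k\<close> both vectors vanish, so this finite maximum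
      bounds all coordinates.\<close>
    define M where "M = Max (l ` {..k} \<union> m ` {..k})"
    have "l i \<le> M \<and> m i \<le> M" for i
    proof (cases "i < k")
      case True then show ?thesis unfolding M_def by (auto intro!: Max_ge)
    next
      case False then show ?thesis using *(1) by (auto simp: matched_def natk_def)
    qed
    then have "A \<in> B M" unfolding B_def using * by blast
    then show "A \<in> \<Union>(range B)" by blast
  qed
  ultimately obtain \<F> where F: "finite \<F>" "\<F> \<subseteq> range B" "K \<subseteq> \<Union>\<F>"
    using K unfolding compactin_def by (metis (no_types, lifting) imageE)
  then obtain J where J: "finite J" "\<F> = B ` J" by (meson finite_subset_image)
  \<comment> \<open>Inserting 0 provides a stage even when the selected subcover is empty.\<close>
  have KB: "K \<subseteq> B (Max (insert 0 J))"
  proof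
    fix A assume "A \<in> K"
    then obtain j where "j \<in> J" "A \<in> B j" using F(3) J(2) by blast
    then show "A \<in> B (Max (insert 0 J))" using mono[of j "Max (insert 0 J)"] J(1) by auto
  qed
  show ?thesis
  proof (rule that[of "Max (insert 0 J)"])
    fix A assume "A \<in> K"
    then obtain l m x y where *: "matched l m x y" "\<forall>i. l i \<le> Max (insert 0 J) \<and> m i \<le> Max (insert 0 J)" "A \<in> q ` nbd l m x y"
      using KB unfolding B_def by blast
    then obtain g where g: "g \<in> nbd l m x y" "A = q g" by blast
    obtain x' p y' where g': "g = (x', p, y')" by (cases g)
    note re = nbd_recenter(1,2)[OF *(1) g(1)[unfolded g']]
    have "y' \<in> X" using re(1) by (simp add: matched_def)
    then have "A = arrow_class x' (intvec l - intvec m) y'" using g(2) g' re(2) q_eq by simp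
    then show "\<exists>l m x y. matched l m x y \<and> (\<forall>i. l i \<le> Max (insert 0 J) \<and> m i \<le> Max (insert 0 J)) \<and> A = arrow_class x (intvec l - intvec m) y"
      using re(1) *(2) by blast
  qed
qed

text \<open>The net is the sequence of box averages, given as the image filter of
  \<open>sequentially\<close>. Only \<open>n\<close> from 1 on is used, so that dividing by
  \<open>n ^ k\<close> is legitimate.\<close>

lemma amenable_H: "amenable H HT"
  unfolding amenable_def variation_def[symmetric]
proof (intro exI[of _ "filtermap box_measure sequentially"] conjI allI impI)
  show "filtermap box_measure sequentially \<noteq> bot" by (simp add: filtermap_bot_iff)
  show "\<forall>\<^sub>F m in filtermap box_measure sequentially. continuous_prob_system H HT m"
    unfolding eventually_filtermap using eventually_ge_at_top[of 1]
    by eventually_elim (rule continuous_prob_system_box_measure)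
  fix K assume K: "compactin HT K"
  obtain M where M: "\<And>g. g \<in> K \<Longrightarrow> \<exists>l m x y. matched l m x y \<and> (\<forall>i. l i \<le> M \<and> m i \<le> M) \<and> g = arrow_class x (intvec l - intvec m) y"
    using compactin_HT_bounded[OF K] by blast
  show "uniform_limit K (\<lambda>m g. variation m g) (\<lambda>g. 0) (filtermap box_measure sequentially)"
    unfolding uniform_limit_iff eventually_filtermap
  proof (intro allI impI)
    fix e :: real assume "e > 0"
    then have "\<forall>\<^sub>F n in sequentially. 2 * (real n ^ k - real (n - M) ^ k) / real n ^ k < e"
      using box_ratio_tendsto by (rule order_tendstoD(2)[rotated])
    then show "\<forall>\<^sub>F n in sequentially. \<forall>g\<in>K. dist (variation (box_measure n) g) 0 < e"
      using eventually_ge_at_top[of 1]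
    proof eventually_elim
      case (elim n)
      show ?case
      proof
        fix g assume "g \<in> K"
        then obtain l m x y where "matched l m x y" "\<forall>i. l i \<le> M \<and> m i \<le> M" "g = arrow_class x (intvec l - intvec m) y" using M by blast
        then have "variation (box_measure n) g < e" 
          using le_less_trans[OF variation_box_measure_le elim(1)] elim(2) by blast
        moreover have "0 \<le> variation (box_measure n) g" unfolding variation_def by (rule infsum_nonneg) simp
        ultimately show "dist (variation (box_measure n) g) 0 < e" by (simp add: dist_real_def)
      qed
    qed
  qed
qed

end

theorem corollary2p2:
  fixes k :: nat and \<Lambda> :: "'a kgraph"
  assumes "k_graph k \<Lambda>"
    and "row_finite_no_sources k \<Lambda>"
    and "kgraph_cofinal k \<Lambda>"
  shows "closedin (path_groupoid_topology k \<Lambda>) (interior_isotropy k \<Lambda>)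
    \<and> interior_isotropy k \<Lambda> = {(x, m, x) |x m. x \<in> inf_paths k \<Lambda> \<and> m \<in> Per k \<Lambda>}
    \<and> topological_groupoid_iso
        (interior_isotropy_groupoid k \<Lambda>) (interior_isotropy_topology k \<Lambda>)
        (Per_bundle k \<Lambda>) (Per_bundle_topology k \<Lambda>)
        (\<lambda>(x, m, y). (x, m))
    \<and> etale_groupoid (H_groupoid k \<Lambda>) (H_topology k \<Lambda>)
    \<and> locally_compact_space (H_topology k \<Lambda>)
    \<and> Hausdorff_space (H_topology k \<Lambda>)
    \<and> topologically_principal (H_groupoid k \<Lambda>) (H_topology k \<Lambda>)
    \<and> amenable (H_groupoid k \<Lambda>) (H_topology k \<Lambda>)"
proof -
  interpret rf_cofinal_graph k \<Lambda>
    by unfold_locales (use assms in auto)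
  show ?thesis
    using closedin_I I_eq iso_IG_PB etale_H locally_compact_HT Hausdorff_HT topologically_principal_H amenable_H
    by blast
qed

end
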